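(* Let $1\le r\le N$ and $0<\widehat N\le N-1$, let $S_0\in\mathbb{C}^{r\times r}$ be the diagonal matrix of the $r$ eigenvalues of largest modulus of a given $W_0\in\mathfrak{su}(N)$, and consider the problem $$\dot U+\frac{1}{\hbar_N}\widehat P(US_0U^* )U=0,\qquad \Delta_N\widehat P=\mathcal{T}_{\widehat N}(US_0U^* ),\qquad U(t)\in \mathrm{St}(r,\mathbb{C}^N),$$ over a time interval $(t_\tau,t_{\tau+1}]$ of length $\Delta t$. Apply to it one step of the explicit $N_s$-stage Runge--Kutta Munthe-Kaas (RK-MK) scheme described in the context, with coordinate map $\Psi$ the Cayley transform $\mathrm{cay}(\Omega)=(I-\Omega/2)^{-1}(I+\Omega/2)$. The arithmetic complexity of this step is $$O(Nr^2N_s^2)+O(r^3N_s^4)+O(N\widehat N rN_s).$$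
   Context: Let $N\ge 2$, $\hbar_N=2/\sqrt{N^2-1}$. $\mathfrak{u}(N)$ denotes the skew-Hermitian $N\times N$ matrices, $\mathfrak{su}(N)$ the traceless ones, and $\mathrm{St}(r,\mathbb{C}^N)=\{U\in\mathbb{C}^{N\times r}:U^*U=I_r\}$. Put $s=(N-1)/2$ and, for $0\le\ell\le N-1$, $-\ell\le m\le\ell$, let $T^N_{\ell,m}\in\mathbb{C}^{N\times N}$ (rows and columns indexed by $m_1,m_2\in\{-s,\dots,s\}$) be $$(T^N_{\ell,m})_{m_1,m_2}=\sqrt{\tfrac{N}{4\pi}}\,(-1)^{s-m_1}\sqrt{2\ell+1}\begin{pmatrix}s&\ell&s\\-m_1&m&m_2\end{pmatrix}$$ (Wigner 3j-symbol), a basis of $\mathbb{C}^{N\times N}$. The discrete Laplacian $\Delta_N$ is the linear map with $\Delta_NT^N_{\ell,m}=-\ell(\ell+1)T^N_{\ell,m}$; its kernel consists of multiples of the identity. $\Delta_N^{-1}$ is its inverse on traceless matrices, extended linearly by $\Delta_N^{-1}I=0$. It is known that $\Delta_N$ maps the $m$th diagonal of a matrix to the $m$th diagonal through a tridiagonal symmetric matrix $\Delta^m$ of size $N-|m|$, with $\Delta^{-m}=\Delta^{m}$; the entries of the $\Delta^m$ are given. The operator $\mathcal{T}_{\widehat N}:\mathbb{C}^{N\times N}\to\mathbb{C}^{N\times N}$ sets to zero the $j$th diagonal of its argument for every $|j|>\widehat N$ and leaves the other diagonals unchanged. $\widehat P(X)=\Delta_N^{-1}\mathcal{T}_{\widehat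 N}(X)$. RK-MK step. Set $\widehat{\mathcal{F}}(U)=-\hbar_N^{-1}\widehat P(US_0U^* )U$ and $\widehat{\mathcal{L}}(U)=(I-UU^* )\widehat{\mathcal{F}}(U)U^*-U\widehat{\mathcal{F}}(U)^*\in\mathfrak{u}(N)$. For a coordinate map $\Psi:\mathfrak{u}(N)\to \mathrm{U}(N)$ the right trivialized tangent $\mathrm{d}\Psi$ is defined by $\frac{d}{dt}\Psi(A(t))=\mathrm{d}\Psi_{A(t)}(\dot A(t))\,\Psi(A(t))$; for $\Psi=\mathrm{cay}$ one has $\mathrm{d}\Psi_\Omega^{-1}(A)=(I-\Omega/2)A(I+\Omega/2)$. Let $\{b_i\}_{i=1}^{N_s}$, $\{a_{i,j}\}_{i,j=1}^{N_s}$ be the coefficients of an explicit Runge--Kutta method ($a_{i,j}=0$ for $j\ge i$). Given $U_\tau\in \mathrm{St}(r,\mathbb{C}^N)$: put $\Omega_\tau^1=0$, $U_\tau^1=U_\tau$; for $i=2,\dots,N_s$ compute $\Omega_\tau^i=\Delta t\sum_{j=1}^{i-1}a_{i,j}\,\mathrm{d}\Psi^{-1}_{\Omega_\tau^j}(\widehat{\mathcal{L}}(U_\tau^j))$ and $U_\tau^i=\Psi(\Omega_\tau^i)U_\tau$; then $\Omega_{\tau+1}=\Delta t\sum_{i=1}^{N_s}b_i\,\mathrm{d}\Psi^{-1}_{\Omega_\tau^i}(\widehat{\mathcal{L}}(U_\tau^i))$ and return $U_{\tau+1}=\Psi(\Omega_{\tau+1})U_\tau$. Arithmetic complexity is the number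 of complex arithmetic operations sufficient to compute $U_{\tau+1}$ from $U_\tau$ (matrices such as $\widehat{\mathcal{L}}(U^i_\tau)$ and $\Omega^i_\tau$ may be handled in low-rank factored form, and only needed entries of $US_0U^*$ are formed), with constants independent of $N,\widehat N,r,N_s$. *)

theory Defs
  imports
    Complex_Main
    "Jordan_Normal_Form.Gauss_Jordan_Elimination"
    "Jordan_Normal_Form.Char_Poly"
    "Jordan_Normal_Form.Schur_Decomposition"
begin

subsection \<open>Matrix spaces\<close>

definition mtrace :: "complex mat \<Rightarrow> complex" where
  "mtrace X = (\<Sum>i<dim_row X. X $$ (i, i))"

definition skew_herm :: "nat \<Rightarrow> complex mat set" where
  "skew_herm N = {X \<in> carrier_mat N N. mat_adjoint X = - X}"

definition traceless :: "nat \<Rightarrow> complex mat set" where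
  "traceless N = {X \<in> carrier_mat N N. mtrace X = 0}"

definition su_alg :: "nat \<Rightarrow> complex mat set" where
  "su_alg N = skew_herm N \<inter> traceless N"

definition stiefel :: "nat \<Rightarrow> nat \<Rightarrow> complex mat set" where
  "stiefel r N = {U \<in> carrier_mat N r. mat_adjoint U * U = 1\<^sub>m r}"

text \<open>Eigenvalues are counted with algebraic multiplicity; when moduli are tied at the
  cut-off, every admissible choice of the \<open>r\<close> eigenvalues, in every admissible order,
  is allowed.\<close>

definition dominant_eigenvalue_matrix :: "nat \<Rightarrow> complex mat \<Rightarrow> complex mat \<Rightarrow> bool" where
  "dominant_eigenvalue_matrix r W S \<longleftrightarrow>
     (\<exists>es. char_poly W = (\<Prod>e\<leftarrow>es. [:- e, 1:]) \<and>
           sorted_wrt (\<lambda>x y. cmod y \<le> cmod x) es \<and>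
           r \<le> length es \<and> S = mat_diag r (\<lambda>i. es ! i))"

definition hbar :: "nat \<Rightarrow> real" where
  "hbar N = 2 / sqrt (real N ^ 2 - 1)"

subsection \<open>Wigner 3j-symbols and the discrete Laplacian\<close>

text \<open>Spins and magnetic quantum numbers may be half-integers, so all six arguments are
  passed doubled: \<open>wigner3j_doubled (2 j1) (2 j2) (2 j3) (2 m1) (2 m2) (2 m3)\<close> is the
  3j-symbol with rows \<open>(j1, j2, j3)\<close> and \<open>(m1, m2, m3)\<close>, by Racah's formula in the
  Condon-Shortley phase convention. The summation range is the set of all \<open>k\<close> for which
  every factorial has a non-negative argument.\<close>

definition ifact :: "int \<Rightarrow> real" where
  "ifact k = fact (nat k)"

definition wigner3j_doubled :: "int \<Rightarrow> int \<Rightarrow> int \<Rightarrow> int \<Rightarrow> int \<Rightarrow> int \<Rightarrow> real" where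
  "wigner3j_doubled J1 J2 J3 M1 M2 M3 =
    (if \<bar>M1\<bar> \<le> J1 \<and> \<bar>M2\<bar> \<le> J2 \<and> \<bar>M3\<bar> \<le> J3 \<and>
        even (J1 + M1) \<and> even (J2 + M2) \<and> even (J3 + M3) \<and>
        M1 + M2 + M3 = 0 \<and> \<bar>J1 - J2\<bar> \<le> J3 \<and> J3 \<le> J1 + J2
     then
       (-1) powi ((J1 - J2 - M3) div 2) *
       sqrt (ifact ((J1 + J2 - J3) div 2) * ifact ((J1 - J2 + J3) div 2) *
             ifact ((J2 + J3 - J1) div 2) / ifact ((J1 + J2 + J3) div 2 + 1)) *
       sqrt (ifact ((J1 + M1) div 2) * ifact ((J1 - M1) div 2) *
             ifact ((J2 + M2) div 2) * ifact ((J2 - M2) div 2) *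
             ifact ((J3 + M3) div 2) * ifact ((J3 - M3) div 2)) *
       (\<Sum>k \<in> {k. 0 \<le> k \<and> k \<le> (J1 + J2 - J3) div 2 \<and> k \<le> (J1 - M1) div 2 \<and>
                   k \<le> (J2 + M2) div 2 \<and> 0 \<le> (J3 - J2 + M1) div 2 + k \<and>
                   0 \<le> (J3 - J1 - M2) div 2 + k}.
          (-1) powi k /
          (ifact k * ifact ((J1 + J2 - J3) div 2 - k) * ifact ((J1 - M1) div 2 - k) *
           ifact ((J2 + M2) div 2 - k) * ifact ((J3 - J2 + M1) div 2 + k) *
           ifact ((J3 - J1 - M2) div 2 + k)))
     else 0)"

text \<open>With \<open>s = (N - 1) / 2\<close>, the label \<open>m1 \<in> {-s, ..., s}\<close> is stored at index
  \<open>p = s + m1\<close>; hence \<open>2 s = N - 1\<close>, \<open>2 m1 = 2 p - (N - 1)\<close> and \<open>s - m1 = N - 1 - p\<close>.\<close>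

definition T_basis :: "nat \<Rightarrow> nat \<Rightarrow> int \<Rightarrow> complex mat" where
  "T_basis N l m = mat N N (\<lambda>(p, q). complex_of_real
     (sqrt (real N / (4 * pi)) * (-1) ^ (N - 1 - p) * sqrt (2 * real l + 1) *
      wigner3j_doubled (int N - 1) (2 * int l) (int N - 1)
        (- (2 * int p - (int N - 1))) (2 * m) (2 * int q - (int N - 1))))"

definition linear_on_mats :: "nat \<Rightarrow> (complex mat \<Rightarrow> complex mat) \<Rightarrow> bool" where
  "linear_on_mats N D \<longleftrightarrow>
     (\<forall>X\<in>carrier_mat N N. D X \<in> carrier_mat N N) \<and>
     (\<forall>X\<in>carrier_mat N N. \<forall>Y\<in>carrier_mat N N. D (X + Y) = D X + D Y) \<and>
     (\<forall>c. \<forall>X\<in>carrier_mat N N. D (c \<cdot>\<^sub>m X) = c \<cdot>\<^sub>m D X)"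

text \<open>Because the matrices \<open>T_basis N l m\<close> form a basis, the choice is unique on the
  \<open>N \<times> N\<close> matrices.\<close>

definition discrete_laplacian :: "nat \<Rightarrow> complex mat \<Rightarrow> complex mat" where
  "discrete_laplacian N = (SOME D. linear_on_mats N D \<and>
     (\<forall>l<N. \<forall>m. - int l \<le> m \<and> m \<le> int l \<longrightarrow>
        D (T_basis N l m) = - of_nat (l * (l + 1)) \<cdot>\<^sub>m T_basis N l m))"

text \<open>The inverse on traceless matrices, extended linearly by sending the identity to zero.\<close>

definition inv_laplacian :: "nat \<Rightarrow> complex mat \<Rightarrow> complex mat" where
  "inv_laplacian N X =
     the_inv_into (traceless N) (discrete_laplacian N) (X - (mtrace X / of_nat N) \<cdot>\<^sub>m 1\<^sub>m N)"

text \<open>Entry \<open>(i, j)\<close>, for \<open>i, j < N - m\<close>, of the matrix by which the Laplacian acts on the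
  \<open>m\<close>-th diagonal \<open>(k, k + m)\<close>; the diagonals \<open>m\<close> and \<open>-m\<close> share it.\<close>

definition lap_diag_entry :: "nat \<Rightarrow> nat \<Rightarrow> nat \<Rightarrow> nat \<Rightarrow> complex" where
  "lap_diag_entry N m i j =
     discrete_laplacian N (mat N N (\<lambda>pq. if pq = (j, j + m) then 1 else 0)) $$ (i, i + m)"

definition trunc_diags :: "nat \<Rightarrow> nat \<Rightarrow> complex mat \<Rightarrow> complex mat" where
  "trunc_diags N Nh X =
     mat N N (\<lambda>(p, q). if \<bar>int q - int p\<bar> \<le> int Nh then X $$ (p, q) else 0)"

definition P_hat :: "nat \<Rightarrow> nat \<Rightarrow> complex mat \<Rightarrow> complex mat" where
  "P_hat N Nh X = inv_laplacian N (trunc_diags N Nh X)"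

subsection \<open>The Runge--Kutta Munthe-Kaas step\<close>

definition F_hat :: "nat \<Rightarrow> nat \<Rightarrow> complex mat \<Rightarrow> complex mat \<Rightarrow> complex mat" where
  "F_hat N Nh S U =
     complex_of_real (- inverse (hbar N)) \<cdot>\<^sub>m (P_hat N Nh (U * S * mat_adjoint U) * U)"

definition L_hat :: "nat \<Rightarrow> nat \<Rightarrow> complex mat \<Rightarrow> complex mat \<Rightarrow> complex mat" where
  "L_hat N Nh S U =
     (1\<^sub>m N - U * mat_adjoint U) * F_hat N Nh S U * mat_adjoint U
     - U * mat_adjoint (F_hat N Nh S U)"

definition cay :: "nat \<Rightarrow> complex mat \<Rightarrow> complex mat" where
  "cay N \<Omega> = the (mat_inverse (1\<^sub>m N - (1/2) \<cdot>\<^sub>m \<Omega>)) * (1\<^sub>m N + (1/2) \<cdot>\<^sub>m \<Omega>)"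

definition has_mat_derivative ::
    "nat \<Rightarrow> (real \<Rightarrow> complex mat) \<Rightarrow> complex mat \<Rightarrow> real \<Rightarrow> bool" where
  "has_mat_derivative N \<alpha> D t \<longleftrightarrow>
     (\<forall>i<N. \<forall>j<N. ((\<lambda>u. \<alpha> u $$ (i, j)) has_vector_derivative D $$ (i, j)) (at t))"

definition right_triv_tangent ::
    "nat \<Rightarrow> (complex mat \<Rightarrow> complex mat) \<Rightarrow> complex mat \<Rightarrow> complex mat \<Rightarrow> complex mat" where
  "right_triv_tangent N \<Psi> \<Omega> A = (THE B. B \<in> carrier_mat N N \<and>
     (\<forall>\<alpha>. (\<forall>t. \<alpha> t \<in> skew_herm N) \<and> \<alpha> 0 = \<Omega> \<and> has_mat_derivative N \<alpha> A 0 \<longrightarrow>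
          has_mat_derivative N (\<lambda>t. \<Psi> (\<alpha> t)) (B * \<Psi> \<Omega>) 0))"

definition inv_right_triv_tangent ::
    "nat \<Rightarrow> (complex mat \<Rightarrow> complex mat) \<Rightarrow> complex mat \<Rightarrow> complex mat \<Rightarrow> complex mat" where
  "inv_right_triv_tangent N \<Psi> \<Omega> = the_inv_into (skew_herm N) (right_triv_tangent N \<Psi> \<Omega>)"

definition mat_lincomb ::
    "nat \<Rightarrow> 'i set \<Rightarrow> ('i \<Rightarrow> real) \<Rightarrow> ('i \<Rightarrow> complex mat) \<Rightarrow> complex mat" where
  "mat_lincomb N J c M =
     mat N N (\<lambda>pq. \<Sum>j\<in>J. complex_of_real (c j) * M j $$ pq)"

lemma mat_lincomb_cong [fundef_cong]:
  assumes "N = N'" "J = J'" "c = c'" "\<And>j. j \<in> J' \<Longrightarrow> M j = M' j"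
  shows "mat_lincomb N J c M = mat_lincomb N' J' c' M'"
  using assms by (simp add: mat_lincomb_def cong: sum.cong)

text \<open>In the following definitions \<open>\<Psi>\<close> is the coordinate map, \<open>L\<close> the vector field on the
  Lie algebra, \<open>a\<close>, \<open>b\<close> the Runge--Kutta coefficients (indexed from \<open>1\<close>) and \<open>dt\<close> the step
  length.\<close>

definition explicit_rk :: "nat \<Rightarrow> (nat \<Rightarrow> nat \<Rightarrow> real) \<Rightarrow> bool" where
  "explicit_rk Ns a \<longleftrightarrow> (\<forall>i\<in>{1..Ns}. \<forall>j\<in>{1..Ns}. i \<le> j \<longrightarrow> a i j = 0)"

fun rkmk_Omega :: "nat \<Rightarrow> (complex mat \<Rightarrow> complex mat) \<Rightarrow> (complex mat \<Rightarrow> complex mat) \<Rightarrow>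
    (nat \<Rightarrow> nat \<Rightarrow> real) \<Rightarrow> real \<Rightarrow> complex mat \<Rightarrow> nat \<Rightarrow> complex mat" where
  "rkmk_Omega N \<Psi> L a dt U i =
     (if i \<le> 1 then 0\<^sub>m N N
      else complex_of_real dt \<cdot>\<^sub>m mat_lincomb N {1..<i} (a i)
        (\<lambda>j. inv_right_triv_tangent N \<Psi> (rkmk_Omega N \<Psi> L a dt U j)
               (L (if j = 1 then U else \<Psi> (rkmk_Omega N \<Psi> L a dt U j) * U))))"

declare rkmk_Omega.simps [simp del]

definition rkmk_stage :: "nat \<Rightarrow> (complex mat \<Rightarrow> complex mat) \<Rightarrow> (complex mat \<Rightarrow> complex mat) \<Rightarrow>
    (nat \<Rightarrow> nat \<Rightarrow> real) \<Rightarrow> real \<Rightarrow> complex mat \<Rightarrow> nat \<Rightarrow> complex mat" where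
  "rkmk_stage N \<Psi> L a dt U i = (if i = 1 then U else \<Psi> (rkmk_Omega N \<Psi> L a dt U i) * U)"

definition rkmk_step :: "nat \<Rightarrow> (complex mat \<Rightarrow> complex mat) \<Rightarrow> (complex mat \<Rightarrow> complex mat) \<Rightarrow>
    nat \<Rightarrow> (nat \<Rightarrow> nat \<Rightarrow> real) \<Rightarrow> (nat \<Rightarrow> real) \<Rightarrow> real \<Rightarrow> complex mat \<Rightarrow> complex mat" where
  "rkmk_step N \<Psi> L Ns a b dt U =
     \<Psi> (complex_of_real dt \<cdot>\<^sub>m mat_lincomb N {1..Ns} b
          (\<lambda>i. inv_right_triv_tangent N \<Psi> (rkmk_Omega N \<Psi> L a dt U i)
                 (L (rkmk_stage N \<Psi> L a dt U i)))) * U"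

subsection \<open>Arithmetic complexity: straight-line programs\<close>

text \<open>A program is a list of instructions without branching. The \<open>k\<close>-th instruction writes its
  result to register \<open>k\<close>; its operands are input data, integer constants or
  earlier registers. Every instruction is one complex arithmetic operation, complex conjugation
  included, so the length of the program is its operation count. A program that divides by zero
  or reads an unwritten register has no result.\<close>

datatype 'i operand = Input 'i | Const int | Reg nat

datatype 'i instr =
    Add "'i operand" "'i operand"
  | Sub "'i operand" "'i operand"
  | Mul "'i operand" "'i operand"
  | Div "'i operand" "'i operand"
  | Conj "'i operand"

fun operand_value :: "('i \<Rightarrow> complex) \<Rightarrow> complex list \<Rightarrow> 'i operand \<Rightarrow> complex option" where
  "operand_value env rs (Input x) = Some (env x)"
| "operand_value env rs (Const k) = Some (of_int k)"
| "operand_value env rs (Reg k) = (if k < length rs then Some (rs ! k) else None)"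

fun binary_value ::
    "(complex \<Rightarrow> complex \<Rightarrow> complex) \<Rightarrow> complex option \<Rightarrow> complex option \<Rightarrow> complex option" where
  "binary_value f (Some u) (Some v) = Some (f u v)"
| "binary_value f _ _ = None"

fun instr_value :: "('i \<Rightarrow> complex) \<Rightarrow> complex list \<Rightarrow> 'i instr \<Rightarrow> complex option" where
  "instr_value env rs (Add x y) = binary_value (+) (operand_value env rs x) (operand_value env rs y)"
| "instr_value env rs (Sub x y) = binary_value (-) (operand_value env rs x) (operand_value env rs y)"
| "instr_value env rs (Mul x y) = binary_value (*) (operand_value env rs x) (operand_value env rs y)"
| "instr_value env rs (Div x y) =
     (if operand_value env rs y = Some 0 then None
      else binary_value (/) (operand_value env rs x) (operand_value env rs y))"
| "instr_value env rs (Conj x) = map_option cnj (operand_value env rs x)"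

fun run_program :: "('i \<Rightarrow> complex) \<Rightarrow> 'i instr list \<Rightarrow> complex list \<Rightarrow> complex list option" where
  "run_program env [] rs = Some rs"
| "run_program env (c # cs) rs =
     (case instr_value env rs c of None \<Rightarrow> None | Some v \<Rightarrow> run_program env cs (rs @ [v]))"

definition computes_matrix :: "('i \<Rightarrow> complex) \<Rightarrow> 'i instr list \<Rightarrow> (nat \<Rightarrow> nat \<Rightarrow> 'i operand) \<Rightarrow>
    complex mat \<Rightarrow> bool" where
  "computes_matrix env prog out Y \<longleftrightarrow>
     (\<exists>rs. run_program env prog [] = Some rs \<and>
        (\<forall>i<dim_row Y. \<forall>j<dim_col Y. operand_value env rs (out i j) = Some (Y $$ (i, j))))"

text \<open>The data a program for one step may read: the entries of the current iterate, the diagonal of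
  \<open>S\<close>, the Runge--Kutta coefficients, the step length, the number \<open>hbar N\<close> and the entries of
  the tridiagonal matrices representing the Laplacian on the diagonals.\<close>

datatype step_input =
    In_U nat nat
  | In_S nat
  | In_a nat nat
  | In_b nat
  | In_dt
  | In_hbar
  | In_lap nat nat nat

fun step_env :: "nat \<Rightarrow> complex mat \<Rightarrow> (nat \<Rightarrow> nat \<Rightarrow> real) \<Rightarrow> (nat \<Rightarrow> real) \<Rightarrow> real \<Rightarrow>
    complex mat \<Rightarrow> step_input \<Rightarrow> complex" where
  "step_env N S a b dt U (In_U i j) = (if i < dim_row U \<and> j < dim_col U then U $$ (i, j) else 0)"
| "step_env N S a b dt U (In_S i) = (if i < dim_row S then S $$ (i, i) else 0)"
| "step_env N S a b dt U (In_a i j) = complex_of_real (a i j)"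
| "step_env N S a b dt U (In_b i) = complex_of_real (b i)"
| "step_env N S a b dt U In_dt = complex_of_real dt"
| "step_env N S a b dt U In_hbar = complex_of_real (hbar N)"
| "step_env N S a b dt U (In_lap m i j) =
     (if i + m < N \<and> j + m < N then lap_diag_entry N m i j else 0)"

end

theory Submission
  imports Defs
begin

text \<open>
  The step costs little because matrices of size \<open>N \<times> N\<close> only occur through a band of diagonals or in
  factored form. Three observations carry the proof.

  \<^emph>\<open>The Laplacian is tridiagonal on every diagonal.\<close> Written out, the 3j-symbols in the tensors
  \<open>T_basis N l m\<close> are alternating sums satisfying a three-term recurrence along the diagonal
  (\<open>racah_sum_recurrence\<close>, proved by creative telescoping). This recurrence says that the tensors are
  eigenvectors of an explicit symmetric tridiagonal operator; as symmetric eigenvectors with different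
  eigenvalues they are orthogonal, and they are numerous enough to span, so the discrete Laplacian is
  that operator (\<open>discrete_laplacian_eq\<close>). The pivots of Gaussian elimination on a diagonal are bounded
  below by explicit numbers (\<open>lap_pivot_ge\<close>), positive except at the end of the main diagonal, where
  the trace condition takes over. So the stream matrix
  \<open>\<Delta>\<^sup>-\<^sup>1\<T>(USU\<^sup>*)\<close>, which vanishes outside the band, costs \<open>O(N)\<close> operations for each of its
  \<open>2 Nh + 1\<close> diagonals. The band entries of \<open>USU\<^sup>*\<close> and the product with \<open>U\<close> cost \<open>O(r)\<close> per band entry.
  This is the term \<open>N Nh r\<close> of a stage.

  \<^emph>\<open>All matrices have low rank.\<close> The inverse tangent of the Cayley transform at a skew-Hermitian \<open>\<Omega>\<close> is
  \<open>A \<mapsto> K A K\<^sup>*\<close> with \<open>K = 1 - \<Omega>/2\<close> (\<open>inv_right_triv_tangent_cay\<close>). The vector field at \<open>U\<close> is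
  \<open>G U\<^sup>* - U G\<^sup>*\<close> with \<open>G\<close> of size \<open>N \<times> r\<close>, hence every increment is \<open>V Z\<^sup>* - Z V\<^sup>*\<close> with \<open>V = K G\<close> and
  \<open>Z = K U\<close>, and \<open>\<Omega>\<close> in stage \<open>i\<close> is a product \<open>P D Q\<^sup>*\<close> with \<open>2 r (i - 1)\<close> columns. By the
  Woodbury identity, \<open>cay(\<Omega>) U = U + P D y\<close> where \<open>y\<close> solves a system of size \<open>2 r (i - 1)\<close> with the
  matrix \<open>1 - Q\<^sup>*P D/2\<close> (\<open>St_entry\<close>). The Gram matrix \<open>Q\<^sup>*P\<close> grows by one block row and one block
  column per stage. Products with \<open>P\<close> and \<open>Q\<close> cost \<open>O(N r\<^sup>2 Ns)\<close> per stage, the solve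
  \<open>O(r\<^sup>3 Ns\<^sup>3)\<close>.

  \<^emph>\<open>No branching is needed.\<close> A straight-line program cannot choose pivots. The small system is
  therefore solved through a Gram-Schmidt process in the inner product of its normal equations, which
  divides only by the squared norms of images of nonzero vectors (\<open>conj_solve\<close>). The matrix of the
  system is injective because a skew-Hermitian matrix has no nonzero real eigenvalue.

  Adding up over the stages and treating the final update as one more stage gives the bound.
\<close>

section \<open>Straight-line programs\<close>

lemma run_program_append:
  "run_program env (p @ q) rs = Option.bind (run_program env p rs) (run_program env q)"
  by (induction p arbitrary: rs) (auto split: option.split)

lemma run_program_extends: "run_program env p rs = Some rs' \<Longrightarrow> \<exists>ts. rs' = rs @ ts"
  by (induction p arbitrary: rs) (fastforce split: option.splits)+

lemma operand_value_extends:
  "operand_value env rs x = Some v \<Longrightarrow> operand_value env (rs @ ts) x = Some v"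
  by (cases x) (auto simp: nth_append split: if_splits)

definition ents :: "nat \<Rightarrow> nat \<Rightarrow> (nat \<Rightarrow> nat \<Rightarrow> 'a) \<Rightarrow> 'a set" where
  "ents p q x = {x i j | i j. i < p \<and> j < q}"

lemma ents_mem [simp]: "i < p \<Longrightarrow> j < q \<Longrightarrow> x i j \<in> ents p q x"
  unfolding ents_def by blast

text \<open>The elements of \<open>E\<close> are the admissible inputs, and quantities are functions of the input. A program
  holds a quantity in an operand if that one operand evaluates to it for every admissible input, so
  the program itself cannot depend on the input.\<close>
locale straight_line =
  fixes env :: "'e \<Rightarrow> 'i \<Rightarrow> complex" and E :: "'e set"
begin

definition runs :: "'i instr list \<Rightarrow> bool" where
  "runs prog \<longleftrightarrow> (\<forall>e\<in>E. run_program (env e) prog [] \<noteq> None)"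

definition holds :: "'i instr list \<Rightarrow> 'i operand \<Rightarrow> ('e \<Rightarrow> complex) \<Rightarrow> bool" where
  "holds prog x f \<longleftrightarrow> (\<forall>e\<in>E. \<exists>rs. run_program (env e) prog [] = Some rs \<and>
     operand_value (env e) rs x = Some (f e))"

text \<open>Every program that holds the quantities in \<open>K\<close> has an extension by at most \<open>c\<close> instructions which
  holds those in \<open>L\<close>. Stated for all programs, this notion composes with additive costs and keeps
  register numbers out of all later arguments.\<close>
definition derives :: "('e \<Rightarrow> complex) set \<Rightarrow> nat \<Rightarrow> ('e \<Rightarrow> complex) set \<Rightarrow> bool" where
  "derives K c L \<longleftrightarrow> (\<forall>prog. runs prog \<and> (\<forall>f\<in>K. \<exists>x. holds prog x f) \<longrightarrow>
     (\<exists>prog'. length prog' \<le> c \<and> runs (prog @ prog') \<and> (\<forall>f\<in>L. \<exists>x. holds (prog @ prog') x f)))"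

lemma holds_append:
  assumes "holds p x f" "runs (p @ q)" shows "holds (p @ q) x f"
  unfolding holds_def
proof
  fix e assume e: "e \<in> E"
  then obtain rs where rs: "run_program (env e) p [] = Some rs" "operand_value (env e) rs x = Some (f e)"
    using assms(1) by (auto simp: holds_def)
  obtain rs' where rs': "run_program (env e) (p @ q) [] = Some rs'"
    using assms(2) e by (auto simp: runs_def)
  then have "run_program (env e) q rs = Some rs'" using rs by (simp add: run_program_append)
  then obtain ts where "rs' = rs @ ts" using run_program_extends by blast
  then show "\<exists>rs. run_program (env e) (p @ q) [] = Some rs \<and> operand_value (env e) rs x = Some (f e)"
    using rs' rs operand_value_extends by blast
qed

lemma derives_mono:
  assumes "derives K c L" "K \<subseteq> K'" "c \<le> c'" "L' \<subseteq> L" shows "derives K' c' L'"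
  unfolding derives_def
proof (intro allI impI)
  fix prog assume "runs prog \<and> (\<forall>f\<in>K'. \<exists>x. holds prog x f)"
  then have "runs prog \<and> (\<forall>f\<in>K. \<exists>x. holds prog x f)" using assms(2) by blast
  then obtain prog' where "length prog' \<le> c" "runs (prog @ prog')" "\<forall>f\<in>L. \<exists>x. holds (prog @ prog') x f"
    using assms(1) unfolding derives_def by blast
  then show "\<exists>prog'. length prog' \<le> c' \<and> runs (prog @ prog') \<and> (\<forall>f\<in>L'. \<exists>x. holds (prog @ prog') x f)"
    using assms(3,4) by (intro exI[of _ prog']) (auto intro: order_trans)
qed

lemma derives_subset: "L \<subseteq> K \<Longrightarrow> derives K c L"
  unfolding derives_def by (intro allI impI exI[of _ "[]"]) auto

lemma derives_seq:
  assumes "derives K c L" "derives (K \<union> L) d M" shows "derives K (c + d) (L \<union> M)"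
  unfolding derives_def
proof (intro allI impI)
  fix p assume p: "runs p \<and> (\<forall>f\<in>K. \<exists>x. holds p x f)"
  then obtain q where q: "length q \<le> c" "runs (p @ q)" "\<forall>f\<in>L. \<exists>x. holds (p @ q) x f"
    using assms(1) unfolding derives_def by blast
  have "runs (p @ q) \<and> (\<forall>f\<in>K \<union> L. \<exists>x. holds (p @ q) x f)"
    using p q holds_append by blast
  then obtain r where r: "length r \<le> d" "runs ((p @ q) @ r)" "\<forall>f\<in>M. \<exists>x. holds ((p @ q) @ r) x f"
    using assms(2) unfolding derives_def by blast
  have "\<forall>f\<in>L \<union> M. \<exists>x. holds ((p @ q) @ r) x f" using q r holds_append by blast
  then show "\<exists>p'. length p' \<le> c + d \<and> runs (p @ p') \<and> (\<forall>f\<in>L \<union> M. \<exists>x. holds (p @ p') x f)"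
    using q r by (intro exI[of _ "q @ r"]) auto
qed

lemma derives_then: "derives K c L \<Longrightarrow> derives (K \<union> L) d M \<Longrightarrow> derives K (c + d) M"
  using derives_mono[OF derives_seq[of K c L d M] subset_refl le_refl] by blast

lemma derives_cong:
  assumes "derives K c {f}" "\<And>e. e \<in> E \<Longrightarrow> f e = g e" shows "derives K c {g}"
proof -
  have "holds p x f = holds p x g" for p x unfolding holds_def using assms(2) by auto
  then show ?thesis using assms(1) unfolding derives_def by simp
qed

lemma derives_const: "derives K 0 {\<lambda>_. of_int k}"
  unfolding derives_def
  by (intro allI impI exI[of _ "[]"])
    (auto simp: holds_def runs_def intro!: exI[of _ "Const k"])

lemma derives_input: "derives K 0 {\<lambda>e. env e x}"
  unfolding derives_def
  by (intro allI impI exI[of _ "[]"])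
    (auto simp: holds_def runs_def intro!: exI[of _ "Input x"])

text \<open>The result of a new instruction is found in the register whose number is the length of the program,
  the same for all inputs.\<close>
lemma derives_binary:
  fixes h :: "complex \<Rightarrow> complex \<Rightarrow> complex" and I :: "'i operand \<Rightarrow> 'i operand \<Rightarrow> 'i instr"
  assumes f: "derives K c {f}" and g: "derives K d {g}"
    and I: "\<And>x y env rs e. e \<in> E \<Longrightarrow> operand_value env rs x = Some (f e) \<Longrightarrow>
         operand_value env rs y = Some (g e) \<Longrightarrow> instr_value env rs (I x y) = Some (h (f e) (g e))"
  shows "derives K (c + d + 1) {\<lambda>e. h (f e) (g e)}"
proof -
  have "derives K (c + d) ({f} \<union> {g})"
    by (rule derives_seq[OF f]) (rule derives_mono[OF g], auto)
  moreover have "derives ({f} \<union> {g}) 1 {\<lambda>e. h (f e) (g e)}"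
    unfolding derives_def
  proof (intro allI impI)
    fix p assume p: "runs p \<and> (\<forall>k\<in>{f} \<union> {g}. \<exists>x. holds p x k)"
    then obtain x y where xy: "holds p x f" "holds p y g" by auto
    have *: "\<exists>rs. run_program (env e) (p @ [I x y]) [] = Some (rs @ [h (f e) (g e)]) \<and>
              run_program (env e) p [] = Some rs" if e: "e \<in> E" for e
    proof -
      obtain rs where "run_program (env e) p [] = Some rs"
        "operand_value (env e) rs x = Some (f e)" "operand_value (env e) rs y = Some (g e)"
        using xy e unfolding holds_def by fastforce
      then show ?thesis using I[OF e] by (auto simp: run_program_append)
    qed
    show "\<exists>q. length q \<le> 1 \<and> runs (p @ q) \<and> (\<forall>k\<in>{\<lambda>e. h (f e) (g e)}. \<exists>x. holds (p @ q) x k)"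
    proof (intro exI[of _ "[I x y]"] conjI)
      show "runs (p @ [I x y])" unfolding runs_def using * by fastforce
      have "\<exists>m. \<forall>e\<in>E. \<forall>rs. run_program (env e) p [] = Some rs \<longrightarrow> length rs = m"
      proof -
        have "run_program v p rs = Some rs' \<Longrightarrow> length rs' = length rs + length p" for v p rs rs'
          by (induction p arbitrary: rs) (fastforce split: option.splits)+
        then show ?thesis by (intro exI[of _ "length p"]) force
      qed
      then obtain m where m: "\<And>e rs. e \<in> E \<Longrightarrow> run_program (env e) p [] = Some rs \<Longrightarrow> length rs = m"
        by blast
      have "holds (p @ [I x y]) (Reg m) (\<lambda>e. h (f e) (g e))"
        unfolding holds_def using * m by (fastforce simp: nth_append)
      then show "\<forall>k\<in>{\<lambda>e. h (f e) (g e)}. \<exists>z. holds (p @ [I x y]) z k" by blast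
    qed simp
  qed
  then have "derives (K \<union> ({f} \<union> {g})) 1 {\<lambda>e. h (f e) (g e)}"
    by (rule derives_mono) auto
  ultimately show ?thesis by (rule derives_then)
qed

lemma derives_add: "derives K c {f} \<Longrightarrow> derives K d {g} \<Longrightarrow> derives K (c + d + 1) {\<lambda>e. f e + g e}"
  using derives_binary[where I = Add and h = "(+)"] by force

lemma derives_diff: "derives K c {f} \<Longrightarrow> derives K d {g} \<Longrightarrow> derives K (c + d + 1) {\<lambda>e. f e - g e}"
  using derives_binary[where I = Sub and h = "(-)"] by force

lemma derives_mult: "derives K c {f} \<Longrightarrow> derives K d {g} \<Longrightarrow> derives K (c + d + 1) {\<lambda>e. f e * g e}"
  using derives_binary[where I = Mul and h = "(*)"] by force

lemma derives_divide:
  "derives K c {f} \<Longrightarrow> derives K d {g} \<Longrightarrow> (\<And>e. e \<in> E \<Longrightarrow> g e \<noteq> 0) \<Longrightarrow>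
    derives K (c + d + 1) {\<lambda>e. f e / g e}"
  using derives_binary[where I = Div and h = "(/)"] by force

lemma derives_cnj: "derives K c {f} \<Longrightarrow> derives K (c + 1) {\<lambda>e. cnj (f e)}"
  using derives_binary[where I = "\<lambda>x y. Conj x" and h = "\<lambda>u v. cnj u" and K = K and c = c
    and d = 0 and f = f and g = "\<lambda>_. of_int 0", OF _ derives_const] by auto

lemma derives_uminus: "derives K c {f} \<Longrightarrow> derives K (c + 1) {\<lambda>e. - f e}"
  using derives_diff[of K 0 "\<lambda>_. of_int 0" c f, OF derives_const] by simp

lemma derives_Union_lessThan:
  fixes n :: nat
  assumes "\<And>k. k < n \<Longrightarrow> derives (K \<union> (\<Union>j<k. X j)) (c k) (X k)"
  shows "derives K (\<Sum>k<n. c k) (\<Union>k<n. X k)"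
  using assms
proof (induction n)
  case 0 then show ?case by (simp add: derives_subset)
next
  case (Suc n)
  have "derives K ((\<Sum>k<n. c k) + c n) ((\<Union>k<n. X k) \<union> X n)"
    by (intro derives_seq Suc) auto
  then show ?case by (simp add: lessThan_Suc Un_commute add.commute)
qed

text \<open>For quantities that are defined by recursion on \<open>k\<close>.\<close>
lemma derives_recursion:
  assumes "\<And>k. k < n \<Longrightarrow> derives (K \<union> (\<Union>j<k. X j)) c (X k)"
  shows "derives K (n * c) (\<Union>k<n. X k)"
  using derives_Union_lessThan[of n K X "\<lambda>_. c"] assms by simp

lemma derives_family:
  assumes "\<And>k. k < n \<Longrightarrow> derives K c (X k)"
  shows "derives K (n * c) (\<Union>k<n. X k)"
  by (rule derives_recursion, rule derives_mono[OF assms]) auto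

lemma derives_family1:
  assumes "\<And>k. k < n \<Longrightarrow> derives K c {x k}"
  shows "derives K (n * c) {x k | k. k < n}"
proof -
  have "derives K (n * c) (\<Union>k<n. {x k})" by (intro derives_family assms)
  then show ?thesis by (rule derives_mono) auto
qed

lemma derives_family2:
  assumes "\<And>i j. i < p \<Longrightarrow> j < q \<Longrightarrow> derives K c {x i j}"
  shows "derives K (p * q * c) {x i j | i j. i < p \<and> j < q}"
proof -
  have "derives K (p * (q * c)) (\<Union>i<p. {x i j | j. j < q})"
    by (intro derives_family derives_family1 assms)
  then show ?thesis by (rule derives_mono) (auto simp: mult.assoc)
qed

lemma derives_sum:
  assumes "\<And>k. k < n \<Longrightarrow> derives K c {x k}"
  shows "derives K (n * (c + 1)) {\<lambda>e. \<Sum>k<n. x k e}"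
  using assms
proof (induction n)
  case 0
  then show ?case using derives_const[of K 0] by simp
next
  case (Suc n)
  have "derives K (n * (c + 1) + c + 1) {\<lambda>e. (\<Sum>k<n. x k e) + x n e}"
    by (rule derives_add) (use Suc in auto)
  then show ?case by (simp add: algebra_simps)
qed

lemma derives_le: "derives K c L \<Longrightarrow> c \<le> c' \<Longrightarrow> derives K c' L"
  by (rule derives_mono) auto

lemma derives_mem: "f \<in> K \<Longrightarrow> derives K 0 {f}"
  by (rule derives_subset) simp

lemma derives_zero: "derives K 0 {\<lambda>_. 0}" using derives_const[of K 0] by simp
lemma derives_one: "derives K 0 {\<lambda>_. 1}" using derives_const[of K 1] by simp
lemma derives_numeral: "derives K 0 {\<lambda>_. numeral w}" using derives_const[of K "numeral w"] by simp
lemma derives_of_nat: "derives K 0 {\<lambda>_. of_nat m}" using derives_const[of K "int m"] by simp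

lemma derives_ents:
  assumes "\<And>i j. i < p \<Longrightarrow> j < q \<Longrightarrow> derives K c {x i j}"
  shows "derives K (p * q * c) (ents p q x)"
  unfolding ents_def by (rule derives_family2) (rule assms)

lemma derives_Un: "derives K c L \<Longrightarrow> derives K d M \<Longrightarrow> derives K (c + d) (L \<union> M)"
  by (rule derives_seq) (auto elim: derives_mono)

lemma derives_cong_set:
  assumes "derives K c L" "\<And>g. g \<in> L' \<Longrightarrow> \<exists>f\<in>L. \<forall>e\<in>E. f e = g e"
  shows "derives K c L'"
proof -
  have "holds p x f = holds p x g" if "\<forall>e\<in>E. f e = g e" for p x f g
    using that unfolding holds_def by auto
  then have "\<exists>x. holds p x g" if "\<forall>f\<in>L. \<exists>x. holds p x f" "g \<in> L'" for p g
    using assms(2)[OF that(2)] that(1) by metis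
  then show ?thesis using assms(1) unfolding derives_def by meson
qed

lemma program_of_derives:
  assumes "derives {} c L"
  obtains prog where "length prog \<le> c" "runs prog" "\<forall>f\<in>L. \<exists>x. holds prog x f"
proof -
  have "runs []" by (simp add: runs_def)
  with assms obtain prog where "length prog \<le> c" "runs ([] @ prog)" "\<forall>f\<in>L. \<exists>x. holds ([] @ prog) x f"
    unfolding derives_def by blast
  then show ?thesis using that by simp
qed

end

section \<open>Spherical tensors and the discrete Laplacian\<close>

text \<open>The reciprocal factorial, continued by \<open>0\<close>. With this continuation Racah's summation range becomes
  automatic, and \<open>k / k! = 1 / (k - 1)!\<close> holds for all integers.\<close>
definition rfact :: "int \<Rightarrow> real" where
  "rfact k = (if k < 0 then 0 else 1 / fact (nat k))"

lemma rfact_step: "of_int k * rfact k = rfact (k - 1)"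
proof (cases "k \<le> 0")
  case False
  then have "nat k = Suc (nat (k - 1))" "of_int k = (of_nat (Suc (nat (k - 1))) :: real)" by auto
  then show ?thesis using False by (simp add: rfact_def)
qed (auto simp: rfact_def)

lemma rfact_Suc: "rfact k = of_int (k + 1) * rfact (k + 1)"
  using rfact_step[of "k + 1"] by simp

text \<open>The summand of Racah's formula for the entry in row \<open>p\<close> and column \<open>p - m\<close> of the tensor of degree
  \<open>l\<close> and order \<open>m\<close>, where \<open>n = N - 1\<close> is twice the spin.\<close>
definition racah_term :: "int \<Rightarrow> int \<Rightarrow> int \<Rightarrow> int \<Rightarrow> nat \<Rightarrow> real" where
  "racah_term n l m p k = (-1) ^ k * rfact (int k) * rfact (l - int k) * rfact (p - int k) *
     rfact (l + m - int k) * rfact (n - l - p + int k) * rfact (int k - m)"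

definition racah_sum :: "int \<Rightarrow> nat \<Rightarrow> int \<Rightarrow> int \<Rightarrow> real" where
  "racah_sum n l m p = (\<Sum>k<Suc l. racah_term n (int l) m p k)"

text \<open>The three-term recurrence in \<open>p\<close> holds because the same combination of summands is a difference
  \<open>\<tau> (k + 1) - \<tau> k\<close> up to a constant factor, with \<open>\<tau>\<close> vanishing at both ends of the summation
  range.\<close>
lemma racah_sum_recurrence:
  fixes n m p :: int and l :: nat
  defines "q \<equiv> p - m"
  shows "of_int (n + p * (n - q) + q * (n - p) - int l * (int l + 1)) * racah_sum n l m p =
     of_int ((p + 1) * (q + 1)) * racah_sum n l m (p + 1) +
     of_int ((n - p + 1) * (n - q + 1)) * racah_sum n l m (p - 1)"
proof -
  define \<tau> :: "nat \<Rightarrow> real" where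
    "\<tau> k = (-1) ^ k * rfact (int k - 1) * rfact (int l - int k) * rfact (p - int k + 1) *
      rfact (int l + m - int k) * rfact (n - int l - p + int k) * rfact (int k - m - 1)" for k
  have key: "of_int (n + p * (n - q) + q * (n - p) - int l * (int l + 1)) * racah_term n l m p k -
     of_int ((p + 1) * (q + 1)) * racah_term n l m (p + 1) k -
     of_int ((n - p + 1) * (n - q + 1)) * racah_term n l m (p - 1) k
     = of_int (n - int l + 1) * (\<tau> (Suc k) - \<tau> k)" for k
  proof -
    define a b c d h g where "a = int k" and "b = int l - int k" and "c = p - int k"
      and "d = int l + m - int k" and "h = n - int l - p + int k" and "g = int k - m"
    \<comment> \<open>All summands involved are polynomial multiples of \<open>\<beta>\<close>, whose arguments are the largest that occur.\<close>
    define \<beta> where "\<beta> = (-1) ^ k * rfact a * rfact b * rfact (c + 1) * rfact d * rfact (h + 1) * rfact g"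
    have 1: "racah_term n l m p k = of_int ((c + 1) * (h + 1)) * \<beta>"
      unfolding racah_term_def \<beta>_def b_def[symmetric] c_def[symmetric]
        d_def[symmetric] h_def[symmetric] g_def[symmetric] unfolding a_def[symmetric]
      by (subst rfact_Suc[of c], subst rfact_Suc[of h]) simp
    have e: "n - int l - (p + 1) + int k = h - 1" "p + 1 - int k = c + 1"
      "n - int l - (p - 1) + int k = h + 1" "p - 1 - int k = c - 1"
      by (auto simp: h_def c_def)
    have h1: "rfact (h - 1) = of_int (h * (h + 1)) * rfact (h + 1)"
      using rfact_step[of h] rfact_step[of "h + 1"] by (simp add: mult.assoc)
    have c1: "rfact (c - 1) = of_int (c * (c + 1)) * rfact (c + 1)"
      using rfact_step[of c] rfact_step[of "c + 1"] by (simp add: mult.assoc)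
    have 2: "racah_term n l m (p + 1) k = of_int (h * (h + 1)) * \<beta>"
      unfolding racah_term_def \<beta>_def e b_def[symmetric]
        d_def[symmetric] g_def[symmetric] h1 unfolding a_def[symmetric] by simp
    have 3: "racah_term n l m (p - 1) k = of_int (c * (c + 1)) * \<beta>"
      unfolding racah_term_def \<beta>_def e b_def[symmetric]
        d_def[symmetric] g_def[symmetric] c1 unfolding a_def[symmetric] by simp
    have f: "int (Suc k) - 1 = a" "int l - int (Suc k) = b - 1" "p - int (Suc k) + 1 = c"
      "int l + m - int (Suc k) = d - 1" "n - int l - p + int (Suc k) = h + 1" "int (Suc k) - m - 1 = g"
      "p - int k + 1 = c + 1"
      by (auto simp: a_def b_def c_def d_def h_def g_def)
    have 4: "\<tau> (Suc k) = - of_int (b * d * (c + 1)) * \<beta>"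
      unfolding \<tau>_def \<beta>_def f rfact_step[of b, symmetric] rfact_step[of d, symmetric]
      by (subst rfact_Suc[of c]) simp
    have 5: "\<tau> k = of_int (a * g * (h + 1)) * \<beta>"
      unfolding \<tau>_def \<beta>_def f b_def[symmetric]
        d_def[symmetric] h_def[symmetric] g_def[symmetric] unfolding a_def[symmetric] rfact_step[of a, symmetric] rfact_step[of g, symmetric]
      by (subst rfact_Suc[of h]) simp
    have "(n + p * (n - q) + q * (n - p) - int l * (int l + 1)) * ((c + 1) * (h + 1)) -
      ((p + 1) * (q + 1)) * (h * (h + 1)) - ((n - p + 1) * (n - q + 1)) * (c * (c + 1))
      = (n - int l + 1) * (- (b * d * (c + 1)) - a * g * (h + 1))"
      unfolding a_def b_def c_def d_def h_def g_def q_def by (simp add: algebra_simps)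
    then have "of_int ((n + p * (n - q) + q * (n - p) - int l * (int l + 1)) * ((c + 1) * (h + 1)) -
      ((p + 1) * (q + 1)) * (h * (h + 1)) - ((n - p + 1) * (n - q + 1)) * (c * (c + 1))) * \<beta>
      = of_int ((n - int l + 1) * (- (b * d * (c + 1)) - a * g * (h + 1))) * \<beta>"
      by (rule arg_cong)
    then show ?thesis unfolding 1 2 3 4 5
      by (simp only: of_int_mult of_int_diff of_int_minus left_diff_distrib right_diff_distrib mult.assoc mult_minus_left)
  qed
  have "(\<Sum>k<Suc l. \<tau> (Suc k) - \<tau> k) = \<tau> (Suc l) - \<tau> 0" by (rule sum_lessThan_telescope)
  also have "\<dots> = 0" by (simp add: \<tau>_def rfact_def)
  finally have "0 = (\<Sum>k<Suc l. of_int (n - int l + 1) * (\<tau> (Suc k) - \<tau> k))"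
    by (simp only: sum_distrib_left[symmetric] mult_zero_right)
  also have "\<dots> = of_int (n + p * (n - q) + q * (n - p) - int l * (int l + 1)) * racah_sum n l m p -
     of_int ((p + 1) * (q + 1)) * racah_sum n l m (p + 1) -
     of_int ((n - p + 1) * (n - q + 1)) * racah_sum n l m (p - 1)"
    unfolding racah_sum_def by (simp only: key[symmetric] sum_subtractf sum_distrib_left)
  finally show ?thesis by linarith
qed

lemma racah_sum_eq_0:
  assumes "p < 0 \<or> p < m \<or> n < p \<or> n + m < p"
  shows "racah_sum n l m p = 0"
  unfolding racah_sum_def
proof (intro sum.neutral ballI)
  fix k assume "k \<in> {..<Suc l}"
  then have "p - int k < 0 \<or> int k - m < 0 \<or> n - int l - p + int k < 0 \<or> int l + m - int k < 0"
    using assms by auto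
  then show "racah_term n l m p k = 0" by (auto simp: racah_term_def rfact_def)
qed

text \<open>In the first position of a diagonal only one summand survives.\<close>
lemma racah_sum_nonzero:
  assumes "int l \<le> n" "\<bar>m\<bar> \<le> int l"
  shows "racah_sum n l m (max 0 m) \<noteq> 0"
proof -
  have "racah_sum n l m (max 0 m) = (\<Sum>k\<in>{nat m}. racah_term n l m (max 0 m) k)"
    unfolding racah_sum_def
  proof (rule sum.mono_neutral_right)
    show "\<forall>k\<in>{..<Suc l} - {nat m}. racah_term n (int l) m (max 0 m) k = 0"
    proof
      fix k assume "k \<in> {..<Suc l} - {nat m}"
      then have "max 0 m - int k < 0 \<or> int k - m < 0" by auto
      then show "racah_term n (int l) m (max 0 m) k = 0" by (auto simp: racah_term_def rfact_def)
    qed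
  qed (use assms in auto)
  also have "\<dots> \<noteq> 0" using assms by (auto simp: racah_term_def rfact_def)
  finally show ?thesis .
qed

text \<open>The square root in Racah's formula, without the part that is constant along a diagonal. It is the
  weight that turns the recurrence into a symmetric one.\<close>
definition diag_weight :: "nat \<Rightarrow> nat \<Rightarrow> nat \<Rightarrow> real" where
  "diag_weight n p q = sqrt (fact p * fact (n - p) * fact q * fact (n - q))"

lemma T_basis_entry:
  assumes N: "0 < N" and l: "l < N" and m: "\<bar>m\<bar> \<le> int l"
  shows "\<exists>\<kappa> :: real. \<kappa> \<noteq> 0 \<and> (\<forall>p<N. \<forall>q<N. T_basis N l m $$ (p, q) = complex_of_real
       (if int p - int q = m then \<kappa> * diag_weight (N - 1) p q * racah_sum (int N - 1) l m (int p) else 0))"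
proof -
  define n where "n = int N - 1"
  define c1 where "c1 = sqrt (ifact (int l) * ifact (n - int l) * ifact (int l) / ifact (n + int l + 1))"
  define c2 where "c2 = sqrt (ifact (int l + m) * ifact (int l - m))"
  define c0 where "c0 = sqrt (real N / (4 * pi)) * sqrt (2 * real l + 1)"
  define \<kappa> where "\<kappa> = c0 * c1 * c2 * (-1) powi (m + int l)"
  have ln: "int l \<le> n" using l by (simp add: n_def)
  have "\<kappa> \<noteq> 0" using N by (simp add: \<kappa>_def c0_def c1_def c2_def ifact_def)
  moreover have "T_basis N l m $$ (p, q) = complex_of_real
       (if int p - int q = m then \<kappa> * diag_weight (N - 1) p q * racah_sum (int N - 1) l m (int p) else 0)"
    if p: "p < N" and q: "q < N" for p q
  proof (cases "int p - int q = m")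
    case False
    then have "- (2 * int p - (int N - 1)) + 2 * m + (2 * int q - (int N - 1)) \<noteq> 0" by presburger
    then show ?thesis using p q False by (simp add: T_basis_def wigner3j_doubled_def)
  next
    case True
    then have mq: "m = int p - int q" by simp
    have d: "(n - 2 * int l - (2 * int q - n)) div 2 = n - int l - int q"
      "(n + 2 * int l - n) div 2 = int l" "(n - 2 * int l + n) div 2 = n - int l"
      "(2 * int l + n - n) div 2 = int l" "(n + 2 * int l + n) div 2 = n + int l"
      "(n + - (2 * int p - n)) div 2 = n - int p" "(n - - (2 * int p - n)) div 2 = int p"
      "(2 * int l + 2 * m) div 2 = int l + m" "(2 * int l - 2 * m) div 2 = int l - m"
      "(n + (2 * int q - n)) div 2 = int q" "(n - (2 * int q - n)) div 2 = n - int q"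
      "(n - 2 * int l + - (2 * int p - n)) div 2 = n - int l - int p"
      "(n - n - 2 * m) div 2 = - m"
      by presburger+
    have cond: "\<bar>- (2 * int p - n)\<bar> \<le> n \<and> \<bar>2 * m\<bar> \<le> 2 * int l \<and> \<bar>2 * int q - n\<bar> \<le> n \<and>
        even (n + - (2 * int p - n)) \<and> even (2 * int l + 2 * m) \<and> even (n + (2 * int q - n)) \<and>
        - (2 * int p - n) + 2 * m + (2 * int q - n) = 0 \<and> \<bar>n - 2 * int l\<bar> \<le> n \<and> n \<le> n + 2 * int l"
      using p q m ln mq by (auto simp: n_def)
    \<comment> \<open>On the diagonal, the integer sum of the definition is the sum over \<open>k \<le> l\<close>.\<close>
    let ?t = "\<lambda>k. (-1) powi k /
          (ifact k * ifact (int l - k) * ifact (int p - k) *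
           ifact (int l + m - k) * ifact (n - int l - int p + k) * ifact (- m + k))"
    let ?A = "{k. 0 \<le> k \<and> k \<le> int l \<and> k \<le> int p \<and> k \<le> int l + m \<and> 0 \<le> n - int l - int p + k \<and> 0 \<le> - m + k}"
    have "(\<Sum>k\<in>?A. ?t k) = (\<Sum>k\<in>int ` {k. k \<le> l \<and> int k \<in> ?A}. ?t k)"
    proof (rule sum.cong)
      show "?A = int ` {k. k \<le> l \<and> int k \<in> ?A}"
      proof (rule subset_antisym; rule subsetI)
        fix k assume "k \<in> ?A"
        then show "k \<in> int ` {k. k \<le> l \<and> int k \<in> ?A}" by (intro image_eqI[of _ _ "nat k"]) auto
      qed auto
    qed simp
    also have "\<dots> = (\<Sum>k\<in>{k. k \<le> l \<and> int k \<in> ?A}. ?t (int k))" by (subst sum.reindex) auto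
    also have "\<dots> = (\<Sum>k\<in>{k. k \<le> l \<and> int k \<in> ?A}. racah_term n (int l) m (int p) k)"
      by (rule sum.cong) (auto simp: racah_term_def rfact_def ifact_def algebra_simps)
    also have "\<dots> = racah_sum n l m (int p)"
      unfolding racah_sum_def
    proof (rule sum.mono_neutral_left)
      show "\<forall>k\<in>{..<Suc l} - {k. k \<le> l \<and> int k \<in> ?A}. racah_term n (int l) m (int p) k = 0"
      proof
        fix k assume "k \<in> {..<Suc l} - {k. k \<le> l \<and> int k \<in> ?A}"
        then have "int p - int k < 0 \<or> int l + m - int k < 0 \<or> n - int l - int p + int k < 0 \<or> int k - m < 0"
          by auto
        then show "racah_term n (int l) m (int p) k = 0" by (auto simp: racah_term_def rfact_def)
      qed
    qed auto
    finally have S: "(\<Sum>k\<in>?A. ?t k) = racah_sum n l m (int p)" .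
    have "nat (n - int p) = N - 1 - p" "nat (n - int q) = N - 1 - q" using p q by (auto simp: n_def)
    then have W: "sqrt (ifact (n - int p) * ifact (int p) * ifact (int l + m) * ifact (int l - m) *
         ifact (int q) * ifact (n - int q)) = c2 * diag_weight (N - 1) p q"
      by (simp add: c2_def diag_weight_def ifact_def real_sqrt_mult algebra_simps)
    have "wigner3j_doubled n (2 * int l) n (- (2 * int p - n)) (2 * m) (2 * int q - n) =
      (-1) powi (n - int l - int q) * c1 * (c2 * diag_weight (N - 1) p q) * racah_sum n l m (int p)"
      unfolding wigner3j_doubled_def d W[symmetric] S[symmetric] c1_def
      by (rule if_P, rule cond)
    \<comment> \<open>The two alternating signs combine to one that is constant along the diagonal.\<close>
    moreover have "(-1) ^ (N - 1 - p) * (-1) powi (n - int l - int q) = ((-1) powi (m + int l) :: real)"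
    proof -
      have "(-1 :: real) ^ (N - 1 - p) = (-1) powi (n - int p)"
        using p by (simp add: n_def power_int_def of_nat_diff nat_diff_distrib)
      then have "(-1 :: real) ^ (N - 1 - p) * (-1) powi (n - int l - int q) = (-1) powi (n - int p + (n - int l - int q))"
        using power_int_add[of "-1 :: real" "n - int p" "n - int l - int q"] by simp
      also have "n - int p + (n - int l - int q) = (m + int l) + 2 * (n - int p - int l)"
        using mq by simp
      also have "(-1 :: real) powi (a + 2 * b) = (-1) powi a" for a b
        by (simp add: power_int_add power_int_mult)
      finally show ?thesis .
    qed
    ultimately have "sqrt (real N / (4 * pi)) * (-1) ^ (N - 1 - p) * sqrt (2 * real l + 1) *
       wigner3j_doubled n (2 * int l) n (- (2 * int p - n)) (2 * m) (2 * int q - n)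
       = \<kappa> * diag_weight (N - 1) p q * racah_sum n l m (int p)"
      unfolding \<kappa>_def c0_def by (simp add: algebra_simps)
    then show ?thesis unfolding T_basis_def n_def
      using p q True by (subst index_mat(1)) (simp_all del: of_real_mult)
  qed
  ultimately show ?thesis by blast
qed

text \<open>The next two functions are the coefficients of \<open>\<Sum>\<^sub>a [J\<^sub>a, [J\<^sub>a, X]]\<close> for the spin matrices \<open>J\<^sub>a\<close> of
  size \<open>n + 1\<close>: with \<open>s = n/2\<close>, \<open>p = s + m\<^sub>1\<close> and \<open>q = s + m\<^sub>2\<close>, the first is
  \<open>2 (s (s + 1) - m\<^sub>1 m\<^sub>2)\<close>, and the second the product of the two matrix elements of the raising
  operator.\<close>
definition lap_main :: "nat \<Rightarrow> nat \<Rightarrow> nat \<Rightarrow> real" where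
  "lap_main n p q = real n + real p * (real n - real q) + real q * (real n - real p)"

definition lap_off :: "nat \<Rightarrow> nat \<Rightarrow> nat \<Rightarrow> real" where
  "lap_off n p q = sqrt ((real n - real p) * (real p + 1) * ((real n - real q) * (real q + 1)))"

definition tridiag_laplacian :: "nat \<Rightarrow> complex mat \<Rightarrow> complex mat" where
  "tridiag_laplacian N X = mat N N (\<lambda>(p, q).
     - of_real (lap_main (N - 1) p q) * X $$ (p, q) +
     (if p + 1 < N \<and> q + 1 < N then of_real (lap_off (N - 1) p q) * X $$ (p + 1, q + 1) else 0) +
     (if 0 < p \<and> 0 < q then of_real (lap_off (N - 1) (p - 1) (q - 1)) * X $$ (p - 1, q - 1) else 0))"

text \<open>Multiplication by \<open>lap_off\<close> moves the weight to a neighbouring position of the diagonal at the price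
  of an integer factor; these are the factors of the recurrence.\<close>
lemma diag_weight_up:
  assumes "p < n" "q < n"
  shows "lap_off n p q * diag_weight n (Suc p) (Suc q) = (real p + 1) * (real q + 1) * diag_weight n p q"
proof -
  have f: "(fact (n - k) :: real) = (real n - real k) * fact (n - Suc k)" if "k < n" for k
    using that fact_reduce[of "n - k", where 'a = real] by (simp add: of_nat_diff)
  have "lap_off n p q * diag_weight n (Suc p) (Suc q) =
     sqrt (((real p + 1) * (real q + 1))\<^sup>2 * (fact p * fact (n - p) * fact q * fact (n - q)))"
    unfolding lap_off_def diag_weight_def real_sqrt_mult[symmetric] f[OF assms(1)] f[OF assms(2)]
    by (simp add: power2_eq_square algebra_simps)
  also have "\<dots> = (real p + 1) * (real q + 1) * diag_weight n p q"
    unfolding real_sqrt_mult[of "((real p + 1) * (real q + 1))\<^sup>2"] diag_weight_def by simp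
  finally show ?thesis .
qed

lemma diag_weight_down:
  assumes "p < n" "q < n"
  shows "lap_off n p q * diag_weight n p q = (real n - real p) * (real n - real q) * diag_weight n (Suc p) (Suc q)"
proof -
  have f: "(fact (n - k) :: real) = (real n - real k) * fact (n - Suc k)" if "k < n" for k
    using that fact_reduce[of "n - k", where 'a = real] by (simp add: of_nat_diff)
  have "lap_off n p q * diag_weight n p q =
     sqrt (((real n - real p) * (real n - real q))\<^sup>2 * (fact (Suc p) * fact (n - Suc p) * fact (Suc q) * fact (n - Suc q)))"
    unfolding lap_off_def diag_weight_def real_sqrt_mult[symmetric] f[OF assms(1)] f[OF assms(2)]
    by (simp add: power2_eq_square algebra_simps)
  also have "\<dots> = (real n - real p) * (real n - real q) * diag_weight n (Suc p) (Suc q)"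
    unfolding real_sqrt_mult[of "((real n - real p) * (real n - real q))\<^sup>2"] diag_weight_def
    using assms by simp
  finally show ?thesis .
qed

lemma T_basis_carrier: "T_basis N l m \<in> carrier_mat N N"
  by (simp add: T_basis_def)

text \<open>The recurrence of \<open>racah_sum\<close>, multiplied by the weight. At both ends of a diagonal the missing
  neighbour does no harm, since \<open>racah_sum\<close> vanishes there.\<close>
lemma tridiag_laplacian_T_basis:
  assumes l: "l < N" and m: "\<bar>m\<bar> \<le> int l"
  shows "tridiag_laplacian N (T_basis N l m) = - of_nat (l * (l + 1)) \<cdot>\<^sub>m T_basis N l m"
proof -
  have N: "0 < N" using l by simp
  define n where "n = N - 1"
  have Nn: "int N - 1 = int n" "N = Suc n" using N by (auto simp: n_def)
  obtain \<kappa> where "\<kappa> \<noteq> 0" and \<kappa>': "\<And>p q. p < N \<Longrightarrow> q < N \<Longrightarrow> T_basis N l m $$ (p, q) = complex_of_real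
       (if int p - int q = m then \<kappa> * diag_weight (N - 1) p q * racah_sum (int N - 1) l m (int p) else 0)"
    using T_basis_entry[OF N l m] by blast
  note \<kappa> = \<kappa>'[unfolded Nn(1), folded n_def]
  show ?thesis
  proof (rule eq_matI)
    fix p q assume "p < dim_row (- of_nat (l * (l + 1)) \<cdot>\<^sub>m T_basis N l m)"
      "q < dim_col (- of_nat (l * (l + 1)) \<cdot>\<^sub>m T_basis N l m)"
    then have pq: "p < N" "q < N" by (auto simp: T_basis_def)
    let ?f = "racah_sum (int n) l m"
    have "tridiag_laplacian N (T_basis N l m) $$ (p, q) = - of_nat (l * (l + 1)) * T_basis N l m $$ (p, q)"
    proof (cases "int p - int q = m")
      case False
      have 1: "p + 1 < N \<Longrightarrow> q + 1 < N \<Longrightarrow> T_basis N l m $$ (p + 1, q + 1) = 0"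
        using False by (subst \<kappa>) auto
      have 2: "0 < p \<Longrightarrow> 0 < q \<Longrightarrow> T_basis N l m $$ (p - 1, q - 1) = 0"
        using False pq by (subst \<kappa>) auto
      have 3: "T_basis N l m $$ (p, q) = 0" using False pq by (subst \<kappa>) auto
      show ?thesis using pq 1 2 3 by (auto simp: tridiag_laplacian_def)
    next
      case True
      have up: "(if p + 1 < N \<and> q + 1 < N then of_real (lap_off n p q) * T_basis N l m $$ (p + 1, q + 1) else 0)
        = complex_of_real (\<kappa> * diag_weight n p q * ((real p + 1) * (real q + 1) * ?f (int p + 1)))"
      proof (cases "p + 1 < N \<and> q + 1 < N")
        case T: True
        then have "p < n" "q < n" by (auto simp: n_def)
        note u = diag_weight_up[OF this]
        have "T_basis N l m $$ (p + 1, q + 1) = complex_of_real (\<kappa> * diag_weight n (Suc p) (Suc q) * ?f (int p + 1))"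
          using T True by (subst \<kappa>) (auto simp: add.commute)
        then have "of_real (lap_off n p q) * T_basis N l m $$ (p + 1, q + 1) =
          complex_of_real (\<kappa> * (lap_off n p q * diag_weight n (Suc p) (Suc q)) * ?f (int p + 1))" by simp
        then show ?thesis unfolding u using T by (simp add: algebra_simps)
      next
        case F: False
        then have "?f (int p + 1) = 0" using pq True by (intro racah_sum_eq_0) (auto simp: n_def)
        then show ?thesis by (subst if_not_P[OF F]) simp
      qed
      have down: "(if 0 < p \<and> 0 < q then of_real (lap_off n (p - 1) (q - 1)) * T_basis N l m $$ (p - 1, q - 1) else 0)
        = complex_of_real (\<kappa> * diag_weight n p q * ((real n - real p + 1) * (real n - real q + 1) * ?f (int p - 1)))"
      proof (cases "0 < p \<and> 0 < q")
        case T: True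
        then have "p - 1 < n" "q - 1 < n" using pq by (auto simp: n_def)
        note u = diag_weight_down[OF this]
        have p1: "Suc (p - 1) = p" "Suc (q - 1) = q" "real (p - 1) = real p - 1" "real (q - 1) = real q - 1"
          using T by auto
        have "T_basis N l m $$ (p - 1, q - 1) = complex_of_real (\<kappa> * diag_weight n (p - 1) (q - 1) * ?f (int p - 1))"
          using T True pq by (subst \<kappa>) (auto simp: of_nat_diff)
        then have "of_real (lap_off n (p - 1) (q - 1)) * T_basis N l m $$ (p - 1, q - 1) =
          complex_of_real (\<kappa> * (lap_off n (p - 1) (q - 1) * diag_weight n (p - 1) (q - 1)) * ?f (int p - 1))" by simp
        then show ?thesis unfolding u unfolding p1 using T by (simp add: algebra_simps)
      next
        case F: False
        then have "?f (int p - 1) = 0" using pq True by (intro racah_sum_eq_0) (auto simp: n_def)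
        then show ?thesis by (subst if_not_P[OF F]) simp
      qed
      have q: "int p - m = int q" using True by simp
      have rec: "(lap_main n p q - real l * (real l + 1)) * ?f (int p) =
        (real p + 1) * (real q + 1) * ?f (int p + 1) + (real n - real p + 1) * (real n - real q + 1) * ?f (int p - 1)"
        using racah_sum_recurrence[of "int n" "int p" m l] unfolding q
        by (simp add: lap_main_def)
      have tri: "tridiag_laplacian N (T_basis N l m) $$ (p, q) = - of_real (lap_main n p q) * T_basis N l m $$ (p, q) +
        (if p + 1 < N \<and> q + 1 < N then of_real (lap_off n p q) * T_basis N l m $$ (p + 1, q + 1) else 0) +
        (if 0 < p \<and> 0 < q then of_real (lap_off n (p - 1) (q - 1)) * T_basis N l m $$ (p - 1, q - 1) else 0)"
        unfolding tridiag_laplacian_def n_def using pq by (subst index_mat(1)) simp_all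
      have "tridiag_laplacian N (T_basis N l m) $$ (p, q) = complex_of_real (\<kappa> * diag_weight n p q *
         (- lap_main n p q * ?f (int p) + ((real p + 1) * (real q + 1) * ?f (int p + 1)
          + (real n - real p + 1) * (real n - real q + 1) * ?f (int p - 1))))"
        unfolding tri up down using pq True by (simp add: \<kappa> algebra_simps)
      also have "\<dots> = complex_of_real (\<kappa> * diag_weight n p q * (- (real l * (real l + 1)) * ?f (int p)))"
        unfolding rec[symmetric] by (simp add: algebra_simps)
      also have "\<dots> = - of_nat (l * (l + 1)) * T_basis N l m $$ (p, q)"
        using True pq by (simp add: \<kappa> algebra_simps)
      finally show ?thesis .
    qed
    then show "tridiag_laplacian N (T_basis N l m) $$ (p, q) = (- of_nat (l * (l + 1)) \<cdot>\<^sub>m T_basis N l m) $$ (p, q)"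
      using pq by (simp add: T_basis_def)
  qed (auto simp: tridiag_laplacian_def T_basis_def)
qed

lemma linear_on_mats_tridiag_laplacian: "linear_on_mats N (tridiag_laplacian N)"
  unfolding linear_on_mats_def
  by (auto simp: tridiag_laplacian_def algebra_simps intro!: eq_matI)

subsection \<open>Completeness of the spherical tensors\<close>

text \<open>The pairing is bilinear, not sesquilinear; the tensors are real, so it is definite on them.\<close>
definition mat_pairing :: "nat \<Rightarrow> complex mat \<Rightarrow> complex mat \<Rightarrow> complex" where
  "mat_pairing N X Y = (\<Sum>(p, q)\<in>{..<N} \<times> {..<N}. X $$ (p, q) * Y $$ (p, q))"

lemma mat_pairing_tridiag_laplacian:
  "mat_pairing N (tridiag_laplacian N X) Y = mat_pairing N X (tridiag_laplacian N Y)"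
proof -
  define shift where "shift X Y = (\<Sum>(p, q)\<in>{..<N} \<times> {..<N}. (if p + 1 < N \<and> q + 1 < N
    then of_real (lap_off (N - 1) p q) * X $$ (p + 1, q + 1) * Y $$ (p, q) else 0))" for X Y :: "complex mat"
  have sh: "(\<Sum>(p, q)\<in>{..<N} \<times> {..<N}. (if 0 < p \<and> 0 < q
    then of_real (lap_off (N - 1) (p - 1) (q - 1)) * X $$ (p - 1, q - 1) * Y $$ (p, q) else 0)) = shift Y X" for X Y
  proof -
    have "(\<Sum>(p, q)\<in>{..<N} \<times> {..<N}. (if 0 < p \<and> 0 < q
       then of_real (lap_off (N - 1) (p - 1) (q - 1)) * X $$ (p - 1, q - 1) * Y $$ (p, q) else 0))
     = (\<Sum>(p, q)\<in>{1..<N} \<times> {1..<N}. of_real (lap_off (N - 1) (p - 1) (q - 1)) * X $$ (p - 1, q - 1) * Y $$ (p, q))"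
      by (rule sum.mono_neutral_cong_right) (auto split: if_splits simp: Suc_le_eq)
    also have "\<dots> = (\<Sum>(p, q)\<in>{..<N - 1} \<times> {..<N - 1}. of_real (lap_off (N - 1) p q) * X $$ (p, q) * Y $$ (p + 1, q + 1))"
      by (rule sum.reindex_bij_witness[of _ "\<lambda>(p, q). (p + 1, q + 1)" "\<lambda>(p, q). (p - 1, q - 1)"]) auto
    also have "\<dots> = shift Y X"
      unfolding shift_def by (rule sum.mono_neutral_cong_left) (auto simp: algebra_simps split: if_splits)
    finally show ?thesis .
  qed
  have "mat_pairing N (tridiag_laplacian N X) Y =
     (\<Sum>(p, q)\<in>{..<N} \<times> {..<N}. - of_real (lap_main (N - 1) p q) * X $$ (p, q) * Y $$ (p, q)) + shift X Y + shift Y X" for X Y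
    unfolding mat_pairing_def shift_def[of X] sh[of X Y, symmetric] sum.distrib[symmetric]
    by (rule sum.cong) (auto simp: tridiag_laplacian_def algebra_simps)
  note e = this
  have "mat_pairing N X (tridiag_laplacian N Y) = mat_pairing N (tridiag_laplacian N Y) X"
    unfolding mat_pairing_def by (rule sum.cong) auto
  then show ?thesis unfolding e by (simp add: algebra_simps case_prod_unfold)
qed

lemma T_basis_orthogonal:
  assumes "l < N" "\<bar>m\<bar> \<le> int l" "l' < N" "\<bar>m\<bar> \<le> int l'" "l \<noteq> l'"
  shows "mat_pairing N (T_basis N l m) (T_basis N l' m) = 0"
proof -
  let ?T = "\<lambda>l. T_basis N l m"
  have c: "mat_pairing N (c \<cdot>\<^sub>m ?T l) Y = c * mat_pairing N (?T l) Y"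
    "mat_pairing N Y (c \<cdot>\<^sub>m ?T l) = c * mat_pairing N Y (?T l)" for c Y l
    unfolding mat_pairing_def sum_distrib_left by (rule sum.cong, auto simp: T_basis_def)+
  have "mat_pairing N (tridiag_laplacian N (?T l)) (?T l') = mat_pairing N (?T l) (tridiag_laplacian N (?T l'))"
    by (rule mat_pairing_tridiag_laplacian)
  then have "- of_nat (l * (l + 1)) * mat_pairing N (?T l) (?T l') = - of_nat (l' * (l' + 1)) * mat_pairing N (?T l) (?T l')"
    using assms by (simp only: tridiag_laplacian_T_basis c)
  then have "(of_nat (l' * (l' + 1)) - of_nat (l * (l + 1))) * mat_pairing N (?T l) (?T l') = 0"
    by (simp only: left_diff_distrib mult_minus_left neg_equal_iff_equal diff_self)
  moreover have "a * (a + 1) < b * (b + 1)" if "a < b" for a b :: nat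
    using that by (intro mult_strict_mono) auto
  then have "l' * (l' + 1) \<noteq> l * (l + 1)" using assms(5) by (metis less_irrefl nat_neq_iff)
  ultimately show ?thesis by (simp only: mult_eq_0_iff right_minus_eq of_nat_eq_iff simp_thms)
qed

lemma T_basis_pairing_self:
  assumes l: "l < N" and m: "\<bar>m\<bar> \<le> int l"
  shows "mat_pairing N (T_basis N l m) (T_basis N l m) \<noteq> 0"
proof -
  have N: "0 < N" using l by simp
  obtain \<kappa> where k0: "\<kappa> \<noteq> 0" and \<kappa>: "\<And>p q. p < N \<Longrightarrow> q < N \<Longrightarrow> T_basis N l m $$ (p, q) = complex_of_real
       (if int p - int q = m then \<kappa> * diag_weight (N - 1) p q * racah_sum (int N - 1) l m (int p) else 0)"
    using T_basis_entry[OF N l m] by blast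
  define g where "g = (\<lambda>(p, q). if int p - int q = m then \<kappa> * diag_weight (N - 1) p q * racah_sum (int N - 1) l m (int p) else 0)"
  define x where "x = (nat m, nat (- m))"
  have x: "x \<in> {..<N} \<times> {..<N}" using l m by (auto simp: x_def)
  have "racah_sum (int N - 1) l m (max 0 m) \<noteq> 0" using l m by (intro racah_sum_nonzero) auto
  then have "g x \<noteq> 0" using k0 by (simp add: g_def x_def diag_weight_def max_def split: if_splits)
  then have "0 < (\<Sum>x\<in>{..<N} \<times> {..<N}. g x * g x)"
    using x by (intro sum_pos2[of _ x]) (auto simp: zero_less_mult_iff)
  moreover have "mat_pairing N (T_basis N l m) (T_basis N l m) = complex_of_real (\<Sum>x\<in>{..<N} \<times> {..<N}. g x * g x)"
    unfolding mat_pairing_def of_real_sum by (rule sum.cong) (auto simp: \<kappa> g_def)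
  ultimately show ?thesis by (metis of_real_eq_0_iff less_irrefl)
qed

primrec mat_comb :: "nat \<Rightarrow> (nat \<Rightarrow> complex) \<Rightarrow> (nat \<Rightarrow> complex mat) \<Rightarrow> nat \<Rightarrow> complex mat" where
  "mat_comb N c B 0 = 0\<^sub>m N N"
| "mat_comb N c B (Suc k) = mat_comb N c B k + c k \<cdot>\<^sub>m B k"

lemma mat_comb_carrier:
  "(\<And>i. i < k \<Longrightarrow> B i \<in> carrier_mat N N) \<Longrightarrow> mat_comb N c B k \<in> carrier_mat N N"
  by (induction k) auto

lemma mat_comb_entry:
  assumes "\<And>i. i < k \<Longrightarrow> B i \<in> carrier_mat N N" "p < N" "q < N"
  shows "mat_comb N c B k $$ (p, q) = (\<Sum>i<k. c i * B i $$ (p, q))"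
  using assms(1)
proof (induction k)
  case (Suc k)
  have "B k \<in> carrier_mat N N" using Suc.prems by simp
  then show ?case using Suc assms(2,3) by (simp add: carrier_matD[of "B k" N N])
qed (use assms in auto)

lemma linear_on_mats_eqI:
  fixes k :: nat
  assumes D: "linear_on_mats N D" and D': "linear_on_mats N D'"
    and B: "\<And>i. i < k \<Longrightarrow> B i \<in> carrier_mat N N" "\<And>i. i < k \<Longrightarrow> D (B i) = D' (B i)"
    and X: "X \<in> carrier_mat N N" "\<And>p q. p < N \<Longrightarrow> q < N \<Longrightarrow> X $$ (p, q) = (\<Sum>i<k. c i * B i $$ (p, q))"
  shows "D X = D' X"
proof -
  have z: "L (0\<^sub>m N N) = 0\<^sub>m N N" if "linear_on_mats N L" for L
  proof -
    have "L (0 \<cdot>\<^sub>m 0\<^sub>m N N) = 0 \<cdot>\<^sub>m L (0\<^sub>m N N)" "L (0\<^sub>m N N) \<in> carrier_mat N N"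
      using that zero_carrier_mat unfolding linear_on_mats_def by blast+
    moreover have "0 \<cdot>\<^sub>m Y = 0\<^sub>m N N" if "Y \<in> carrier_mat N N" for Y :: "complex mat"
      using that by (intro eq_matI) auto
    ultimately show ?thesis using zero_carrier_mat[of N N] by metis
  qed
  have comb: "D (mat_comb N c B k) = D' (mat_comb N c B k)"
    using B
  proof (induction k)
    case 0
    then show ?case using z[OF D] z[OF D'] by simp
  next
    case (Suc k)
    have c: "mat_comb N c B k \<in> carrier_mat N N" "c k \<cdot>\<^sub>m B k \<in> carrier_mat N N" "B k \<in> carrier_mat N N"
      using Suc.prems mat_comb_carrier[of k B N c] by auto
    have "L (mat_comb N c B (Suc k)) = L (mat_comb N c B k) + c k \<cdot>\<^sub>m L (B k)" if "linear_on_mats N L" for L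
      using that c unfolding linear_on_mats_def by (metis mat_comb.simps(2))
    from this[OF D] this[OF D'] show ?case using Suc by simp
  qed
  have "X = mat_comb N c B k"
    using X mat_comb_carrier[of k B N c] B(1) by (intro eq_matI) (auto simp: mat_comb_entry)
  then show ?thesis using comb by simp
qed

definition unit_mat :: "nat \<Rightarrow> nat \<Rightarrow> nat \<Rightarrow> complex mat" where
  "unit_mat N p q = mat N N (\<lambda>pq. if pq = (p, q) then 1 else 0)"

lemma unit_mat_carrier: "unit_mat N p q \<in> carrier_mat N N"
  by (simp add: unit_mat_def)

text \<open>On a diagonal of length \<open>L = N - |m|\<close> there are \<open>L\<close> tensors. Orthogonality says that the matrix \<open>V\<close> of
  their entries has the left inverse \<open>R\<close>, its transpose with rescaled rows. As \<open>V\<close> is square, \<open>R\<close> is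
  also a right inverse, and \<open>V R = 1\<close> expands every matrix unit into tensors.\<close>
lemma unit_mat_expansion:
  assumes p0: "p0 < N" and q0: "q0 < N"
  defines "m \<equiv> int p0 - int q0"
  obtains c where "\<And>p q. p < N \<Longrightarrow> q < N \<Longrightarrow> unit_mat N p0 q0 $$ (p, q) =
    (\<Sum>j<N - nat \<bar>m\<bar>. c j * T_basis N (nat \<bar>m\<bar> + j) m $$ (p, q))"
proof -
  define L x y where "L = N - nat \<bar>m\<bar>" and "x = nat m" and "y = nat (- m)"
  define T where "T j = T_basis N (nat \<bar>m\<bar> + j) m" for j
  define V where "V = mat L L (\<lambda>(i, j). T j $$ (x + i, y + i))"
  define R where "R = mat L L (\<lambda>(j, i). T j $$ (x + i, y + i) / mat_pairing N (T j) (T j))"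
  have off: "T j $$ (p, q) = 0" if "j < L" "p < N" "q < N" "int p - int q \<noteq> m" for j p q
    using that T_basis_entry[of N "nat \<bar>m\<bar> + j" m] unfolding T_def L_def by fastforce
  have pair: "(\<Sum>i<L. T j $$ (x + i, y + i) * T j' $$ (x + i, y + i)) = mat_pairing N (T j) (T j')"
    if "j < L" "j' < L" for j j'
  proof -
    have "(\<Sum>i<L. T j $$ (x + i, y + i) * T j' $$ (x + i, y + i)) =
      (\<Sum>(p, q)\<in>{(p, q) \<in> {..<N} \<times> {..<N}. int p - int q = m}. T j $$ (p, q) * T j' $$ (p, q))"
      by (rule sum.reindex_bij_witness[of _ "\<lambda>(p, q). p - x" "\<lambda>i. (x + i, y + i)"])
        (auto simp: L_def x_def y_def)
    also have "\<dots> = mat_pairing N (T j) (T j')"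
      unfolding mat_pairing_def
    proof (rule sum.mono_neutral_left)
      show "\<forall>x\<in>{..<N} \<times> {..<N} - {(p, q) \<in> {..<N} \<times> {..<N}. int p - int q = m}.
          (case x of (p, q) \<Rightarrow> T j $$ (p, q) * T j' $$ (p, q)) = 0"
        using off[OF that(1)] by auto
    qed auto
    finally show ?thesis .
  qed
  have carr: "R \<in> carrier_mat L L" "V \<in> carrier_mat L L" by (auto simp: R_def V_def)
  have "R * V = 1\<^sub>m L"
  proof (rule eq_matI)
    fix i j assume "i < dim_row (1\<^sub>m L)" "j < dim_col (1\<^sub>m L)"
    then have ij: "i < L" "j < L" by auto
    then have "(R * V) $$ (i, j) = (\<Sum>k<L. T i $$ (x + k, y + k) * T j $$ (x + k, y + k)) / mat_pairing N (T i) (T i)"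
      by (simp add: R_def V_def scalar_prod_def sum_divide_distrib lessThan_atLeast0)
    also have "\<dots> = mat_pairing N (T i) (T j) / mat_pairing N (T i) (T i)" using pair ij by simp
    also have "\<dots> = 1\<^sub>m L $$ (i, j)"
    proof (cases "i = j")
      case True
      then show ?thesis using ij T_basis_pairing_self[of "nat \<bar>m\<bar> + j" N m] by (simp add: T_def L_def)
    next
      case False
      then show ?thesis using ij T_basis_orthogonal[of "nat \<bar>m\<bar> + i" N m "nat \<bar>m\<bar> + j"] by (simp add: T_def L_def)
    qed
    finally show "(R * V) $$ (i, j) = 1\<^sub>m L $$ (i, j)" .
  qed (auto simp: R_def V_def)
  then have VR: "V * R = 1\<^sub>m L" using carr by (metis mat_mult_left_right_inverse)
  define i0 where "i0 = p0 - x"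
  have i0: "i0 < L" "x + i0 = p0" "y + i0 = q0" using p0 q0 by (auto simp: i0_def x_def y_def L_def m_def)
  have "unit_mat N p0 q0 $$ (p, q) = (\<Sum>j<L. R $$ (j, i0) * T j $$ (p, q))" if pq: "p < N" "q < N" for p q
  proof (cases "int p - int q = m")
    case True
    define i where "i = p - x"
    have i: "i < L" "x + i = p" "y + i = q" using pq True by (auto simp: i_def x_def y_def L_def)
    have "(V * R) $$ (i, i0) = (\<Sum>j<L. R $$ (j, i0) * T j $$ (p, q))"
      using i i0 carr by (simp add: V_def scalar_prod_def lessThan_atLeast0 mult.commute)
    moreover have "(V * R) $$ (i, i0) = unit_mat N p0 q0 $$ (p, q)"
      unfolding VR using i i0 pq by (auto simp: unit_mat_def)
    ultimately show ?thesis by simp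
  next
    case False
    then show ?thesis using pq by (auto simp: unit_mat_def off m_def)
  qed
  then show ?thesis unfolding L_def T_def by (rule that)
qed

text \<open>The tensors span, so the eigenvalue equations admit only one linear operator.\<close>
lemma discrete_laplacian_eq:
  assumes X: "X \<in> carrier_mat N N"
  shows "discrete_laplacian N X = tridiag_laplacian N X"
proof -
  let ?P = "\<lambda>D. linear_on_mats N D \<and> (\<forall>l<N. \<forall>m. - int l \<le> m \<and> m \<le> int l \<longrightarrow>
        D (T_basis N l m) = - of_nat (l * (l + 1)) \<cdot>\<^sub>m T_basis N l m)"
  have lin': "linear_on_mats N (tridiag_laplacian N)" by (rule linear_on_mats_tridiag_laplacian)
  have eig': "tridiag_laplacian N (T_basis N l m) = - of_nat (l * (l + 1)) \<cdot>\<^sub>m T_basis N l m"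
    if "l < N" "\<bar>m\<bar> \<le> int l" for l m using tridiag_laplacian_T_basis that by blast
  moreover have abs: "\<bar>m\<bar> \<le> int l \<longleftrightarrow> - int l \<le> m \<and> m \<le> int l" for m l by linarith
  ultimately have "?P (tridiag_laplacian N)" using lin' by blast
  then have P: "?P (discrete_laplacian N)" unfolding discrete_laplacian_def by (rule someI[where P = ?P])
  then have lin: "linear_on_mats N (discrete_laplacian N)"
    and eig: "\<And>l m. l < N \<Longrightarrow> \<bar>m\<bar> \<le> int l \<Longrightarrow>
        discrete_laplacian N (T_basis N l m) = - of_nat (l * (l + 1)) \<cdot>\<^sub>m T_basis N l m"
    unfolding abs by blast+
  have unit: "discrete_laplacian N (unit_mat N p q) = tridiag_laplacian N (unit_mat N p q)"
    if pq: "p < N" "q < N" for p q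
  proof -
    let ?m = "int p - int q"
    obtain c where c: "\<And>p' q'. p' < N \<Longrightarrow> q' < N \<Longrightarrow> unit_mat N p q $$ (p', q') =
      (\<Sum>j<N - nat \<bar>?m\<bar>. c j * T_basis N (nat \<bar>?m\<bar> + j) ?m $$ (p', q'))"
      using unit_mat_expansion[OF pq] by blast
    show ?thesis
      by (rule linear_on_mats_eqI[OF lin lin' _ _ _ c])
        (auto simp: T_basis_carrier unit_mat_carrier eig eig')
  qed
  show ?thesis
  proof (cases "N = 0")
    case True
    have "discrete_laplacian N X \<in> carrier_mat N N" "tridiag_laplacian N X \<in> carrier_mat N N"
      using lin lin' X unfolding linear_on_mats_def by blast+
    then show ?thesis using True by (intro eq_matI) auto
  next
    case False
    define B where "B i = unit_mat N (i div N) (i mod N)" for i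
    have dm: "i div N < N" "i mod N < N" if "i < N * N" for i
      using that False by (auto simp: less_mult_imp_div_less)
    have X': "X $$ (p, q) = (\<Sum>i<N * N. X $$ (i div N, i mod N) * B i $$ (p, q))"
      if pq: "p < N" "q < N" for p q
    proof -
      have "(\<Sum>i<N * N. X $$ (i div N, i mod N) * B i $$ (p, q)) = (\<Sum>i<N * N. if i = p * N + q then X $$ (p, q) else 0)"
        using pq by (intro sum.cong) (auto simp: B_def unit_mat_def)
      also have "\<dots> = X $$ (p, q)"
      proof -
        have "p * N + q < (p + 1) * N" using pq by simp
        also have "\<dots> \<le> N * N" using pq by (intro mult_le_mono1) simp
        finally show ?thesis by simp
      qed
      finally show ?thesis by simp
    qed
    show ?thesis
      by (rule linear_on_mats_eqI[OF lin lin' _ _ X X']) (auto simp: B_def unit dm, simp add: unit_mat_def)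
  qed
qed

lemma lap_diag_entry_main:
  "i + m < N \<Longrightarrow> lap_diag_entry N m i i = - of_real (lap_main (N - 1) i (i + m))"
  unfolding lap_diag_entry_def by (subst discrete_laplacian_eq) (auto simp: tridiag_laplacian_def)

lemma lap_diag_entry_off:
  "i + m + 1 < N \<Longrightarrow> lap_diag_entry N m i (i + 1) = of_real (lap_off (N - 1) i (i + m))"
  unfolding lap_diag_entry_def by (subst discrete_laplacian_eq) (auto simp: tridiag_laplacian_def)

section \<open>The Cayley transform on skew-Hermitian matrices\<close>

lemma mat_adjoint_dim [simp]: "dim_row (mat_adjoint A) = dim_col A" "dim_col (mat_adjoint A) = dim_row A"
  by (auto simp: mat_adjoint_def)

lemma mat_adjoint_carrier [simp]: "A \<in> carrier_mat n m \<Longrightarrow> mat_adjoint A \<in> carrier_mat m n"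
  by auto

lemma mat_adjoint_index [simp]:
  "i < dim_col A \<Longrightarrow> j < dim_row A \<Longrightarrow> mat_adjoint A $$ (i, j) = cnj (A $$ (j, i))"
  for A :: "complex mat"
  by (simp add: mat_adjoint_def mat_of_rows_index vec_index_conjugate)

lemma mat_adjoint_mult:
  fixes A B :: "complex mat"
  assumes "A \<in> carrier_mat n m" "B \<in> carrier_mat m k"
  shows "mat_adjoint (A * B) = mat_adjoint B * mat_adjoint A"
  using assms by (intro eq_matI) (auto simp: scalar_prod_def mult.commute)

lemma mat_adjoint_add: "A \<in> carrier_mat n m \<Longrightarrow> B \<in> carrier_mat n m \<Longrightarrow>
    mat_adjoint (A + B) = mat_adjoint A + mat_adjoint B" for A B :: "complex mat"
  by (intro eq_matI) auto

lemma mat_adjoint_minus: "A \<in> carrier_mat n m \<Longrightarrow> B \<in> carrier_mat n m \<Longrightarrow>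
    mat_adjoint (A - B) = mat_adjoint A - mat_adjoint B" for A B :: "complex mat"
  by (intro eq_matI) auto

lemma mat_adjoint_smult: "mat_adjoint (c \<cdot>\<^sub>m A) = cnj c \<cdot>\<^sub>m mat_adjoint A" for A :: "complex mat"
  by (intro eq_matI) auto

lemma mat_adjoint_one [simp]: "mat_adjoint (1\<^sub>m n) = (1\<^sub>m n :: complex mat)"
  by (intro eq_matI) auto

lemma mat_adjoint_adjoint [simp]: "mat_adjoint (mat_adjoint A) = A" for A :: "complex mat"
  by (intro eq_matI) auto

lemma skew_hermI:
  "X \<in> carrier_mat N N \<Longrightarrow> mat_adjoint X = - X \<Longrightarrow> X \<in> skew_herm N"
  by (simp add: skew_herm_def)

lemma skew_hermD: "X \<in> skew_herm N \<Longrightarrow> X \<in> carrier_mat N N" "X \<in> skew_herm N \<Longrightarrow> mat_adjoint X = - X"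
  by (auto simp: skew_herm_def)

lemma skew_herm_entry: "X \<in> skew_herm N \<Longrightarrow> i < N \<Longrightarrow> j < N \<Longrightarrow> cnj (X $$ (i, j)) = - X $$ (j, i)"
  using mat_adjoint_index[of j X i] by (auto simp: skew_herm_def)

text \<open>A skew-Hermitian matrix has no nonzero real eigenvalue: if \<open>v = c \<Omega> v\<close> with \<open>c\<close> real, then
  \<open>|v|\<^sup>2 = c v\<^sup>*\<Omega>v\<close> is both real and purely imaginary.\<close>
lemma skew_herm_no_real_eigenvector:
  assumes \<Omega>: "\<Omega> \<in> skew_herm N"
    and v: "\<And>i. i < N \<Longrightarrow> v i = complex_of_real c * (\<Sum>j<N. \<Omega> $$ (i, j) * v j)" and i: "i < N"
  shows "v i = 0"
proof -
  define q where "q = (\<Sum>i<N. \<Sum>j<N. cnj (v i) * \<Omega> $$ (i, j) * v j)"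
  have "cnj q = (\<Sum>i<N. \<Sum>j<N. - (cnj (v j) * \<Omega> $$ (j, i) * v i))"
    unfolding q_def cnj_sum by (intro sum.cong refl) (simp add: skew_herm_entry[OF \<Omega>])
  also have "\<dots> = - q" unfolding q_def by (subst sum.swap) (simp add: sum_negf)
  finally have "Re (cnj q) = Re (- q)" by (rule arg_cong)
  then have im: "Re q = 0" by simp
  have "(\<Sum>i<N. cnj (v i) * v i) = complex_of_real c * q"
    unfolding q_def sum_distrib_left
  proof (rule sum.cong)
    fix i assume "i \<in> {..<N}"
    then have "i < N" by simp
    from v[OF this] have "cnj (v i) * v i = cnj (v i) * (complex_of_real c * (\<Sum>j<N. \<Omega> $$ (i, j) * v j))"
      by (rule arg_cong)
    then show "cnj (v i) * v i = (\<Sum>j<N. complex_of_real c * (cnj (v i) * \<Omega> $$ (i, j) * v j))"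
      by (simp add: sum_distrib_left algebra_simps)
  qed simp
  then have "Re (\<Sum>i<N. cnj (v i) * v i) = 0" using im by simp
  then have "(\<Sum>i<N. (cmod (v i))\<^sup>2) = 0" by (simp add: mult.commute complex_mult_cnj cmod_power2)
  then show ?thesis using i by (simp add: sum_nonneg_eq_0_iff)
qed

text \<open>The matrix called \<open>K\<close> in the introduction, and its inverse.\<close>
definition cay_denom :: "nat \<Rightarrow> complex mat \<Rightarrow> complex mat" where
  "cay_denom N \<Omega> = 1\<^sub>m N - (1/2) \<cdot>\<^sub>m \<Omega>"

definition cay_inv :: "nat \<Rightarrow> complex mat \<Rightarrow> complex mat" where
  "cay_inv N \<Omega> = the (mat_inverse (cay_denom N \<Omega>))"

lemma cay_denom_carrier [simp]: "\<Omega> \<in> carrier_mat N N \<Longrightarrow> cay_denom N \<Omega> \<in> carrier_mat N N"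
  by (auto simp: cay_denom_def)

lemma cay_denom_adjoint:
  assumes "\<Omega> \<in> skew_herm N" shows "mat_adjoint (cay_denom N \<Omega>) = 1\<^sub>m N + (1/2) \<cdot>\<^sub>m \<Omega>"
proof -
  have c: "\<Omega> \<in> carrier_mat N N" using assms by (rule skew_hermD)
  show ?thesis using c unfolding cay_denom_def
    by (subst mat_adjoint_minus[of _ N N]) (auto simp: mat_adjoint_smult skew_hermD(2)[OF assms] intro!: eq_matI)
qed

lemma cay_inv:
  assumes \<Omega>: "\<Omega> \<in> skew_herm N"
  shows "cay_inv N \<Omega> \<in> carrier_mat N N" "cay_denom N \<Omega> * cay_inv N \<Omega> = 1\<^sub>m N"
    "cay_inv N \<Omega> * cay_denom N \<Omega> = 1\<^sub>m N"
proof -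
  have c: "\<Omega> \<in> carrier_mat N N" using assms by (rule skew_hermD)
  have K: "cay_denom N \<Omega> \<in> carrier_mat N N" using c by simp
  have "det (cay_denom N \<Omega>) \<noteq> 0"
  proof
    assume "det (cay_denom N \<Omega>) = 0"
    then obtain v where v: "v \<in> carrier_vec N" "v \<noteq> 0\<^sub>v N" "cay_denom N \<Omega> *\<^sub>v v = 0\<^sub>v N"
      using det_0_iff_vec_prod_zero[OF K] by auto
    have "v $ i = complex_of_real (1/2) * (\<Sum>j<N. \<Omega> $$ (i, j) * v $ j)" if i: "i < N" for i
    proof -
      have "0 = (cay_denom N \<Omega> *\<^sub>v v) $ i" using v i by simp
      also have "\<dots> = (\<Sum>j<N. (if i = j then v $ j else 0) - 1/2 * (\<Omega> $$ (i, j) * v $ j))"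
        using i v(1) c unfolding cay_denom_def
        by (simp add: scalar_prod_def lessThan_atLeast0) (rule sum.cong, auto simp: algebra_simps)
      also have "\<dots> = v $ i - 1/2 * (\<Sum>j<N. \<Omega> $$ (i, j) * v $ j)"
        using i by (simp add: sum_subtractf sum_distrib_left)
      finally show ?thesis by simp
    qed
    then have "v $ i = 0" if "i < N" for i by (rule skew_herm_no_real_eigenvector[OF \<Omega> _ that])
    then have "v = 0\<^sub>v N" using v by (intro eq_vecI) auto
    then show False using v by simp
  qed
  then have U: "cay_denom N \<Omega> \<in> Units (ring_mat TYPE(complex) N ())"
    by (rule det_non_zero_imp_unit[OF K])
  then obtain B where "mat_inverse (cay_denom N \<Omega>) = Some B"
    using mat_inverse(1)[OF K, where b = "()"] by (cases "mat_inverse (cay_denom N \<Omega>)") auto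
  then show "cay_inv N \<Omega> \<in> carrier_mat N N" "cay_denom N \<Omega> * cay_inv N \<Omega> = 1\<^sub>m N"
    "cay_inv N \<Omega> * cay_denom N \<Omega> = 1\<^sub>m N"
    using mat_inverse(2)[OF K] by (auto simp: cay_inv_def)
qed

lemma cay_eq:
  assumes "\<Omega> \<in> skew_herm N"
  shows "cay N \<Omega> = cay_inv N \<Omega> * mat_adjoint (cay_denom N \<Omega>)"
  unfolding cay_denom_adjoint[OF assms] by (simp add: cay_def cay_inv_def cay_denom_def)

lemma cay_carrier: "\<Omega> \<in> skew_herm N \<Longrightarrow> cay N \<Omega> \<in> carrier_mat N N"
  using cay_inv(1) skew_hermD(1) by (auto simp: cay_eq intro!: mult_carrier_mat[of _ N N])

lemma cay_denom_commute:
  assumes \<Omega>: "\<Omega> \<in> skew_herm N"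
  shows "cay_denom N \<Omega> * mat_adjoint (cay_denom N \<Omega>) = mat_adjoint (cay_denom N \<Omega>) * cay_denom N \<Omega>"
proof -
  have c: "\<Omega> \<in> carrier_mat N N" using assms by (rule skew_hermD)
  show ?thesis unfolding cay_denom_adjoint[OF \<Omega>] unfolding cay_denom_def
    using c by (simp add: add_mult_distrib_mat[of _ N N _ _ N] minus_mult_distrib_mat[of _ N N _ _ N]
        mult_add_distrib_mat[of _ N N _ N] mult_minus_distrib_mat[of _ N N _ N] right_mult_one_mat[of _ N N]
        left_mult_one_mat[of _ N N])
qed

lemma cay_inv_adjoint:
  assumes \<Omega>: "\<Omega> \<in> skew_herm N"
  shows "mat_adjoint (cay_denom N \<Omega>) * mat_adjoint (cay_inv N \<Omega>) = 1\<^sub>m N"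
    "mat_adjoint (cay_inv N \<Omega>) * mat_adjoint (cay_denom N \<Omega>) = 1\<^sub>m N"
  using cay_inv[OF \<Omega>] skew_hermD(1)[OF \<Omega>] mat_adjoint_mult[of _ N N _ N]
  by (metis cay_denom_carrier mat_adjoint_one)+

lemma cay_denom_mult_cay:
  assumes \<Omega>: "\<Omega> \<in> skew_herm N"
  shows "cay_denom N \<Omega> * cay N \<Omega> = mat_adjoint (cay_denom N \<Omega>)"
  using cay_inv[OF \<Omega>] skew_hermD(1)[OF \<Omega>]
  by (simp add: cay_eq[OF \<Omega>] assoc_mult_mat[symmetric, of _ N N _ N _ N] left_mult_one_mat[of _ N N])

text \<open>Both factors of the Cayley transform commute, which makes it unitary.\<close>
lemma cay_unitary:
  assumes \<Omega>: "\<Omega> \<in> skew_herm N"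
  shows "mat_adjoint (cay N \<Omega>) * cay N \<Omega> = 1\<^sub>m N" "cay N \<Omega> * mat_adjoint (cay N \<Omega>) = 1\<^sub>m N"
proof -
  let ?K = "cay_denom N \<Omega>" and ?J = "cay_inv N \<Omega>"
  note [simp] = cay_inv[OF \<Omega>] cay_inv_adjoint[OF \<Omega>] mult_carrier_mat[of _ N N _ N]
  note assoc = assoc_mult_mat[of _ N N _ N _ N]
  have c [simp]: "\<Omega> \<in> carrier_mat N N" using assms by (rule skew_hermD)
  have adj: "mat_adjoint (cay N \<Omega>) = ?K * mat_adjoint ?J"
    unfolding cay_eq[OF \<Omega>] by (subst mat_adjoint_mult[of _ N N _ N]) auto
  have "cay N \<Omega> * mat_adjoint (cay N \<Omega>) = ?J * (mat_adjoint ?K * ?K) * mat_adjoint ?J"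
    unfolding adj unfolding cay_eq[OF \<Omega>] by (simp add: assoc)
  also have "\<dots> = ?J * (?K * mat_adjoint ?K) * mat_adjoint ?J"
    by (simp only: cay_denom_commute[OF \<Omega>])
  also have "\<dots> = (?J * ?K) * (mat_adjoint ?K * mat_adjoint ?J)"
    by (simp only: assoc mult_carrier_mat[of _ N N _ N] cay_inv(1)[OF \<Omega>] cay_denom_carrier c mat_adjoint_carrier)
  also have "\<dots> = 1\<^sub>m N" by (simp add: right_mult_one_mat[of _ N N])
  finally show 1: "cay N \<Omega> * mat_adjoint (cay N \<Omega>) = 1\<^sub>m N" .
  then show "mat_adjoint (cay N \<Omega>) * cay N \<Omega> = 1\<^sub>m N"
    using mat_mult_left_right_inverse[of "cay N \<Omega>" N "mat_adjoint (cay N \<Omega>)"] cay_carrier[OF \<Omega>] by simp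
qed


subsection \<open>The right trivialised tangent of the Cayley transform\<close>

text \<open>The resolvent identity.\<close>
lemma cay_inv_diff:
  assumes A: "A \<in> skew_herm N" and B: "B \<in> skew_herm N"
  shows "cay_inv N A - cay_inv N B = (1/2) \<cdot>\<^sub>m (cay_inv N A * (A - B) * cay_inv N B)"
proof -
  note [simp] = cay_inv[OF A] cay_inv[OF B] mult_carrier_mat[of _ N N _ N] skew_hermD(1)[OF A] skew_hermD(1)[OF B]
    left_mult_one_mat[of _ N N] right_mult_one_mat[of _ N N]
  have d: "(1/2) \<cdot>\<^sub>m (A - B) = cay_denom N B - cay_denom N A"
    using carrier_matD[OF skew_hermD(1)[OF A]] carrier_matD[OF skew_hermD(1)[OF B]]
    unfolding cay_denom_def by (intro eq_matI) (auto simp: algebra_simps)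
  have "(1/2) \<cdot>\<^sub>m (cay_inv N A * (A - B) * cay_inv N B) = cay_inv N A * ((1/2) \<cdot>\<^sub>m (A - B)) * cay_inv N B"
    by (simp add: mult_smult_distrib[of _ N N _ N] mult_smult_assoc_mat[of _ N N _ N] minus_carrier_mat)
  also have "\<dots> = cay_inv N A - cay_inv N B" unfolding d
    by (simp add: mult_minus_distrib_mat[of _ N N _ N] minus_mult_distrib_mat[of _ N N _ _ N]
       assoc_mult_mat[of _ N N _ N _ N])
  finally show ?thesis by simp
qed

lemma cay_eq_inv:
  assumes A: "A \<in> skew_herm N"
  shows "cay N A = 2 \<cdot>\<^sub>m cay_inv N A - 1\<^sub>m N"
proof -
  note [simp] = cay_inv[OF A] skew_hermD(1)[OF A] right_mult_one_mat[of _ N N]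
  have "mat_adjoint (cay_denom N A) = 2 \<cdot>\<^sub>m 1\<^sub>m N - cay_denom N A"
    using carrier_matD[OF skew_hermD(1)[OF A]] unfolding cay_denom_adjoint[OF A] unfolding cay_denom_def
    by (intro eq_matI) (auto simp: algebra_simps)
  then show ?thesis unfolding cay_eq[OF A]
    by (simp add: mult_minus_distrib_mat[of _ N N _ N] mult_smult_distrib[of _ N N _ N])
qed

text \<open>This uniform bound makes the inverse continuous along any path of skew-Hermitian matrices. It holds
  since \<open>cay A\<close> is unitary and \<open>cay_inv A = (cay A + 1) / 2\<close>.\<close>
lemma cay_inv_bound:
  assumes A: "A \<in> skew_herm N" and ij: "i < N" "j < N"
  shows "cmod (cay_inv N A $$ (i, j)) \<le> 1"
proof -
  have c: "cay N A \<in> carrier_mat N N" by (rule cay_carrier[OF A])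
  have "1 = (mat_adjoint (cay N A) * cay N A) $$ (j, j)" using cay_unitary(1)[OF A] ij by simp
  also have "\<dots> = (\<Sum>k<N. complex_of_real ((cmod (cay N A $$ (k, j)))\<^sup>2))"
    using c ij by (simp add: scalar_prod_def lessThan_atLeast0 complex_norm_square mult.commute del: of_real_power)
  finally have "(\<Sum>k<N. (cmod (cay N A $$ (k, j)))\<^sup>2) = 1"
    unfolding of_real_sum[symmetric] by (metis of_real_eq_1_iff)
  then have "(cmod (cay N A $$ (i, j)))\<^sup>2 \<le> 1"
    using member_le_sum[of i "{..<N}" "\<lambda>k. (cmod (cay N A $$ (k, j)))\<^sup>2"] ij by simp
  then have "cmod (cay N A $$ (i, j)) \<le> 1" by (simp add: power_le_one_iff abs_square_le_1)
  moreover have "cay N A $$ (i, j) = 2 * cay_inv N A $$ (i, j) - 1\<^sub>m N $$ (i, j)"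
    using ij cay_inv(1)[OF A] by (simp add: cay_eq_inv[OF A])
  then have "2 * cay_inv N A $$ (i, j) = cay N A $$ (i, j) + 1\<^sub>m N $$ (i, j)" by simp
  then have "2 * cmod (cay_inv N A $$ (i, j)) = cmod (cay N A $$ (i, j) + 1\<^sub>m N $$ (i, j))"
    by (metis norm_mult norm_numeral)
  moreover have "cmod (1\<^sub>m N $$ (i, j)) \<le> 1" using ij by simp
  ultimately show ?thesis
    using norm_triangle_ineq[of "cay N A $$ (i, j)" "1\<^sub>m N $$ (i, j)"] by linarith
qed

lemma mat_triple_entry:
  assumes "X \<in> carrier_mat N N" "Y \<in> carrier_mat N N" "Z \<in> carrier_mat N N" "i < N" "j < N"
  shows "(X * Y * Z) $$ (i, j) = (\<Sum>l<N. \<Sum>k<N. X $$ (i, k) * Y $$ (k, l) * Z $$ (l, j))"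
  using assms by (simp del: assoc_mult_mat add: scalar_prod_def lessThan_atLeast0 sum_distrib_right)

lemma has_vector_derivative_at_0_iff:
  fixes f :: "real \<Rightarrow> complex"
  shows "(f has_vector_derivative D) (at 0) \<longleftrightarrow> ((\<lambda>t. (f t - f 0) /\<^sub>R t) \<longlongrightarrow> D) (at 0)"
proof -
  have "norm (f h - f 0 - h *\<^sub>R D) / norm h = norm ((f h - f 0) /\<^sub>R h - D)" if "h \<noteq> 0" for h
  proof -
    have "(f h - f 0) /\<^sub>R h - D = (f h - f 0 - h *\<^sub>R D) /\<^sub>R h"
      using that by (simp add: scaleR_diff_right)
    then show ?thesis by (simp add: divide_inverse mult.commute)
  qed
  then have "((\<lambda>h. norm (f h - f 0 - h *\<^sub>R D) / norm h) \<longlongrightarrow> 0) (at 0) \<longleftrightarrow>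
     ((\<lambda>h. norm ((f h - f 0) /\<^sub>R h - D)) \<longlongrightarrow> 0) (at 0)"
    by (intro filterlim_cong refl) (auto simp: eventually_at_filter)
  also have "\<dots> \<longleftrightarrow> ((\<lambda>t. (f t - f 0) /\<^sub>R t) \<longlongrightarrow> D) (at 0)"
    by (simp only: tendsto_norm_zero_iff LIM_zero_iff)
  finally show ?thesis
    by (simp add: has_vector_derivative_def has_derivative_at bounded_linear_scaleR_left)
qed

text \<open>By the resolvent identity, a difference quotient of \<open>cay\<close> is the difference quotient of the path
  between two factors \<open>cay_inv\<close>, of which one is constant and the other continuous.\<close>
lemma has_mat_derivative_cay:
  assumes \<alpha>: "\<And>t. \<alpha> t \<in> skew_herm N" and A: "has_mat_derivative N \<alpha> A 0" and Ac: "A \<in> carrier_mat N N"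
  shows "has_mat_derivative N (\<lambda>t. cay N (\<alpha> t)) (cay_inv N (\<alpha> 0) * A * cay_inv N (\<alpha> 0)) 0"
  unfolding has_mat_derivative_def
proof (intro allI impI)
  fix i j assume ij: "i < N" "j < N"
  let ?J = "\<lambda>t. cay_inv N (\<alpha> t)"
  have Jc: "?J t \<in> carrier_mat N N" for t by (rule cay_inv(1)[OF \<alpha>])
  have ac: "\<alpha> t \<in> carrier_mat N N" for t by (rule skew_hermD(1)[OF \<alpha>])
  have Jdiff: "?J t $$ (i, j) = ?J 0 $$ (i, j) +
     1/2 * (\<Sum>l<N. \<Sum>k<N. ?J t $$ (i, k) * (\<alpha> t $$ (k, l) - \<alpha> 0 $$ (k, l)) * ?J 0 $$ (l, j))"
    if ij: "i < N" "j < N" for i j t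
  proof -
    have "?J t $$ (i, j) - ?J 0 $$ (i, j) = (?J t - ?J 0) $$ (i, j)" using ij Jc[of 0] Jc[of t] by simp
    also have "\<dots> = 1/2 * (?J t * (\<alpha> t - \<alpha> 0) * ?J 0) $$ (i, j)"
      unfolding cay_inv_diff[OF \<alpha> \<alpha>] using ij Jc[of 0] Jc[of t] by simp
    also have "(?J t * (\<alpha> t - \<alpha> 0) * ?J 0) $$ (i, j) =
      (\<Sum>l<N. \<Sum>k<N. ?J t $$ (i, k) * (\<alpha> t - \<alpha> 0) $$ (k, l) * ?J 0 $$ (l, j))"
      by (rule mat_triple_entry) (use ij Jc ac in \<open>auto simp: minus_carrier_mat\<close>)
    also have "\<dots> = (\<Sum>l<N. \<Sum>k<N. ?J t $$ (i, k) * (\<alpha> t $$ (k, l) - \<alpha> 0 $$ (k, l)) * ?J 0 $$ (l, j))"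
      using ac[of 0] ac[of t] by (intro sum.cong refl) auto
    finally show ?thesis by (simp only: diff_eq_eq add.commute)
  qed
  have \<alpha>': "((\<lambda>t. \<alpha> t $$ (k, l)) has_vector_derivative A $$ (k, l)) (at 0)" if "k < N" "l < N" for k l
    using A that by (simp add: has_mat_derivative_def)
  have \<alpha>lim: "((\<lambda>t. \<alpha> t $$ (k, l) - \<alpha> 0 $$ (k, l)) \<longlongrightarrow> 0) (at 0)" if "k < N" "l < N" for k l
    using has_vector_derivative_continuous[OF \<alpha>'[OF that]] by (simp add: isCont_def LIM_zero)
  have small: "((\<lambda>t. ?J t $$ (i, k) * (\<alpha> t $$ (k, l) - \<alpha> 0 $$ (k, l))) \<longlongrightarrow> 0) (at 0)"
    if "i < N" "k < N" "l < N" for i k l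
  proof (rule tendsto_0_le[OF \<alpha>lim[OF that(2,3)], where K = 1])
    show "\<forall>\<^sub>F t in at 0. norm (?J t $$ (i, k) * (\<alpha> t $$ (k, l) - \<alpha> 0 $$ (k, l))) \<le> norm (\<alpha> t $$ (k, l) - \<alpha> 0 $$ (k, l)) * 1"
      using cay_inv_bound[OF \<alpha> that(1,2)] by (intro always_eventually allI) (simp add: norm_mult mult_left_le_one_le)
  qed
  have Jlim: "((\<lambda>t. ?J t $$ (i, j)) \<longlongrightarrow> ?J 0 $$ (i, j)) (at 0)" if ij: "i < N" "j < N" for i j
  proof -
    have "((\<lambda>t. ?J 0 $$ (i, j) + 1/2 * (\<Sum>l<N. \<Sum>k<N. ?J t $$ (i, k) * (\<alpha> t $$ (k, l) - \<alpha> 0 $$ (k, l)) * ?J 0 $$ (l, j)))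
      \<longlongrightarrow> ?J 0 $$ (i, j) + 1/2 * (\<Sum>l<N. \<Sum>k<N. 0 * ?J 0 $$ (l, j))) (at 0)"
      by (intro tendsto_intros small) (use ij in auto)
    then show ?thesis unfolding Jdiff[OF ij, symmetric] by simp
  qed
  have quot: "((\<lambda>t. (\<alpha> t $$ (k, l) - \<alpha> 0 $$ (k, l)) /\<^sub>R t) \<longlongrightarrow> A $$ (k, l)) (at 0)" if "k < N" "l < N" for k l
    using \<alpha>'[OF that] by (simp only: has_vector_derivative_at_0_iff)
  have cay_diff: "(cay N (\<alpha> t) $$ (i, j) - cay N (\<alpha> 0) $$ (i, j)) /\<^sub>R t =
    (\<Sum>l<N. \<Sum>k<N. ?J t $$ (i, k) * ((\<alpha> t $$ (k, l) - \<alpha> 0 $$ (k, l)) /\<^sub>R t) * ?J 0 $$ (l, j))" for t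
  proof -
    have "cay N (\<alpha> t) $$ (i, j) = 2 * ?J t $$ (i, j) - 1\<^sub>m N $$ (i, j)" for t
      unfolding cay_eq_inv[OF \<alpha>] using ij Jc[of t] by simp
    then have "cay N (\<alpha> t) $$ (i, j) - cay N (\<alpha> 0) $$ (i, j) = 2 * (?J t $$ (i, j) - ?J 0 $$ (i, j))" by simp
    also have "\<dots> = (\<Sum>l<N. \<Sum>k<N. ?J t $$ (i, k) * (\<alpha> t $$ (k, l) - \<alpha> 0 $$ (k, l)) * ?J 0 $$ (l, j))"
      by (subst Jdiff[OF ij]) simp
    finally show ?thesis by (simp add: scaleR_sum_right)
  qed
  have "((\<lambda>t. \<Sum>l<N. \<Sum>k<N. ?J t $$ (i, k) * ((\<alpha> t $$ (k, l) - \<alpha> 0 $$ (k, l)) /\<^sub>R t) * ?J 0 $$ (l, j))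
    \<longlongrightarrow> (\<Sum>l<N. \<Sum>k<N. ?J 0 $$ (i, k) * A $$ (k, l) * ?J 0 $$ (l, j))) (at 0)"
    by (intro tendsto_intros Jlim quot) (use ij in auto)
  also have "(\<Sum>l<N. \<Sum>k<N. ?J 0 $$ (i, k) * A $$ (k, l) * ?J 0 $$ (l, j)) = (?J 0 * A * ?J 0) $$ (i, j)"
    by (rule mat_triple_entry[symmetric]) (use ij Jc Ac in auto)
  finally show "((\<lambda>t. cay N (\<alpha> t) $$ (i, j)) has_vector_derivative (?J 0 * A * ?J 0) $$ (i, j)) (at 0)"
    unfolding has_vector_derivative_at_0_iff cay_diff .
qed

text \<open>Differentiating along the line \<open>\<Omega> + t A\<close> determines the right trivialised tangent.\<close>
lemma right_triv_tangent_cay: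
  assumes \<Omega>: "\<Omega> \<in> skew_herm N" and A: "A \<in> skew_herm N"
  shows "right_triv_tangent N (cay N) \<Omega> A = cay_inv N \<Omega> * A * mat_adjoint (cay_inv N \<Omega>)"
proof -
  let ?J = "cay_inv N \<Omega>" and ?K = "cay_denom N \<Omega>"
  note [simp] = skew_hermD(1)[OF \<Omega>] skew_hermD(1)[OF A] cay_inv(1)[OF \<Omega>] mult_carrier_mat[of _ N N _ N]
    cay_carrier[OF \<Omega>] right_mult_one_mat[of _ N N] left_mult_one_mat[of _ N N]
  note assoc = assoc_mult_mat[of _ N N _ N _ N]
  let ?B = "?J * A * mat_adjoint ?J"
  have B: "?B * cay N \<Omega> = ?J * A * ?J"
  proof -
    have "mat_adjoint ?J * cay N \<Omega> = ?J"
    proof -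
      \<comment> \<open>Commuting with \<open>K\<close>, the adjoint of \<open>K\<close> commutes with its inverse.\<close>
      have "?J * mat_adjoint ?K = ?J * (mat_adjoint ?K * ?K) * ?J"
        by (simp add: assoc cay_inv[OF \<Omega>])
      also have "\<dots> = (?J * ?K) * mat_adjoint ?K * ?J"
        unfolding cay_denom_commute[OF \<Omega>, symmetric] by (simp add: assoc del: cay_inv(2,3))
      finally have "?J * mat_adjoint ?K = mat_adjoint ?K * ?J" by (simp add: cay_inv[OF \<Omega>])
      then show ?thesis unfolding cay_eq[OF \<Omega>] 
        by (simp add: assoc[symmetric] cay_inv_adjoint[OF \<Omega>])
    qed
    then show ?thesis by (simp add: assoc)
  qed
  show ?thesis
    unfolding right_triv_tangent_def
  proof (rule the_equality)
    show "?B \<in> carrier_mat N N \<and> (\<forall>\<alpha>. (\<forall>t. \<alpha> t \<in> skew_herm N) \<and> \<alpha> 0 = \<Omega> \<and> has_mat_derivative N \<alpha> A 0 \<longrightarrow>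
          has_mat_derivative N (\<lambda>t. cay N (\<alpha> t)) (?B * cay N \<Omega>) 0)"
      unfolding B using has_mat_derivative_cay[of _ N A] by auto
  next
    fix C assume C: "C \<in> carrier_mat N N \<and> (\<forall>\<alpha>. (\<forall>t. \<alpha> t \<in> skew_herm N) \<and> \<alpha> 0 = \<Omega> \<and> has_mat_derivative N \<alpha> A 0 \<longrightarrow>
          has_mat_derivative N (\<lambda>t. cay N (\<alpha> t)) (C * cay N \<Omega>) 0)"
    then have Cc [simp]: "C \<in> carrier_mat N N" by simp
    define \<alpha> where "\<alpha> t = \<Omega> + complex_of_real t \<cdot>\<^sub>m A" for t
    have \<alpha>: "\<alpha> t \<in> skew_herm N" for t
    proof (rule skew_hermI)
      show "mat_adjoint (\<alpha> t) = - \<alpha> t" unfolding \<alpha>_def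
        by (subst mat_adjoint_add[of _ N N]) (simp_all add: mat_adjoint_smult skew_hermD(2)[OF \<Omega>] skew_hermD(2)[OF A],
          insert carrier_matD[OF skew_hermD(1)[OF A]] carrier_matD[OF skew_hermD(1)[OF \<Omega>]], intro eq_matI, auto)
    qed (simp add: \<alpha>_def)
    have \<alpha>0: "\<alpha> 0 = \<Omega>" unfolding \<alpha>_def
      using carrier_matD[OF skew_hermD(1)[OF A]] carrier_matD[OF skew_hermD(1)[OF \<Omega>]] by (intro eq_matI) auto
    have d: "has_mat_derivative N \<alpha> A 0"
      unfolding has_mat_derivative_def
    proof (intro allI impI)
      fix i j assume ij: "i < N" "j < N"
      have "(\<lambda>u. \<alpha> u $$ (i, j)) = (\<lambda>u. \<Omega> $$ (i, j) + complex_of_real u * A $$ (i, j))"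
        using ij carrier_matD[OF skew_hermD(1)[OF A]] carrier_matD[OF skew_hermD(1)[OF \<Omega>]] by (auto simp: \<alpha>_def)
      then show "((\<lambda>u. \<alpha> u $$ (i, j)) has_vector_derivative A $$ (i, j)) (at 0)"
        by (auto intro!: derivative_eq_intros)
    qed
    have 1: "has_mat_derivative N (\<lambda>t. cay N (\<alpha> t)) (C * cay N \<Omega>) 0" using C \<alpha> \<alpha>0 d by blast
    have 2: "has_mat_derivative N (\<lambda>t. cay N (\<alpha> t)) (?B * cay N \<Omega>) 0"
      unfolding B using has_mat_derivative_cay[of \<alpha> N A] \<alpha> \<alpha>0 d by auto
    have "C * cay N \<Omega> = ?B * cay N \<Omega>"
    proof (rule eq_matI)
      fix i j assume "i < dim_row (?B * cay N \<Omega>)" "j < dim_col (?B * cay N \<Omega>)"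
      then have "i < N" "j < N" using carrier_matD[OF cay_carrier[OF \<Omega>]] carrier_matD[OF cay_inv(1)[OF \<Omega>]] by auto
      then show "(C * cay N \<Omega>) $$ (i, j) = (?B * cay N \<Omega>) $$ (i, j)"
        using 1 2 unfolding has_mat_derivative_def has_vector_derivative_at_0_iff
        by (blast intro: tendsto_unique[OF at_neq_bot])
    qed (use carrier_matD[OF cay_carrier[OF \<Omega>]] carrier_matD[OF Cc] carrier_matD[OF cay_inv(1)[OF \<Omega>]] in auto)
    then have "C * cay N \<Omega> * mat_adjoint (cay N \<Omega>) = ?B * cay N \<Omega> * mat_adjoint (cay N \<Omega>)" by simp
    moreover have "X * cay N \<Omega> * mat_adjoint (cay N \<Omega>) = X" if "X \<in> carrier_mat N N" for X
      using that by (simp add: assoc cay_unitary[OF \<Omega>])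
    ultimately show "C = ?B" by simp
  qed
qed

lemma mult_adjoint_skew_herm:
  assumes A: "A \<in> skew_herm N" and X: "X \<in> carrier_mat N N"
  shows "X * A * mat_adjoint X \<in> skew_herm N"
proof (rule skew_hermI)
  note [simp] = X skew_hermD(1)[OF A]
  show "X * A * mat_adjoint X \<in> carrier_mat N N" by (intro mult_carrier_mat[of _ N N]) auto
  have "mat_adjoint (X * A * mat_adjoint X) = X * (mat_adjoint A * mat_adjoint X)"
    by (subst mat_adjoint_mult[of _ N N _ N], auto intro!: mult_carrier_mat[of _ N N])
      (subst mat_adjoint_mult[of _ N N _ N], auto)
  also have "\<dots> = - (X * A * mat_adjoint X)"
    unfolding skew_hermD(2)[OF A] using carrier_matD[OF X] carrier_matD[OF skew_hermD(1)[OF A]]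
    by (simp add: assoc_mult_mat[of _ N N _ N _ N] uminus_mult_left_mat uminus_mult_right_mat)
  finally show "mat_adjoint (X * A * mat_adjoint X) = - (X * A * mat_adjoint X)" .
qed

text \<open>The tangent map is a congruence with \<open>cay_inv\<close>, which maps the skew-Hermitian matrices bijectively
  onto themselves and is inverted by the congruence with \<open>cay_denom\<close>.\<close>
lemma inv_right_triv_tangent_cay:
  assumes \<Omega>: "\<Omega> \<in> skew_herm N" and L: "L \<in> skew_herm N"
  shows "inv_right_triv_tangent N (cay N) \<Omega> L = cay_denom N \<Omega> * L * mat_adjoint (cay_denom N \<Omega>)"
proof -
  let ?J = "cay_inv N \<Omega>" and ?K = "cay_denom N \<Omega>"
  note [simp] = skew_hermD(1)[OF \<Omega>] skew_hermD(1)[OF L] mult_carrier_mat[of _ N N _ N]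
    right_mult_one_mat[of _ N N] left_mult_one_mat[of _ N N] cay_inv[OF \<Omega>] cay_inv_adjoint[OF \<Omega>]
  note assoc = assoc_mult_mat[of _ N N _ N _ N]
  have cancel: "P * (Q * X * mat_adjoint Q) * mat_adjoint P = X"
    if "P * Q = 1\<^sub>m N" "mat_adjoint Q * mat_adjoint P = 1\<^sub>m N"
      "P \<in> carrier_mat N N" "Q \<in> carrier_mat N N" "X \<in> carrier_mat N N" for P Q X :: "complex mat"
  proof -
    have "P * (Q * X * mat_adjoint Q) * mat_adjoint P = (P * Q) * X * (mat_adjoint Q * mat_adjoint P)"
      using that(3-5) by (simp add: assoc)
    then show ?thesis using that by simp
  qed
  have inj: "inj_on (right_triv_tangent N (cay N) \<Omega>) (skew_herm N)"
  proof (rule inj_on_inverseI)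
    fix A assume A: "A \<in> skew_herm N"
    show "?K * (right_triv_tangent N (cay N) \<Omega> A) * mat_adjoint ?K = A"
      unfolding right_triv_tangent_cay[OF \<Omega> A] by (rule cancel) (auto simp: skew_hermD[OF A])
  qed
  have KL: "?K * L * mat_adjoint ?K \<in> skew_herm N" by (rule mult_adjoint_skew_herm[OF L]) simp
  show ?thesis unfolding inv_right_triv_tangent_def
  proof (rule the_inv_into_f_eq[OF inj _ KL])
    show "right_triv_tangent N (cay N) \<Omega> (?K * L * mat_adjoint ?K) = L"
      unfolding right_triv_tangent_cay[OF \<Omega> KL] by (rule cancel) auto
  qed
qed

section \<open>Tridiagonal elimination and the inverse Laplacian\<close>

text \<open>Gaussian elimination without pivoting for the symmetric tridiagonal system with diagonal \<open>d\<close> and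
  off-diagonal entries \<open>- e\<close>: the pivots, the transformed right-hand side, and, further below, the
  back substitution.\<close>
fun elim_pivot :: "(nat \<Rightarrow> complex) \<Rightarrow> (nat \<Rightarrow> complex) \<Rightarrow> nat \<Rightarrow> complex" where
  "elim_pivot d e 0 = d 0"
| "elim_pivot d e (Suc i) = d (Suc i) - e i * e i / elim_pivot d e i"

fun elim_rhs :: "(nat \<Rightarrow> complex) \<Rightarrow> (nat \<Rightarrow> complex) \<Rightarrow> (nat \<Rightarrow> complex) \<Rightarrow> nat \<Rightarrow> complex" where
  "elim_rhs d e x 0 = x 0"
| "elim_rhs d e x (Suc i) = x (Suc i) + e i * elim_rhs d e x i / elim_pivot d e i"

lemma eliminated_system_solves:
  assumes piv: "\<And>i. Suc i < L \<Longrightarrow> elim_pivot d e i \<noteq> 0"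
    and red: "\<And>i. i < L \<Longrightarrow> elim_pivot d e i * y i = elim_rhs d e x i + (if Suc i < L then e i * y (Suc i) else 0)"
    and i: "i < L"
  shows "d i * y i - (if Suc i < L then e i * y (Suc i) else 0) - (if 0 < i then e (i - 1) * y (i - 1) else 0) = x i"
proof (cases i)
  case 0
  then show ?thesis using red[OF i] by simp
next
  case (Suc j)
  then have j: "elim_pivot d e j \<noteq> 0" "elim_pivot d e j * y j = elim_rhs d e x j + e j * y (Suc j)"
    using piv[of j] red[of j] i by auto
  then have "e j * y j = e j * (elim_rhs d e x j + e j * y (Suc j)) / elim_pivot d e j"
    by (simp add: field_simps)
  then show ?thesis using red[OF i] Suc by (simp add: algebra_simps add_divide_distrib cong: if_cong)
qed

text \<open>The components of the solution from the last one, \<open>z\<close>, to the first; \<open>k\<close> counts backwards.\<close>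
primrec back_subst :: "(nat \<Rightarrow> complex) \<Rightarrow> (nat \<Rightarrow> complex) \<Rightarrow> (nat \<Rightarrow> complex) \<Rightarrow> nat \<Rightarrow> complex \<Rightarrow> nat \<Rightarrow> complex" where
  "back_subst d e x L z 0 = z"
| "back_subst d e x L z (Suc k) = (elim_rhs d e x (L - 2 - k) + e (L - 2 - k) * back_subst d e x L z k) / elim_pivot d e (L - 2 - k)"

lemma back_subst_solves:
  assumes piv: "\<And>i. Suc i < L \<Longrightarrow> elim_pivot d e i \<noteq> 0"
    and z: "elim_pivot d e (L - 1) * z = elim_rhs d e x (L - 1)"
    and y: "\<And>i. i < L \<Longrightarrow> y i = back_subst d e x L z (L - 1 - i)" and i: "i < L"
  shows "d i * y i - (if Suc i < L then e i * y (Suc i) else 0) - (if 0 < i then e (i - 1) * y (i - 1) else 0) = x i"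
proof -
  have "elim_pivot d e i * y i = elim_rhs d e x i + (if Suc i < L then e i * y (Suc i) else 0)" if i: "i < L" for i
  proof (cases "Suc i < L")
    case True
    then have "L - 1 - i = Suc (L - 1 - Suc i)" "L - 2 - (L - 1 - Suc i) = i" by auto
    then have "y i = (elim_rhs d e x i + e i * y (Suc i)) / elim_pivot d e i"
      using y[OF i] y[OF True] by simp
    then show ?thesis using piv[OF True] True by simp
  next
    case False
    then have "i = L - 1" using i by simp
    then show ?thesis using z y[OF i] i by simp
  qed
  then show ?thesis using eliminated_system_solves[where d = d and e = e and y = y and x = x and L = L, OF piv] i by blast
qed

text \<open>The arithmetic mean of two numbers whose geometric mean is \<open>lap_off\<close>. Consecutive values along a
  diagonal add up to \<open>lap_main\<close>, which makes \<open>lap_bound\<close> an invariant lower bound for the pivots.\<close>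
definition lap_bound :: "nat \<Rightarrow> nat \<Rightarrow> nat \<Rightarrow> real" where
  "lap_bound n p q = ((real n - real p) * (real q + 1) + (real n - real q) * (real p + 1)) / 2"

lemma lap_main_Suc: "lap_main n (Suc p) (Suc q) = lap_bound n p q + lap_bound n (Suc p) (Suc q)"
  by (simp add: lap_main_def lap_bound_def field_simps)

lemma lap_bound_le_main: "p \<le> n \<Longrightarrow> q \<le> n \<Longrightarrow> lap_bound n p q \<le> lap_main n p q"
proof -
  assume "p \<le> n" "q \<le> n"
  then have "0 \<le> ((real n - real p) * real q + real q) + ((real n - real q) * real p + real p)" by simp
  also have "\<dots> = 2 * (lap_main n p q - lap_bound n p q)"
    by (simp add: lap_main_def lap_bound_def field_simps)
  finally show ?thesis by simp
qed

lemma lap_off_sq_le: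
  assumes "p \<le> n" "q \<le> n"
  shows "(lap_off n p q)\<^sup>2 \<le> (lap_bound n p q)\<^sup>2"
proof -
  define u v where "u = (real n - real p) * (real q + 1)" and "v = (real n - real q) * (real p + 1)"
  have "(lap_off n p q)\<^sup>2 = (real n - real p) * (real p + 1) * ((real n - real q) * (real q + 1))"
    unfolding lap_off_def by (rule real_sqrt_pow2) (use assms in simp)
  also have "\<dots> = u * v" by (simp add: u_def v_def)
  also have "\<dots> \<le> ((u + v) / 2)\<^sup>2"
    using zero_le_power2[of "u - v"] by (simp add: power2_eq_square field_simps)
  finally show ?thesis by (simp add: lap_bound_def u_def v_def)
qed

lemma lap_bound_pos: "p \<le> n \<Longrightarrow> q \<le> n \<Longrightarrow> p < n \<or> q < n \<Longrightarrow> 0 < lap_bound n p q"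
proof -
  assume le: "p \<le> n" "q \<le> n" "p < n \<or> q < n"
  let ?u = "(real n - real p) * (real q + 1)" and ?v = "(real n - real q) * (real p + 1)"
  have "0 \<le> ?u" "0 \<le> ?v" using le by auto
  moreover have "0 < ?u \<or> 0 < ?v" using le(3) by auto
  ultimately show ?thesis unfolding lap_bound_def by (auto intro: add_pos_nonneg add_nonneg_pos)
qed

abbreviation "main_diag n a b i \<equiv> complex_of_real (lap_main n (a + i) (b + i))"
abbreviation "off_diag n a b i \<equiv> complex_of_real (lap_off n (a + i) (b + i))"
abbreviation "lap_pivot n a b \<equiv> elim_pivot (main_diag n a b) (off_diag n a b)"

text \<open>If a pivot is at least \<open>b = lap_bound\<close>, then the next one is at least \<open>(b + b') - b\<^sup>2 / b = b'\<close>, where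
  \<open>b'\<close> is the next value of \<open>lap_bound\<close>.\<close>
lemma lap_pivot_ge:
  assumes "a + b + i \<le> n"
  shows "\<exists>r. lap_pivot n a b i = complex_of_real r \<and> lap_bound n (a + i) (b + i) \<le> r"
  using assms
proof (induction i)
  case 0
  then show ?case using lap_bound_le_main[of a n b] by auto
next
  case (Suc i)
  then obtain r where r: "lap_pivot n a b i = complex_of_real r" "lap_bound n (a + i) (b + i) \<le> r"
    by auto
  have le: "a + i < n" "b + i < n" using Suc.prems by auto
  then have pos: "0 < lap_bound n (a + i) (b + i)" by (intro lap_bound_pos) auto
  let ?b = "lap_bound n (a + i) (b + i)"
  have "(lap_off n (a + i) (b + i))\<^sup>2 / r \<le> ?b\<^sup>2 / ?b"
    using lap_off_sq_le[of "a + i" n "b + i"] le r pos by (intro frac_le) auto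
  then have "(lap_off n (a + i) (b + i))\<^sup>2 / r \<le> ?b" using pos by (simp add: power2_eq_square)
  then have "lap_bound n (a + Suc i) (b + Suc i) \<le> lap_main n (a + Suc i) (b + Suc i) - (lap_off n (a + i) (b + i))\<^sup>2 / r"
    using lap_main_Suc[of n "a + i" "b + i"] by simp
  then show ?case using r(1)
    by (intro exI[of _ "lap_main n (a + Suc i) (b + Suc i) - (lap_off n (a + i) (b + i))\<^sup>2 / r"])
      (simp add: power2_eq_square)
qed

lemma lap_pivot_nonzero:
  assumes "a + b + i \<le> n" "a = 0 \<or> b = 0" "a + b + i < n \<or> a + b \<noteq> 0"
  shows "lap_pivot n a b i \<noteq> 0"
proof -
  have "0 < lap_bound n (a + i) (b + i)" using assms by (intro lap_bound_pos) auto
  then show ?thesis using lap_pivot_ge[OF assms(1)] by auto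
qed

lemma lap_off_diagonal: "p \<le> n \<Longrightarrow> lap_off n p p = (real n - real p) * (real p + 1)"
  unfolding lap_off_def real_sqrt_mult_self by simp

text \<open>On the main diagonal pivots and off-diagonal entries coincide, so elimination forms partial sums. The
  last transformed right-hand side is then the sum of all components, which for a traceless matrix is
  zero, as is the last pivot.\<close>
lemma lap_pivot_diagonal: "i \<le> n \<Longrightarrow> lap_pivot n 0 0 i = complex_of_real ((real n - real i) * (real i + 1))"
proof (induction i)
  case (Suc i)
  have "(real n - real i) * (real i + 1) \<noteq> 0" using Suc.prems by auto
  then have "complex_of_real ((real n - real i) * (real i + 1)) \<noteq> 0" by (simp only: of_real_eq_0_iff simp_thms)
  then have "lap_pivot n 0 0 (Suc i) = complex_of_real (lap_main n (Suc i) (Suc i) - (real n - real i) * (real i + 1))"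
    using Suc lap_off_diagonal[of i n] by simp
  also have "lap_main n (Suc i) (Suc i) - (real n - real i) * (real i + 1) = (real n - real (Suc i)) * (real (Suc i) + 1)"
    by (simp add: lap_main_def algebra_simps)
  finally show ?case .
qed (simp add: lap_main_def)

lemma elim_rhs_diagonal:
  "i \<le> n \<Longrightarrow> elim_rhs (main_diag n 0 0) (off_diag n 0 0) x i = (\<Sum>j\<le>i. x j)"
proof (induction i)
  case (Suc i)
  have "(real n - real i) * (real i + 1) \<noteq> 0" using Suc.prems by auto
  then have "complex_of_real ((real n - real i) * (real i + 1)) \<noteq> 0" by (simp only: of_real_eq_0_iff simp_thms)
  then show ?case using Suc lap_off_diagonal[of i n] lap_pivot_diagonal[of i n] by simp
qed simp

text \<open>On the main diagonal the last pivot vanishes; the component left free there is set to \<open>0\<close>.\<close>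
definition diag_solution :: "nat \<Rightarrow> nat \<Rightarrow> nat \<Rightarrow> (nat \<Rightarrow> complex) \<Rightarrow> nat \<Rightarrow> complex" where
  "diag_solution N a b x i =
    (let n = N - 1; L = N - a - b; d = main_diag n a b; e = off_diag n a b in
     back_subst d e x L (if a = b then 0 else elim_rhs d e x (L - 1) / elim_pivot d e (L - 1)) (L - 1 - i))"

lemma diag_solution:
  assumes ab: "a = 0 \<or> b = 0" "a + b < N" and i: "i < N - a - b"
    and x: "a = b \<Longrightarrow> (\<Sum>i<N. x i) = 0"
  defines "n \<equiv> N - 1" and "L \<equiv> N - a - b" and "y \<equiv> diag_solution N a b x"
  shows "main_diag n a b i * y i - (if Suc i < L then off_diag n a b i * y (Suc i) else 0) -
     (if 0 < i then off_diag n a b (i - 1) * y (i - 1) else 0) = x i"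
proof (rule back_subst_solves)
  show "lap_pivot n a b i \<noteq> 0" if "Suc i < L" for i
    using that ab by (intro lap_pivot_nonzero) (auto simp: L_def n_def)
  show "lap_pivot n a b (L - 1) * (if a = b then 0 else elim_rhs (main_diag n a b) (off_diag n a b) x (L - 1) / lap_pivot n a b (L - 1))
     = elim_rhs (main_diag n a b) (off_diag n a b) x (L - 1)"
  proof (cases "a = b")
    case True
    then have "a = 0" "b = 0" "L - 1 = n" "{..n} = {..<N}" using ab by (auto simp: L_def n_def)
    then show ?thesis using elim_rhs_diagonal[of n n x] x by simp
  next
    case False
    then have "lap_pivot n a b (L - 1) \<noteq> 0"
      using ab by (intro lap_pivot_nonzero) (auto simp: L_def n_def)
    then show ?thesis using False by simp
  qed
  show "y i = back_subst (main_diag n a b) (off_diag n a b) x L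
      (if a = b then 0 else elim_rhs (main_diag n a b) (off_diag n a b) x (L - 1) / lap_pivot n a b (L - 1)) (L - 1 - i)" for i
    unfolding y_def diag_solution_def Let_def n_def L_def ..
  show "i < L" using i by (simp add: L_def)
qed

lemma tridiag_laplacian_on_diagonal:
  assumes ab: "a = 0 \<or> b = 0" and i: "i < N - a - b"
  shows "tridiag_laplacian N X $$ (a + i, b + i) =
    - (main_diag (N - 1) a b i * X $$ (a + i, b + i) -
       (if Suc i < N - a - b then off_diag (N - 1) a b i * X $$ (a + Suc i, b + Suc i) else 0) -
       (if 0 < i then off_diag (N - 1) a b (i - 1) * X $$ (a + (i - 1), b + (i - 1)) else 0))"
proof -
  have "a + i < N" "b + i < N" "(a + i + 1 < N \<and> b + i + 1 < N) \<longleftrightarrow> Suc i < N - a - b" "(0 < a + i \<and> 0 < b + i) \<longleftrightarrow> 0 < i"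
    using ab i by auto
  moreover have "0 < i \<Longrightarrow> a + i - 1 = a + (i - 1)" "0 < i \<Longrightarrow> b + i - 1 = b + (i - 1)" by auto
  ultimately show ?thesis unfolding tridiag_laplacian_def
    by (subst index_mat(1)) (auto simp del: Suc_less_eq)
qed

lemma tridiag_laplacian_entry:
  "p < N \<Longrightarrow> q < N \<Longrightarrow> tridiag_laplacian N X $$ (p, q) =
     - of_real (lap_main (N - 1) p q) * X $$ (p, q) +
     (if p + 1 < N \<and> q + 1 < N then of_real (lap_off (N - 1) p q) * X $$ (p + 1, q + 1) else 0) +
     (if 0 < p \<and> 0 < q then of_real (lap_off (N - 1) (p - 1) (q - 1)) * X $$ (p - 1, q - 1) else 0)"
  unfolding tridiag_laplacian_def by (subst index_mat(1)) auto

lemma tridiag_laplacian_carrier: "tridiag_laplacian N X \<in> carrier_mat N N"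
  by (simp add: tridiag_laplacian_def)

lemma tridiag_laplacian_minus:
  "X \<in> carrier_mat N N \<Longrightarrow> Y \<in> carrier_mat N N \<Longrightarrow>
    tridiag_laplacian N (X - Y) = tridiag_laplacian N X - tridiag_laplacian N Y"
  by (intro eq_matI) (auto simp: tridiag_laplacian_def algebra_simps)

text \<open>Minus the diagonal with offsets \<open>a\<close>, \<open>b\<close> of the traceless part of \<open>X\<close>: the elimination above is set
  up for the negative of the Laplacian.\<close>
definition shifted_diag :: "nat \<Rightarrow> complex mat \<Rightarrow> nat \<Rightarrow> nat \<Rightarrow> nat \<Rightarrow> complex" where
  "shifted_diag N X a b i = (if a = b then (\<Sum>k<N. X $$ (k, k)) / of_nat N else 0) - X $$ (a + i, b + i)"

text \<open>The solution assembled from its diagonals. Subtracting the mean on the main diagonal makes the trace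
  zero and changes nothing else, since constants are in the kernel.\<close>
definition band_poisson :: "nat \<Rightarrow> nat \<Rightarrow> complex mat \<Rightarrow> complex mat" where
  "band_poisson N Nh X = mat N N (\<lambda>(p, q). if \<bar>int q - int p\<bar> \<le> int Nh
     then diag_solution N (p - q) (q - p) (shifted_diag N X (p - q) (q - p)) (min p q) -
       (if p = q then (\<Sum>k<N. diag_solution N 0 0 (shifted_diag N X 0 0) k) / of_nat N else 0)
     else 0)"

lemma P_hat_equation:
  fixes N Nh :: nat and X :: "complex mat"
  assumes N: "0 < N" and X: "X \<in> carrier_mat N N"
  defines "Y \<equiv> band_poisson N Nh X"
  shows "Y \<in> traceless N"
    "tridiag_laplacian N Y = trunc_diags N Nh X - (mtrace (trunc_diags N Nh X) / of_nat N) \<cdot>\<^sub>m 1\<^sub>m N"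
proof -
  have Yc: "Y \<in> carrier_mat N N" by (simp add: Y_def band_poisson_def)
  let ?y = "\<lambda>a b. diag_solution N a b (shifted_diag N X a b)"
  let ?m = "(\<Sum>k<N. ?y 0 0 k) / of_nat N"
  have "mtrace Y = (\<Sum>k<N. ?y 0 0 k - ?m)"
    unfolding mtrace_def by (simp add: Y_def band_poisson_def)
  also have "\<dots> = 0" using N by (simp add: sum_subtractf)
  finally show "Y \<in> traceless N" using Yc by (simp add: traceless_def)
  have Ye: "Y $$ (a + i, b + i) = (if a + b \<le> Nh then ?y a b i - (if a = b then ?m else 0) else 0)"
    if "a = 0 \<or> b = 0" "i < N - a - b" for a b i
  proof -
    have "a + i < N" "b + i < N" "a + i - (b + i) = a" "b + i - (a + i) = b" "min (a + i) (b + i) = i"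
      "\<bar>int (b + i) - int (a + i)\<bar> \<le> int Nh \<longleftrightarrow> a + b \<le> Nh" "a + i = b + i \<longleftrightarrow> a = b"
      using that by auto
    then show ?thesis unfolding Y_def band_poisson_def by (subst index_mat(1)) auto
  qed
  have tr: "mtrace (trunc_diags N Nh X) = (\<Sum>k<N. X $$ (k, k))"
    by (simp add: mtrace_def trunc_diags_def)
  show "tridiag_laplacian N Y = trunc_diags N Nh X - (mtrace (trunc_diags N Nh X) / of_nat N) \<cdot>\<^sub>m 1\<^sub>m N"
  proof (rule eq_matI)
    fix p q assume "p < dim_row (trunc_diags N Nh X - (mtrace (trunc_diags N Nh X) / of_nat N) \<cdot>\<^sub>m 1\<^sub>m N)"
      "q < dim_col (trunc_diags N Nh X - (mtrace (trunc_diags N Nh X) / of_nat N) \<cdot>\<^sub>m 1\<^sub>m N)"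
    then have pq: "p < N" "q < N" by (auto simp: trunc_diags_def)
    define a b i where "a = p - q" and "b = q - p" and "i = min p q"
    have e: "a + i = p" "b + i = q" "a = 0 \<or> b = 0" "a + b < N" "i < N - a - b"
      using pq by (auto simp: a_def b_def i_def)
    note Ye' = Ye[OF e(3)]
    have rhs: "(trunc_diags N Nh X - (mtrace (trunc_diags N Nh X) / of_nat N) \<cdot>\<^sub>m 1\<^sub>m N) $$ (a + i, b + i) =
      (if a + b \<le> Nh then - shifted_diag N X a b i else 0)"
    proof -
      have "\<bar>int q - int p\<bar> \<le> int Nh \<longleftrightarrow> a + b \<le> Nh" "p = q \<longleftrightarrow> a = b" by (auto simp: a_def b_def)
      moreover have "a = b \<Longrightarrow> a + b = 0" using e by auto
      ultimately show ?thesis using pq unfolding e tr shifted_diag_def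
        by (auto simp: trunc_diags_def)
    qed
    have "tridiag_laplacian N Y $$ (a + i, b + i) = (if a + b \<le> Nh then - shifted_diag N X a b i else 0)"
    proof (cases "a + b \<le> Nh")
      case False
      show ?thesis
        unfolding tridiag_laplacian_on_diagonal[OF e(3,5)] using e(5) False Ye'[of i] Ye'[of "Suc i"] Ye'[of "i - 1"]
          by (cases i) (simp_all cong: if_cong)
    next
      case True
      have s0: "a = b \<Longrightarrow> (\<Sum>i<N. shifted_diag N X a b i) = 0"
        using N e by (auto simp: shifted_diag_def sum_subtractf)
      note sol = diag_solution[OF e(3,4,5) s0]
      show ?thesis
      proof (cases "a = b")
        case False
        show ?thesis
          unfolding tridiag_laplacian_on_diagonal[OF e(3,5)] using e(5) True False sol
            Ye'[of i] Ye'[of "Suc i"] Ye'[of "i - 1"] by (cases i) (simp_all cong: if_cong)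
      next
        case ab: True
        then have ab0: "a = 0" "b = 0" using e by auto
        \<comment> \<open>The row sum, which is what the operator makes of the constant that was subtracted.\<close>
        define c where "c = lap_main (N - 1) i i - (if Suc i < N then lap_off (N - 1) i i else 0) - (if 0 < i then lap_off (N - 1) (i - 1) (i - 1) else 0)"
        have c: "c = 0"
        proof -
          have "Suc i < N \<or> i = N - 1" "i \<le> N - 1" using e by auto
          then have 1: "(if Suc i < N then lap_off (N - 1) i i else 0) = (real (N - 1) - real i) * (real i + 1)"
            by (auto simp: lap_off_diagonal)
          have 2: "(if 0 < i then lap_off (N - 1) (i - 1) (i - 1) else 0) = (real (N - 1) - real i + 1) * real i"
            using \<open>i \<le> N - 1\<close> by (auto simp: lap_off_diagonal of_nat_diff)
          show ?thesis unfolding c_def 1 2 by (simp add: lap_main_def algebra_simps)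
        qed
        define m where "m = ?m"
        let ?u = "diag_solution N 0 0 (shifted_diag N X 0 0)"
        have Ym: "Y $$ (0 + j, 0 + j) = ?u j - m" if "j < N - 0 - 0" for j
          using Ye'[of j] that True unfolding ab0 m_def by simp
        have "tridiag_laplacian N Y $$ (a + i, b + i) = - (main_diag (N - 1) 0 0 i * (?u i - m) -
          (if Suc i < N - 0 - 0 then off_diag (N - 1) 0 0 i * (?u (Suc i) - m) else 0) -
          (if 0 < i then off_diag (N - 1) 0 0 (i - 1) * (?u (i - 1) - m) else 0))"
          unfolding tridiag_laplacian_on_diagonal[OF e(3,5)] unfolding ab0
          using e(5) Ym[of i] Ym[of "Suc i"] Ym[of "i - 1"] unfolding ab0 by (cases i) (simp_all cong: if_cong)
        also have "\<dots> = - ((main_diag (N - 1) 0 0 i * ?u i -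
          (if Suc i < N - 0 - 0 then off_diag (N - 1) 0 0 i * ?u (Suc i) else 0) -
          (if 0 < i then off_diag (N - 1) 0 0 (i - 1) * ?u (i - 1) else 0)) - m * complex_of_real c)"
          unfolding c_def by (auto simp: algebra_simps)
        also have "\<dots> = - (shifted_diag N X a b i - m * complex_of_real c)"
          using sol unfolding ab0 by simp
        finally have "tridiag_laplacian N Y $$ (a + i, b + i) = - (shifted_diag N X a b i - m * complex_of_real c)" .
        then show ?thesis unfolding c using True by simp
      qed
    qed
    then show "tridiag_laplacian N Y $$ (p, q) =
      (trunc_diags N Nh X - (mtrace (trunc_diags N Nh X) / of_nat N) \<cdot>\<^sub>m 1\<^sub>m N) $$ (p, q)"
      using rhs unfolding e by simp
  qed (auto simp: tridiag_laplacian_def trunc_diags_def)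
qed

text \<open>A symmetric operator that is onto is injective. If \<open>\<Delta>Z = 0\<close> for a traceless \<open>Z\<close>, solve
  \<open>\<Delta>W\<close> = conjugate of \<open>Z\<close> with the solution just constructed; pairing both equations shows that the
  sum of all \<open>|Z\<^sub>p\<^sub>q|\<^sup>2\<close> is zero.\<close>
lemma inj_on_tridiag_laplacian: "inj_on (tridiag_laplacian N) (traceless N)"
proof (rule inj_onI)
  fix X Y assume X: "X \<in> traceless N" and Y: "Y \<in> traceless N" and eq: "tridiag_laplacian N X = tridiag_laplacian N Y"
  have c: "X \<in> carrier_mat N N" "Y \<in> carrier_mat N N" using X Y by (auto simp: traceless_def)
  define Z where "Z = X - Y"
  define Zc where "Zc = mat N N (\<lambda>pq. cnj (Z $$ pq))"
  define W where "W = band_poisson N N Zc"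
  have Z0: "tridiag_laplacian N Z = 0\<^sub>m N N"
    unfolding Z_def tridiag_laplacian_minus[OF c] eq
    using tridiag_laplacian_carrier[of N Y] by (intro eq_matI) auto
  have "(\<Sum>i<N. Z $$ (i, i)) = 0"
    using X Y c by (auto simp: Z_def traceless_def mtrace_def sum_subtractf)
  then have "mtrace Zc = 0" unfolding mtrace_def by (simp add: Zc_def flip: cnj_sum)
  moreover have "trunc_diags N N Zc = Zc" by (intro eq_matI) (auto simp: trunc_diags_def Zc_def)
  ultimately have W: "0 < N \<Longrightarrow> tridiag_laplacian N W = Zc"
    using P_hat_equation(2)[of N Zc N] unfolding W_def by (auto simp: Zc_def intro!: eq_matI)
  have "Z $$ (p, q) = 0" if pq: "p < N" "q < N" for p q
  proof -
    have "mat_pairing N Z Zc = mat_pairing N (tridiag_laplacian N Z) W"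
      using W pq by (simp add: mat_pairing_tridiag_laplacian)
    also have "\<dots> = 0" unfolding Z0 mat_pairing_def by (rule sum.neutral) auto
    also have "mat_pairing N Z Zc = complex_of_real (\<Sum>x\<in>{..<N} \<times> {..<N}. (cmod (Z $$ x))\<^sup>2)"
      unfolding mat_pairing_def of_real_sum
      by (rule sum.cong) (auto simp: Zc_def complex_norm_square simp del: of_real_power)
    finally have "(\<Sum>x\<in>{..<N} \<times> {..<N}. (cmod (Z $$ x))\<^sup>2) = 0" by (simp only: of_real_eq_0_iff)
    then have "\<forall>x\<in>{..<N} \<times> {..<N}. (cmod (Z $$ x))\<^sup>2 = 0" by (subst (asm) sum_nonneg_eq_0_iff) auto
    then show ?thesis using pq by auto
  qed
  then show "X = Y" using c by (intro eq_matI) (auto simp: Z_def)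
qed

lemma inv_laplacian_eqI:
  assumes X: "X \<in> carrier_mat N N" and Y: "Y \<in> traceless N"
    and eq: "tridiag_laplacian N Y = X - (mtrace X / of_nat N) \<cdot>\<^sub>m 1\<^sub>m N"
  shows "inv_laplacian N X = Y"
  unfolding inv_laplacian_def
proof (rule the_inv_into_f_eq)
  have e: "discrete_laplacian N Z = tridiag_laplacian N Z" if "Z \<in> traceless N" for Z
    using that by (intro discrete_laplacian_eq) (simp add: traceless_def)
  show "inj_on (discrete_laplacian N) (traceless N)"
    using inj_on_tridiag_laplacian[of N] by (simp add: e cong: inj_on_cong)
  show "discrete_laplacian N Y = X - (mtrace X / of_nat N) \<cdot>\<^sub>m 1\<^sub>m N" using e[OF Y] eq by simp
qed (rule Y)

lemma P_hat_eq: "0 < N \<Longrightarrow> X \<in> carrier_mat N N \<Longrightarrow> P_hat N Nh X = band_poisson N Nh X"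
  unfolding P_hat_def
  by (rule inv_laplacian_eqI) (auto simp: P_hat_equation, simp add: trunc_diags_def)

lemma tridiag_laplacian_adjoint:
  assumes "X \<in> carrier_mat N N"
  shows "tridiag_laplacian N (mat_adjoint X) = mat_adjoint (tridiag_laplacian N X)"
proof -
  have s: "lap_main n q p = lap_main n p q" "lap_off n q p = lap_off n p q" for n p q
    by (simp_all add: lap_main_def lap_off_def mult.commute)
  show ?thesis
  proof (rule eq_matI)
    fix p q assume "p < dim_row (mat_adjoint (tridiag_laplacian N X))" "q < dim_col (mat_adjoint (tridiag_laplacian N X))"
    then have pq: "p < N" "q < N" by (auto simp: tridiag_laplacian_def)
    have x: "p + 1 < N \<Longrightarrow> q + 1 < N \<Longrightarrow> mat_adjoint X $$ (p + 1, q + 1) = cnj (X $$ (q + 1, p + 1))"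
      "mat_adjoint X $$ (p - 1, q - 1) = cnj (X $$ (q - 1, p - 1))" "mat_adjoint X $$ (p, q) = cnj (X $$ (q, p))"
      using assms pq by auto
    have up: "(if p + 1 < N \<and> q + 1 < N then of_real (lap_off (N - 1) p q) * mat_adjoint X $$ (p + 1, q + 1) else 0) =
      cnj (if q + 1 < N \<and> p + 1 < N then of_real (lap_off (N - 1) q p) * X $$ (q + 1, p + 1) else 0)"
      unfolding s(2)[of "N - 1" q p] using x(1) by auto
    have down: "(if 0 < p \<and> 0 < q then of_real (lap_off (N - 1) (p - 1) (q - 1)) * mat_adjoint X $$ (p - 1, q - 1) else 0) =
      cnj (if 0 < q \<and> 0 < p then of_real (lap_off (N - 1) (q - 1) (p - 1)) * X $$ (q - 1, p - 1) else 0)"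
      unfolding s(2)[of "N - 1" "q - 1" "p - 1"] x(2) by auto
    have "tridiag_laplacian N (mat_adjoint X) $$ (p, q) = cnj (tridiag_laplacian N X $$ (q, p))"
      unfolding tridiag_laplacian_entry[OF pq] tridiag_laplacian_entry[OF pq(2,1)] up down x(3)
        s(1)[of "N - 1" q p] by simp
    then show "tridiag_laplacian N (mat_adjoint X) $$ (p, q) = mat_adjoint (tridiag_laplacian N X) $$ (p, q)"
      using pq by (simp add: tridiag_laplacian_def)
  qed (auto simp: tridiag_laplacian_def)
qed

text \<open>The operator commutes with taking adjoints, so minus the adjoint of the solution solves the same
  equation, which has only one traceless solution.\<close>
lemma P_hat_skew_herm:
  assumes N: "0 < N" and X: "X \<in> skew_herm N"
  shows "P_hat N Nh X \<in> skew_herm N"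
proof -
  have Xc: "X \<in> carrier_mat N N" using X by (rule skew_hermD)
  define Y where "Y = P_hat N Nh X"
  have Y: "Y \<in> traceless N" "tridiag_laplacian N Y = trunc_diags N Nh X - (mtrace (trunc_diags N Nh X) / of_nat N) \<cdot>\<^sub>m 1\<^sub>m N"
    using P_hat_equation[OF N Xc, of Nh] unfolding Y_def P_hat_eq[OF N Xc] by auto
  have Yc: "Y \<in> carrier_mat N N" using Y by (simp add: traceless_def)
  have tY: "- mat_adjoint Y \<in> traceless N"
    using Y(1) Yc unfolding traceless_def mtrace_def by (auto simp: sum_negf simp flip: cnj_sum)
  have "tridiag_laplacian N (- mat_adjoint Y) = - mat_adjoint (tridiag_laplacian N Y)"
    unfolding tridiag_laplacian_adjoint[OF Yc, symmetric]
    using Yc by (intro eq_matI) (auto simp: tridiag_laplacian_def)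
  also have "\<dots> = tridiag_laplacian N Y"
  proof -
    have "cnj (mtrace (trunc_diags N Nh X)) = - mtrace (trunc_diags N Nh X)"
      using skew_herm_entry[OF X] by (simp add: mtrace_def trunc_diags_def cnj_sum sum_negf)
    then show ?thesis unfolding Y(2)
      using skew_herm_entry[OF X] by (intro eq_matI) (auto simp: trunc_diags_def abs_minus_commute)
  qed
  finally have "- mat_adjoint Y = Y"
    using inj_on_tridiag_laplacian Y(1) tY by (auto dest: inj_onD)
  then have "mat_adjoint Y = - Y" using Yc by (metis uminus_uminus_mat)
  then show ?thesis using Yc unfolding Y_def[symmetric] by (intro skew_hermI)
qed

section \<open>Solving linear systems by conjugate directions\<close>

text \<open>The entries of \<open>A = M\<^sup>*M\<close>. The vectors \<open>conj_dir\<close> below arise from the unit vectors by the Gram-Schmidt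
  process in the inner product of \<open>A\<close>. In the recursion the inner product of direction \<open>j\<close> with the
  \<open>k\<close>-th unit vector is written as the conjugate of the \<open>k\<close>-th component of \<open>A\<close> times direction \<open>j\<close>,
  which costs nothing extra.\<close>
definition normal_entry :: "(nat \<Rightarrow> nat \<Rightarrow> complex) \<Rightarrow> nat \<Rightarrow> nat \<Rightarrow> nat \<Rightarrow> complex" where
  "normal_entry M n i j = (\<Sum>k<n. cnj (M k i) * M k j)"

function conj_dir :: "(nat \<Rightarrow> nat \<Rightarrow> complex) \<Rightarrow> nat \<Rightarrow> nat \<Rightarrow> nat \<Rightarrow> complex" where
  "conj_dir M n k i = (if i = k then 1 else 0) -
     (\<Sum>j\<in>{..<k}. cnj (\<Sum>l<n. normal_entry M n k l * conj_dir M n j l) /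
        (\<Sum>l<n. cnj (conj_dir M n j l) * (\<Sum>l'<n. normal_entry M n l l' * conj_dir M n j l')) * conj_dir M n j i)"
  by auto
termination by (relation "measure (\<lambda>(M, n, k, i). k)") auto

declare conj_dir.simps [simp del]

definition conj_image :: "(nat \<Rightarrow> nat \<Rightarrow> complex) \<Rightarrow> nat \<Rightarrow> nat \<Rightarrow> nat \<Rightarrow> complex" where
  "conj_image M n k i = (\<Sum>l<n. normal_entry M n i l * conj_dir M n k l)"

definition conj_energy :: "(nat \<Rightarrow> nat \<Rightarrow> complex) \<Rightarrow> nat \<Rightarrow> nat \<Rightarrow> complex" where
  "conj_energy M n k = (\<Sum>l<n. cnj (conj_dir M n k l) * conj_image M n k l)"

lemma conj_dir_rec:
  "conj_dir M n k i = (if i = k then 1 else 0) -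
     (\<Sum>j<k. cnj (conj_image M n j k) / conj_energy M n j * conj_dir M n j i)"
  unfolding conj_image_def conj_energy_def by (subst conj_dir.simps) simp

definition conj_coeff :: "(nat \<Rightarrow> nat \<Rightarrow> complex) \<Rightarrow> nat \<Rightarrow> (nat \<Rightarrow> complex) \<Rightarrow> nat \<Rightarrow> complex" where
  "conj_coeff M n f k = (\<Sum>c<n. cnj (conj_dir M n k c) * f c) / conj_energy M n k"

definition conj_solve :: "(nat \<Rightarrow> nat \<Rightarrow> complex) \<Rightarrow> nat \<Rightarrow> (nat \<Rightarrow> complex) \<Rightarrow> nat \<Rightarrow> complex" where
  "conj_solve M n b i = (\<Sum>k<n. conj_coeff M n (\<lambda>c. \<Sum>l<n. cnj (M l c) * b l) k * conj_dir M n k i)"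

lemma conj_dir_triangular: "conj_dir M n k k = 1" "k < i \<Longrightarrow> conj_dir M n k i = 0"
proof -
  have *: "\<forall>i>k. conj_dir M n k i = 0" for k
  proof (induction k rule: less_induct)
    case (less k)
    show ?case
    proof (intro allI impI)
      fix i assume i: "k < i"
      have "(\<Sum>j<k. cnj (conj_image M n j k) / conj_energy M n j * conj_dir M n j i) = 0"
        using less i by (intro sum.neutral) auto
      then show "conj_dir M n k i = 0" using i by (subst conj_dir_rec) simp
    qed
  qed
  then show "k < i \<Longrightarrow> conj_dir M n k i = 0" by blast
  have "(\<Sum>j<k. cnj (conj_image M n j k) / conj_energy M n j * conj_dir M n j k) = 0"
    using * by (intro sum.neutral) auto
  then show "conj_dir M n k k = 1" by (subst conj_dir_rec) simp
qed

lemma normal_entry_hermitian: "cnj (normal_entry M n i j) = normal_entry M n j i"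
  by (simp add: normal_entry_def mult.commute)

lemma normal_form_sym:
  "cnj (\<Sum>i<n. cnj (x i) * (\<Sum>j<n. normal_entry M n i j * y j)) = (\<Sum>i<n. cnj (y i) * (\<Sum>j<n. normal_entry M n i j * x j))"
proof -
  have "cnj (\<Sum>i<n. cnj (x i) * (\<Sum>j<n. normal_entry M n i j * y j)) = (\<Sum>i<n. \<Sum>j<n. x i * normal_entry M n j i * cnj (y j))"
    by (simp add: sum_distrib_left normal_entry_hermitian mult.assoc)
  also have "\<dots> = (\<Sum>j<n. \<Sum>i<n. x i * normal_entry M n j i * cnj (y j))" by (rule sum.swap)
  finally show ?thesis by (simp add: sum_distrib_left algebra_simps)
qed

lemma normal_form_eq_norm:
  "(\<Sum>i<n. cnj (x i) * (\<Sum>j<n. normal_entry M n i j * x j)) = complex_of_real (\<Sum>k<n. (cmod (\<Sum>j<n. M k j * x j))\<^sup>2)"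
proof -
  have "(\<Sum>i<n. cnj (x i) * (\<Sum>j<n. normal_entry M n i j * x j)) =
      (\<Sum>i<n. \<Sum>j<n. \<Sum>k<n. cnj (M k i * x i) * (M k j * x j))"
    by (simp add: normal_entry_def sum_distrib_left sum_distrib_right algebra_simps)
  also have "\<dots> = (\<Sum>i<n. \<Sum>k<n. \<Sum>j<n. cnj (M k i * x i) * (M k j * x j))"
    by (intro sum.cong refl sum.swap)
  also have "\<dots> = (\<Sum>k<n. \<Sum>i<n. \<Sum>j<n. cnj (M k i * x i) * (M k j * x j))"
    by (rule sum.swap)
  also have "\<dots> = (\<Sum>k<n. cnj (\<Sum>j<n. M k j * x j) * (\<Sum>j<n. M k j * x j))"
    by (simp only: sum_product cnj_sum)
  also have "\<dots> = (\<Sum>k<n. complex_of_real ((cmod (\<Sum>j<n. M k j * x j))\<^sup>2))"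
    by (intro sum.cong refl) (simp only: complex_norm_square mult.commute)
  finally show ?thesis by simp
qed

text \<open>Injectivity makes the inner product definite. Since component \<open>k\<close> of direction \<open>k\<close> is \<open>1\<close>, the
  process then never divides by zero.\<close>
locale injective_system =
  fixes M :: "nat \<Rightarrow> nat \<Rightarrow> complex" and n :: nat
  assumes inj: "\<And>x. (\<And>i. i < n \<Longrightarrow> (\<Sum>j<n. M i j * x j) = 0) \<Longrightarrow> i < n \<Longrightarrow> x i = 0"
begin

lemma conj_energy_nonzero:
  assumes "k < n" shows "conj_energy M n k \<noteq> 0"
proof
  assume "conj_energy M n k = 0"
  then have "(\<Sum>l<n. (cmod (\<Sum>j<n. M l j * conj_dir M n k j))\<^sup>2) = 0"
    unfolding conj_energy_def conj_image_def normal_form_eq_norm by (simp only: of_real_eq_0_iff)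
  then have "\<And>i. i < n \<Longrightarrow> (\<Sum>j<n. M i j * conj_dir M n k j) = 0"
    by (simp add: sum_nonneg_eq_0_iff)
  then have "conj_dir M n k k = 0" by (rule inj[OF _ assms])
  then show False by (simp add: conj_dir_triangular)
qed

lemma conj_dir_orthogonal:
  assumes "k < n" "j < n" "j \<noteq> k"
  shows "(\<Sum>i<n. cnj (conj_dir M n j i) * conj_image M n k i) = 0"
proof -
  let ?B = "\<lambda>j k. \<Sum>i<n. cnj (conj_dir M n j i) * conj_image M n k i"
  have sym: "cnj (?B j k) = ?B k j" for j k
    unfolding conj_image_def by (rule normal_form_sym)
  have *: "\<forall>j<k. ?B j k = 0" if "k < n" for k
    using that
  proof (induction k rule: less_induct)
    case (less k)
    show ?case
    proof (intro allI impI)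
      fix j assume j: "j < k"
      \<comment> \<open>By induction, only direction \<open>j\<close> contributes to the correction term, and this cancels the first term.\<close>
      have zero: "?B j j' = 0" if "j' < k" "j' \<noteq> j" for j'
      proof (cases "j < j'")
        case True then show ?thesis using less that by simp
      next
        case False
        then have "?B j' j = 0" using less that j by simp
        then show ?thesis using sym[of j' j] by simp
      qed
      define w where "w j' = cnj (conj_image M n j' k) / conj_energy M n j'" for j'
      have im: "conj_image M n k i = normal_entry M n i k - (\<Sum>j'<k. w j' * conj_image M n j' i)" if "i < n" for i
      proof -
        have "conj_image M n k i = (\<Sum>l<n. normal_entry M n i l * (if l = k then 1 else 0)) -
           (\<Sum>l<n. \<Sum>j'<k. normal_entry M n i l * (w j' * conj_dir M n j' l))"
          unfolding conj_image_def[of M n k]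
          by (subst conj_dir_rec) (simp add: w_def right_diff_distrib sum_subtractf sum_distrib_left)
        also have "(\<Sum>l<n. normal_entry M n i l * (if l = k then 1 else 0)) = (\<Sum>l<n. if l = k then normal_entry M n i k else 0)"
          by (intro sum.cong) auto
        also have "\<dots> = normal_entry M n i k" using less.prems by simp
        also have "(\<Sum>l<n. \<Sum>j'<k. normal_entry M n i l * (w j' * conj_dir M n j' l)) = (\<Sum>j'<k. w j' * conj_image M n j' i)"
          by (subst sum.swap) (simp add: conj_image_def sum_distrib_left algebra_simps)
        finally show ?thesis .
      qed
      have "?B j k = (\<Sum>i<n. cnj (conj_dir M n j i) * normal_entry M n i k) - (\<Sum>i<n. \<Sum>j'<k. w j' * (cnj (conj_dir M n j i) * conj_image M n j' i))"
        by (simp add: im right_diff_distrib sum_subtractf sum_distrib_left algebra_simps)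
      also have "(\<Sum>i<n. cnj (conj_dir M n j i) * normal_entry M n i k) = cnj (conj_image M n j k)"
        by (simp add: conj_image_def normal_entry_hermitian mult.commute)
      also have "(\<Sum>i<n. \<Sum>j'<k. w j' * (cnj (conj_dir M n j i) * conj_image M n j' i)) = (\<Sum>j'<k. w j' * ?B j j')"
        by (subst sum.swap) (simp add: sum_distrib_left)
      also have "\<dots> = (\<Sum>j'\<in>{j}. w j' * ?B j j')"
        using j zero by (intro sum.mono_neutral_right) auto
      also have "\<dots> = cnj (conj_image M n j k)"
        using conj_energy_nonzero[of j] j less.prems by (simp add: w_def conj_energy_def)
      finally show "?B j k = 0" by simp
    qed
  qed
  show ?thesis
  proof (cases "j < k")
    case True then show ?thesis using * assms by blast
  next
    case False
    then have "?B k j = 0" using * assms by simp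
    then show ?thesis using sym[of k j] by simp
  qed
qed

lemma solution_exists: "\<exists>y. \<forall>i<n. (\<Sum>j<n. M i j * y j) = b i"
proof -
  define A where "A = mat n n (\<lambda>(i, j). M i j)"
  have A: "A \<in> carrier_mat n n" by (simp add: A_def)
  have Av: "(A *\<^sub>v v) $ i = (\<Sum>j<n. M i j * v $ j)" if "v \<in> carrier_vec n" "i < n" for v i
    using that by (simp add: A_def scalar_prod_def lessThan_atLeast0)
  have "det A \<noteq> 0"
  proof
    assume "det A = 0"
    then obtain v where v: "v \<in> carrier_vec n" "v \<noteq> 0\<^sub>v n" "A *\<^sub>v v = 0\<^sub>v n"
      using det_0_iff_vec_prod_zero[OF A] by auto
    have "v $ i = 0" if "i < n" for i
    proof (rule inj[where x = "\<lambda>j. v $ j", OF _ that])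
      show "(\<Sum>j<n. M i j * v $ j) = 0" if "i < n" for i using Av[OF v(1) that] v(3) that by simp
    qed
    then have "v = 0\<^sub>v n" using v(1) by (intro eq_vecI) auto
    then show False using v by simp
  qed
  then have "A \<in> Units (ring_mat TYPE(complex) n ())" by (rule det_non_zero_imp_unit[OF A])
  then obtain B where "mat_inverse A = Some B"
    using mat_inverse(1)[OF A, where b = "()"] by (cases "mat_inverse A") auto
  then have B: "A * B = 1\<^sub>m n" "B \<in> carrier_mat n n" using mat_inverse(2)[OF A] by auto
  have "(\<Sum>j<n. M i j * (B *\<^sub>v vec n b) $ j) = b i" if i: "i < n" for i
  proof -
    have c: "B *\<^sub>v vec n b \<in> carrier_vec n" using B by simp
    have "A *\<^sub>v (B *\<^sub>v vec n b) = (A * B) *\<^sub>v vec n b"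
      by (rule assoc_mult_mat_vec[symmetric, of _ n n _ n]) (use A B in auto)
    also have "\<dots> = vec n b" unfolding B by simp
    finally show ?thesis using Av[OF c i] i by simp
  qed
  then show ?thesis by blast
qed

text \<open>The residual of the normal equations is orthogonal to all directions, and these are unit upper
  triangular, so the residual vanishes.\<close>
lemma conj_solve:
  assumes i: "i < n"
  shows "(\<Sum>j<n. M i j * conj_solve M n b j) = b i"
proof -
  define f where "f c = (\<Sum>l<n. cnj (M l c) * b l)" for c
  define y where "y = conj_solve M n b"
  define res where "res i = (\<Sum>l<n. normal_entry M n i l * y l) - f i" for i
  have y: "y i = (\<Sum>k<n. conj_coeff M n f k * conj_dir M n k i)" for i
    by (simp add: y_def conj_solve_def f_def[abs_def])
  have Ay: "(\<Sum>l<n. normal_entry M n i l * y l) = (\<Sum>k<n. conj_coeff M n f k * conj_image M n k i)" for i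
  proof -
    have "(\<Sum>l<n. normal_entry M n i l * y l) = (\<Sum>l<n. \<Sum>k<n. conj_coeff M n f k * (normal_entry M n i l * conj_dir M n k l))"
      by (simp add: y sum_distrib_left algebra_simps)
    also have "\<dots> = (\<Sum>k<n. conj_coeff M n f k * conj_image M n k i)"
      by (subst sum.swap) (simp add: conj_image_def sum_distrib_left)
    finally show ?thesis .
  qed
  have orth: "(\<Sum>i<n. cnj (conj_dir M n j i) * res i) = 0" if j: "j < n" for j
  proof -
    have "(\<Sum>i<n. cnj (conj_dir M n j i) * (\<Sum>l<n. normal_entry M n i l * y l)) =
      (\<Sum>i<n. \<Sum>k<n. conj_coeff M n f k * (cnj (conj_dir M n j i) * conj_image M n k i))"
      unfolding Ay by (simp add: sum_distrib_left algebra_simps)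
    also have "\<dots> = (\<Sum>k<n. conj_coeff M n f k * (\<Sum>i<n. cnj (conj_dir M n j i) * conj_image M n k i))"
      by (subst sum.swap) (simp add: sum_distrib_left)
    also have "\<dots> = (\<Sum>k\<in>{j}. conj_coeff M n f k * (\<Sum>i<n. cnj (conj_dir M n j i) * conj_image M n k i))"
      using j by (intro sum.mono_neutral_right) (auto simp: conj_dir_orthogonal)
    also have "\<dots> = conj_coeff M n f j * conj_energy M n j" by (simp add: conj_energy_def)
    also have "\<dots> = (\<Sum>i<n. cnj (conj_dir M n j i) * f i)"
      using conj_energy_nonzero[OF j] by (simp add: conj_coeff_def)
    finally show ?thesis by (simp add: res_def right_diff_distrib sum_subtractf)
  qed
  have res0: "i < n \<Longrightarrow> res i = 0" for i
  proof (induction i rule: less_induct)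
    case (less i)
    have "(\<Sum>l<n. cnj (conj_dir M n i l) * res l) = (\<Sum>l\<in>{i}. cnj (conj_dir M n i l) * res l)"
    proof (rule sum.mono_neutral_right)
      show "\<forall>l\<in>{..<n} - {i}. cnj (conj_dir M n i l) * res l = 0"
      proof
        fix l assume "l \<in> {..<n} - {i}"
        then show "cnj (conj_dir M n i l) * res l = 0"
          using less.IH[of l] less.prems conj_dir_triangular(2)[of i l M n] by (cases "l < i") auto
      qed
    qed (use less.prems in auto)
    then show ?case using orth[OF less.prems] by (simp add: conj_dir_triangular)
  qed
  obtain y0 where y0: "\<forall>i<n. (\<Sum>j<n. M i j * y0 j) = b i" using solution_exists by blast
  have fy0: "f i = (\<Sum>l<n. normal_entry M n i l * y0 l)" for i
  proof -
    have "f i = (\<Sum>k<n. \<Sum>l<n. cnj (M k i) * M k l * y0 l)"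
      unfolding f_def using y0 by (intro sum.cong refl) (auto simp: sum_distrib_left mult.assoc simp flip: y0)
    also have "\<dots> = (\<Sum>l<n. normal_entry M n i l * y0 l)"
      by (subst sum.swap) (simp add: normal_entry_def sum_distrib_right)
    finally show ?thesis .
  qed
  have "(\<Sum>l<n. normal_entry M n i l * (y l - y0 l)) = 0" if "i < n" for i
    using res0[OF that] by (simp add: res_def fy0 right_diff_distrib sum_subtractf)
  then have "(\<Sum>i<n. cnj (y i - y0 i) * (\<Sum>l<n. normal_entry M n i l * (y l - y0 l))) = 0" by simp
  then have "(\<Sum>k<n. (cmod (\<Sum>j<n. M k j * (y j - y0 j)))\<^sup>2) = 0"
    unfolding normal_form_eq_norm[where x = "\<lambda>i. y i - y0 i"] by (simp only: of_real_eq_0_iff)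
  then have "(\<Sum>j<n. M i j * (y j - y0 j)) = 0" using i by (simp add: sum_nonneg_eq_0_iff)
  then show ?thesis using y0 i by (simp add: y_def right_diff_distrib sum_subtractf)
qed

end

section \<open>The low-rank form of the Munthe-Kaas step\<close>

lemma stiefelD: "X \<in> stiefel r N \<Longrightarrow> X \<in> carrier_mat N r" "X \<in> stiefel r N \<Longrightarrow> mat_adjoint X * X = 1\<^sub>m r"
  by (auto simp: stiefel_def)

text \<open>The matrix called \<open>G\<close> in the introduction.\<close>
definition horizontal :: "complex mat \<Rightarrow> complex mat \<Rightarrow> complex mat" where
  "horizontal X F = F - (1/2) \<cdot>\<^sub>m (X * (mat_adjoint X * F))"

lemma horizontal_carrier:
  "X \<in> carrier_mat N r \<Longrightarrow> F \<in> carrier_mat N r \<Longrightarrow> horizontal X F \<in> carrier_mat N r"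
  by (auto simp: horizontal_def)

definition skew_product :: "complex mat \<Rightarrow> complex mat \<Rightarrow> complex mat" where
  "skew_product G X = G * mat_adjoint X - X * mat_adjoint G"

lemma skew_product_skew_herm:
  assumes G: "G \<in> carrier_mat N r" and X: "X \<in> carrier_mat N r"
  shows "skew_product G X \<in> skew_herm N"
proof (rule skew_hermI)
  have c: "G * mat_adjoint X \<in> carrier_mat N N" "X * mat_adjoint G \<in> carrier_mat N N"
    by (intro mult_carrier_mat[of _ N r _ N] mat_adjoint_carrier G X)+
  then show "skew_product G X \<in> carrier_mat N N" by (simp add: skew_product_def minus_carrier_mat)
  have "mat_adjoint (G * mat_adjoint X) = X * mat_adjoint G" "mat_adjoint (X * mat_adjoint G) = G * mat_adjoint X"
    using G X by (simp_all add: mat_adjoint_mult[of _ N r _ N])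
  then have "mat_adjoint (skew_product G X) = X * mat_adjoint G - G * mat_adjoint X"
    unfolding skew_product_def by (simp add: mat_adjoint_minus[OF c])
  then show "mat_adjoint (skew_product G X) = - skew_product G X"
    unfolding skew_product_def using carrier_matD[OF c(1)] carrier_matD[OF c(2)] by (intro eq_matI) auto
qed

text \<open>If \<open>X\<^sup>*F\<close> is skew-Hermitian, the term \<open>X X\<^sup>*F X\<^sup>*\<close> of the vector field can be split evenly between
  \<open>F X\<^sup>*\<close> and \<open>X F\<^sup>*\<close>, which leaves a skew-Hermitian product of rank at most \<open>2 r\<close>.\<close>
lemma vector_field_skew_product:
  assumes X: "X \<in> carrier_mat N r" and F: "F \<in> carrier_mat N r"
    and H: "mat_adjoint X * F \<in> skew_herm r"
  shows "(1\<^sub>m N - X * mat_adjoint X) * F * mat_adjoint X - X * mat_adjoint F = skew_product (horizontal X F) X"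
proof -
  let ?H = "mat_adjoint X * F"
  have [simp]: "mat_adjoint X \<in> carrier_mat r N" "mat_adjoint F \<in> carrier_mat r N" "?H \<in> carrier_mat r r"
    "X * ?H \<in> carrier_mat N r" "F * mat_adjoint X \<in> carrier_mat N N" "X * mat_adjoint F \<in> carrier_mat N N"
    "X * ?H * mat_adjoint X \<in> carrier_mat N N" "X * mat_adjoint X \<in> carrier_mat N N"
    using X F by auto
  have l: "(1\<^sub>m N - X * mat_adjoint X) * F = F - X * ?H"
    using X F by (subst minus_mult_distrib_mat[of _ N N _ _ r]) (auto simp: assoc_mult_mat[of _ N r _ N _ r] left_mult_one_mat[of _ N r])
  have l2: "(F - X * ?H) * mat_adjoint X = F * mat_adjoint X - X * ?H * mat_adjoint X"
    using X F by (subst minus_mult_distrib_mat[of _ N r _ _ N]) auto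
  have g: "horizontal X F * mat_adjoint X = F * mat_adjoint X - (1/2) \<cdot>\<^sub>m (X * ?H * mat_adjoint X)"
    unfolding horizontal_def using X F
    by (subst minus_mult_distrib_mat[of _ N r _ _ N]) (auto simp: mult_smult_assoc_mat[of _ N r _ N])
  have "mat_adjoint (horizontal X F) = mat_adjoint F - (1/2) \<cdot>\<^sub>m (mat_adjoint ?H * mat_adjoint X)"
    unfolding horizontal_def using X F
    by (subst mat_adjoint_minus[of _ N r]) (auto simp: mat_adjoint_smult mat_adjoint_mult[of X N r ?H r])
  also have "\<dots> = mat_adjoint F + (1/2) \<cdot>\<^sub>m (?H * mat_adjoint X)"
  proof -
    have "mat_adjoint ?H * mat_adjoint X = - (?H * mat_adjoint X)"
      unfolding skew_hermD(2)[OF H] by (rule uminus_mult_left_mat) (use X F in auto)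
    moreover have "?H * mat_adjoint X \<in> carrier_mat r N" by (rule mult_carrier_mat[of _ r r]) auto
    ultimately show ?thesis using carrier_matD[of "?H * mat_adjoint X" r N] carrier_matD[of "mat_adjoint F" r N]
      F by (intro eq_matI) auto
  qed
  finally have a: "X * mat_adjoint (horizontal X F) = X * mat_adjoint F + (1/2) \<cdot>\<^sub>m (X * ?H * mat_adjoint X)"
    using X F by (simp add: mult_add_distrib_mat[of _ N r _ N] mult_smult_distrib[of _ N r _ N]
        assoc_mult_mat[of _ N r _ r _ N] mult_carrier_mat[of _ r r _ N])
  define T where "T = X * ?H * mat_adjoint X"
  have T: "T \<in> carrier_mat N N" by (simp add: T_def)
  show ?thesis unfolding skew_product_def l l2 g a unfolding T_def[symmetric]
    using carrier_matD[OF T] X F by (intro eq_matI) (auto simp: field_simps)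
qed

lemma skew_product_conjugate:
  assumes K: "K \<in> carrier_mat N N" and G: "G \<in> carrier_mat N r" and X: "X \<in> carrier_mat N r"
  shows "K * skew_product G X * mat_adjoint K = skew_product (K * G) (K * X)"
proof -
  have [simp]: "mat_adjoint K \<in> carrier_mat N N" "mat_adjoint G \<in> carrier_mat r N" "mat_adjoint X \<in> carrier_mat r N"
    using K G X by auto
  note [simp] = K G X mult_carrier_mat[of _ N N _ N] mult_carrier_mat[of _ N N _ r] mult_carrier_mat[of _ N r _ N] mult_carrier_mat[of _ r N _ N]
  have 1: "K * (A * mat_adjoint B) * mat_adjoint K = (K * A) * mat_adjoint (K * B)"
    if [simp]: "A \<in> carrier_mat N r" "B \<in> carrier_mat N r" for A B :: "complex mat"
  proof -
    have [simp]: "mat_adjoint B \<in> carrier_mat r N" using that by auto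
    show ?thesis
      by (simp add: mat_adjoint_mult[of K N N B r] assoc_mult_mat[of _ N N _ N _ N] assoc_mult_mat[of _ N N _ r _ N] assoc_mult_mat[of _ N r _ N _ N])
  qed
  show ?thesis unfolding skew_product_def
    by (simp add: mult_minus_distrib_mat[of _ N N _ N] minus_mult_distrib_mat[of _ N N _ _ N] 1)
qed

text \<open>The mathematics of one step, for a fixed input. The matrix \<open>S\<close> enters only through being diagonal
  with imaginary entries, which makes \<open>X S X\<^sup>*\<close> skew-Hermitian, and with it every stream matrix and every \<open>\<Omega>\<close>.\<close>
locale rkmk =
  fixes N r Nh :: nat and S U :: "complex mat" and a :: "nat \<Rightarrow> nat \<Rightarrow> real" and dt :: real and s :: "nat \<Rightarrow> complex"
  assumes N: "0 < N" and U: "U \<in> stiefel r N" and S: "S = mat_diag r s"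
    and s: "\<And>i. i < r \<Longrightarrow> cnj (s i) = - s i"
begin

text \<open>For stage \<open>i\<close>: the Lie algebra element \<open>\<Omega>\<close>, the stage value, the matrices \<open>F\<close> and \<open>G\<close> there, and
  the two factors \<open>V\<close> and \<open>Z\<close> of the increment.\<close>
definition Om :: "nat \<Rightarrow> complex mat" where "Om i = rkmk_Omega N (cay N) (L_hat N Nh S) a dt U i"
definition St :: "nat \<Rightarrow> complex mat" where "St i = rkmk_stage N (cay N) (L_hat N Nh S) a dt U i"
definition Fm :: "nat \<Rightarrow> complex mat" where "Fm i = F_hat N Nh S (St i)"
definition Gm :: "nat \<Rightarrow> complex mat" where "Gm i = horizontal (St i) (Fm i)"
definition Vm :: "nat \<Rightarrow> complex mat" where "Vm i = cay_denom N (Om i) * Gm i"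
definition Zm :: "nat \<Rightarrow> complex mat" where "Zm i = cay_denom N (Om i) * St i"

lemma S_carrier: "S \<in> carrier_mat r r" unfolding S by simp

lemma S_adjoint: "mat_adjoint S = - S"
  unfolding S mat_diag_def by (intro eq_matI) (auto simp: s)

lemma density_skew:
  assumes X: "X \<in> carrier_mat N r"
  shows "X * S * mat_adjoint X \<in> skew_herm N"
proof (rule skew_hermI)
  have [simp]: "mat_adjoint X \<in> carrier_mat r N" "X * S \<in> carrier_mat N r" using X S_carrier by auto
  show "X * S * mat_adjoint X \<in> carrier_mat N N" by (rule mult_carrier_mat[of _ N r]) auto
  have "mat_adjoint (X * S * mat_adjoint X) = X * (mat_adjoint S * mat_adjoint X)"
    using X S_carrier by (simp add: mat_adjoint_mult[of _ N r _ N] mat_adjoint_mult[of X N r S r])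
  also have "\<dots> = X * - S * mat_adjoint X" unfolding S_adjoint
    using X S_carrier by (simp add: assoc_mult_mat[of _ N r _ r _ N])
  also have "\<dots> = - (X * S * mat_adjoint X)"
    using X S_carrier by (simp add: uminus_mult_right_mat[of X] uminus_mult_left_mat[of "X * S"])
  finally show "mat_adjoint (X * S * mat_adjoint X) = - (X * S * mat_adjoint X)" .
qed

lemma F_hat_facts:
  assumes X: "X \<in> carrier_mat N r"
  shows "F_hat N Nh S X \<in> carrier_mat N r" "mat_adjoint X * F_hat N Nh S X \<in> skew_herm r"
proof -
  let ?P = "P_hat N Nh (X * S * mat_adjoint X)"
  have P: "?P \<in> skew_herm N" by (rule P_hat_skew_herm[OF N density_skew[OF X]])
  note Pc = skew_hermD(1)[OF P]
  have [simp]: "mat_adjoint X \<in> carrier_mat r N" "?P * X \<in> carrier_mat N r" using X Pc by auto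
  show c: "F_hat N Nh S X \<in> carrier_mat N r" unfolding F_hat_def by simp
  have e: "mat_adjoint X * F_hat N Nh S X = complex_of_real (- inverse (hbar N)) \<cdot>\<^sub>m (mat_adjoint X * (?P * X))"
    unfolding F_hat_def by (rule mult_smult_distrib[of _ r N _ r]) auto
  have c2: "mat_adjoint X * (?P * X) \<in> carrier_mat r r" by (rule mult_carrier_mat[of _ r N]) auto
  have "mat_adjoint (mat_adjoint X * (?P * X)) = mat_adjoint X * mat_adjoint ?P * X"
    using X Pc by (simp add: mat_adjoint_mult[of _ r N _ r] mat_adjoint_mult[of _ N N X r])
  also have "\<dots> = - (mat_adjoint X * (?P * X))" unfolding skew_hermD(2)[OF P]
    using X Pc by (simp add: uminus_mult_right_mat[of "mat_adjoint X"] uminus_mult_left_mat[of "mat_adjoint X * ?P"] assoc_mult_mat[of _ r N _ N _ r])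
  finally have h: "mat_adjoint (mat_adjoint X * (?P * X)) = - (mat_adjoint X * (?P * X))" .
  show "mat_adjoint X * F_hat N Nh S X \<in> skew_herm r"
  proof (rule skew_hermI)
    show "mat_adjoint X * F_hat N Nh S X \<in> carrier_mat r r" unfolding e using c2 by simp
    show "mat_adjoint (mat_adjoint X * F_hat N Nh S X) = - (mat_adjoint X * F_hat N Nh S X)"
      unfolding e mat_adjoint_smult h by (intro eq_matI) auto
  qed
qed

lemma L_hat_eq:
  assumes X: "X \<in> carrier_mat N r"
  shows "L_hat N Nh S X = skew_product (horizontal X (F_hat N Nh S X)) X"
  unfolding L_hat_def by (rule vector_field_skew_product[OF X F_hat_facts[OF X]])

lemma L_hat_skew_herm: "X \<in> carrier_mat N r \<Longrightarrow> L_hat N Nh S X \<in> skew_herm N"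
  unfolding L_hat_eq by (intro skew_product_skew_herm[of _ N r] horizontal_carrier F_hat_facts)

lemma Om_eq:
  "Om i = complex_of_real dt \<cdot>\<^sub>m mat_lincomb N {1..<i} (a i)
     (\<lambda>j. inv_right_triv_tangent N (cay N) (Om j) (L_hat N Nh S (St j)))"
proof (cases "i \<le> 1")
  case True
  then show ?thesis unfolding Om_def by (subst rkmk_Omega.simps) (auto simp: mat_lincomb_def intro!: eq_matI)
next
  case False
  have "(if j = 1 then U else cay N (rkmk_Omega N (cay N) (L_hat N Nh S) a dt U j) * U) = St j" for j
    by (simp add: St_def rkmk_stage_def)
  then show ?thesis using False unfolding Om_def by (subst rkmk_Omega.simps) simp
qed

lemma mat_lincomb_skew_herm:
  assumes "\<And>j. j \<in> J \<Longrightarrow> M j \<in> skew_herm N"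
  shows "complex_of_real c \<cdot>\<^sub>m mat_lincomb N J w M \<in> skew_herm N"
  by (rule skew_hermI) (auto simp: mat_lincomb_def skew_herm_entry[OF assms] sum_negf intro!: eq_matI)

lemma Om_1: "i \<le> 1 \<Longrightarrow> Om i = 0\<^sub>m N N"
  unfolding Om_def by (subst rkmk_Omega.simps) simp

lemma stage_facts: "Om i \<in> skew_herm N \<and> St i \<in> stiefel r N"
proof (induction i rule: less_induct)
  case (less i)
  have Om: "Om i \<in> skew_herm N"
  proof (subst Om_eq, rule mat_lincomb_skew_herm)
    fix j assume "j \<in> {1..<i}"
    then have j: "Om j \<in> skew_herm N" "St j \<in> stiefel r N" using less by auto
    note L = L_hat_skew_herm[OF stiefelD(1)[OF j(2)]]
    show "inv_right_triv_tangent N (cay N) (Om j) (L_hat N Nh S (St j)) \<in> skew_herm N"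
      unfolding inv_right_triv_tangent_cay[OF j(1) L]
      by (rule mult_adjoint_skew_herm[OF L]) (use skew_hermD(1)[OF j(1)] in simp)
  qed
  have Uc: "U \<in> carrier_mat N r" by (rule stiefelD(1)[OF U])
  have "cay N (Om i) * U \<in> stiefel r N"
  proof -
    let ?C = "cay N (Om i)"
    have C: "?C \<in> carrier_mat N N" by (rule cay_carrier[OF Om])
    have "mat_adjoint (?C * U) * (?C * U) = mat_adjoint U * ((mat_adjoint ?C * ?C) * U)"
      using C Uc by (simp add: mat_adjoint_mult[of _ N N _ r] assoc_mult_mat[of _ r N _ N _ r] assoc_mult_mat[of _ N N _ N _ r] mult_carrier_mat[of _ N N _ r])
    also have "\<dots> = 1\<^sub>m r" unfolding cay_unitary[OF Om] using stiefelD[OF U] by (simp add: left_mult_one_mat[of _ N r])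
    finally show ?thesis using C Uc by (auto simp: stiefel_def)
  qed
  then have "St i \<in> stiefel r N" using U by (simp add: St_def rkmk_stage_def Om_def)
  then show ?case using Om by blast
qed

lemmas Om_skew = conjunct1[OF stage_facts] and St_stiefel = conjunct2[OF stage_facts]
lemmas Om_carrier = skew_hermD(1)[OF Om_skew] and St_carrier = stiefelD(1)[OF St_stiefel]

lemma U_carrier: "U \<in> carrier_mat N r" by (rule stiefelD(1)[OF U])

lemma Gm_carrier: "Gm i \<in> carrier_mat N r"
  unfolding Gm_def Fm_def by (intro horizontal_carrier F_hat_facts St_carrier)

lemma Vm_carrier: "Vm i \<in> carrier_mat N r" and Zm_carrier: "Zm i \<in> carrier_mat N r"
  unfolding Vm_def Zm_def using Om_carrier[of i] Gm_carrier[of i] St_carrier[of i]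
  by (auto intro!: mult_carrier_mat[of _ N N])

lemma increment_eq: "inv_right_triv_tangent N (cay N) (Om j) (L_hat N Nh S (St j)) = skew_product (Vm j) (Zm j)"
  unfolding inv_right_triv_tangent_cay[OF Om_skew L_hat_skew_herm[OF St_carrier]]
  unfolding L_hat_eq[OF St_carrier] Vm_def Zm_def Gm_def Fm_def
  by (rule skew_product_conjugate) (auto intro!: horizontal_carrier F_hat_facts St_carrier cay_denom_carrier Om_carrier)

text \<open>To identify \<open>cay \<Omega>\<close> times \<open>U\<close> it suffices to verify a linear equation, without inverting
  anything of size \<open>N\<close>.\<close>
lemma cay_mult_unique:
  assumes \<Omega>: "\<Omega> \<in> skew_herm N" and X: "X \<in> carrier_mat N r"
    and eq: "cay_denom N \<Omega> * X = mat_adjoint (cay_denom N \<Omega>) * U"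
  shows "X = cay N \<Omega> * U"
proof -
  note [simp] = cay_inv(1)[OF \<Omega>] skew_hermD(1)[OF \<Omega>] X U_carrier
  have "X = (cay_inv N \<Omega> * cay_denom N \<Omega>) * X" unfolding cay_inv(3)[OF \<Omega>] by (simp add: left_mult_one_mat[of _ N r])
  also have "\<dots> = cay_inv N \<Omega> * (cay_denom N \<Omega> * X)" by (simp add: assoc_mult_mat[of _ N N _ N _ r])
  also have "\<dots> = cay N \<Omega> * U" unfolding eq cay_eq[OF \<Omega>] by (simp add: assoc_mult_mat[of _ N N _ N _ r])
  finally show ?thesis .
qed

lemma St_cay: "St i = cay N (Om i) * U"
proof (cases "i = 1")
  case True
  have "U = cay N (Om 1) * U"
    by (rule cay_mult_unique[OF Om_skew U_carrier], unfold cay_denom_adjoint[OF Om_skew], unfold cay_denom_def Om_1[OF order_refl])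
      (rule arg_cong[where f = "\<lambda>X. X * U"], intro eq_matI, auto)
  then show ?thesis using True by (simp add: St_def rkmk_stage_def)
qed (simp add: St_def rkmk_stage_def Om_def)

text \<open>The factor \<open>Z\<close> of a stage is obtained from the initial \<open>U\<close>, with \<open>1 + \<Omega>/2\<close> in place of
  \<open>1 - \<Omega>/2\<close>.\<close>
lemma Zm_eq: "Zm i = mat_adjoint (cay_denom N (Om i)) * U"
proof -
  have "Zm i = (cay_denom N (Om i) * cay N (Om i)) * U"
    unfolding Zm_def St_cay using cay_carrier[OF Om_skew] Om_carrier[of i] U_carrier
    by (simp add: assoc_mult_mat[of _ N N _ N _ r])
  then show ?thesis unfolding cay_denom_mult_cay[OF Om_skew] .
qed

subsection \<open>Factored form\<close>

text \<open>Column \<open>c\<close> of the factors \<open>P\<close> and \<open>Q\<close> of \<open>\<Omega> = P D Q\<^sup>*\<close>. Stage \<open>j\<close> owns the \<open>2 r\<close> columns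
  from \<open>2 r (j - 1)\<close> on, so that later stages only append columns; only the weights \<open>D\<close> depend on the
  stage that uses them.\<close>
definition left_col :: "nat \<Rightarrow> nat \<Rightarrow> complex" where
  "left_col c p = (let j = Suc (c div (2 * r)); t = c mod (2 * r) in
     if t < r then Vm j $$ (p, t) else Zm j $$ (p, t - r))"

definition right_col :: "nat \<Rightarrow> nat \<Rightarrow> complex" where
  "right_col c p = (let j = Suc (c div (2 * r)); t = c mod (2 * r) in
     if t < r then Zm j $$ (p, t) else - Vm j $$ (p, t - r))"

definition weight :: "nat \<Rightarrow> nat \<Rightarrow> complex" where
  "weight i c = of_real dt * of_real (a i (Suc (c div (2 * r))))"

definition gram :: "nat \<Rightarrow> nat \<Rightarrow> complex" where
  "gram c d = (\<Sum>p<N. cnj (right_col c p) * left_col d p)"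

definition col_count :: "nat \<Rightarrow> nat" where "col_count i = (i - 1) * (2 * r)"

lemma Om_entry:
  assumes pq: "p < N" "q < N"
  shows "Om i $$ (p, q) = (\<Sum>c<col_count i. weight i c * left_col c p * cnj (right_col c q))"
proof -
  let ?g = "\<lambda>c. left_col c p * cnj (right_col c q)"
  have dv: "c div (2 * r) = m" if "m * (2 * r) \<le> c" "c < m * (2 * r) + 2 * r" for c m
    using that by (intro div_nat_eqI) (auto simp: algebra_simps)
  have block: "(\<Sum>c\<in>{m * (2 * r)..<m * (2 * r) + 2 * r}. weight i c * left_col c p * cnj (right_col c q)) =
     of_real dt * (of_real (a i (Suc m)) * skew_product (Vm (Suc m)) (Zm (Suc m)) $$ (p, q))" for m
  proof -
    have "(\<Sum>c\<in>{m * (2 * r)..<m * (2 * r) + 2 * r}. weight i c * left_col c p * cnj (right_col c q)) =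
       (\<Sum>t<2 * r. of_real dt * of_real (a i (Suc m)) * ?g (m * (2 * r) + t))"
      by (rule sum.reindex_bij_witness[of _ "\<lambda>t. m * (2 * r) + t" "\<lambda>c. c - m * (2 * r)"])
        (auto simp: weight_def dv)
    also have "\<dots> = of_real dt * of_real (a i (Suc m)) * (\<Sum>t<2 * r. ?g (m * (2 * r) + t))"
      by (simp add: sum_distrib_left)
    also have "(\<Sum>t<2 * r. ?g (m * (2 * r) + t)) = (\<Sum>t<r. ?g (m * (2 * r) + t)) + (\<Sum>t<r. ?g (m * (2 * r) + (r + t)))"
    proof -
      have "(\<Sum>t<2 * r. ?g (m * (2 * r) + t)) = (\<Sum>t<r. ?g (m * (2 * r) + t)) + (\<Sum>t\<in>{r..<2 * r}. ?g (m * (2 * r) + t))"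
        by (subst sum.union_disjoint[symmetric]) (auto intro!: sum.cong)
      also have "(\<Sum>t\<in>{r..<2 * r}. ?g (m * (2 * r) + t)) = (\<Sum>t<r. ?g (m * (2 * r) + (r + t)))"
        by (rule sum.reindex_bij_witness[of _ "\<lambda>t. r + t" "\<lambda>c. c - r"]) auto
      finally show ?thesis .
    qed
    also have "\<dots> = (\<Sum>t<r. Vm (Suc m) $$ (p, t) * cnj (Zm (Suc m) $$ (q, t))) + (\<Sum>t<r. - (Zm (Suc m) $$ (p, t) * cnj (Vm (Suc m) $$ (q, t))))"
      by (intro arg_cong2[where f = "(+)"] sum.cong refl) (auto simp: left_col_def right_col_def Let_def)
    also have "\<dots> = skew_product (Vm (Suc m)) (Zm (Suc m)) $$ (p, q)"
      using pq carrier_matD[OF Vm_carrier[of "Suc m"]] carrier_matD[OF Zm_carrier[of "Suc m"]]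
      by (simp add: skew_product_def scalar_prod_def lessThan_atLeast0 sum_negf)
    finally show ?thesis by (simp only: mult.assoc)
  qed
  have "Om i $$ (p, q) = of_real dt * (\<Sum>j\<in>{1..<i}. of_real (a i j) * skew_product (Vm j) (Zm j) $$ (p, q))"
    using pq by (subst Om_eq) (simp add: mat_lincomb_def increment_eq)
  also have "\<dots> = (\<Sum>m<i - 1. of_real dt * (of_real (a i (Suc m)) * skew_product (Vm (Suc m)) (Zm (Suc m)) $$ (p, q)))"
    unfolding sum_distrib_left
    by (rule sum.reindex_bij_witness[of _ Suc "\<lambda>j. j - 1"]) auto
  also have "\<dots> = (\<Sum>c<col_count i. weight i c * left_col c p * cnj (right_col c q))"
    unfolding col_count_def block[symmetric] by (rule sum.nat_group)
  finally show ?thesis .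
qed

lemma Om_mult_entry:
  assumes X: "X \<in> carrier_mat N k" and pt: "p < N" "t < k"
  shows "(Om i * X) $$ (p, t) = (\<Sum>c<col_count i. weight i c * left_col c p * (\<Sum>q<N. cnj (right_col c q) * X $$ (q, t)))"
proof -
  have "(Om i * X) $$ (p, t) = (\<Sum>q<N. \<Sum>c<col_count i. weight i c * left_col c p * (cnj (right_col c q) * X $$ (q, t)))"
    using X pt Om_carrier[of i] by (simp add: scalar_prod_def lessThan_atLeast0 Om_entry sum_distrib_right mult.assoc)
  also have "\<dots> = (\<Sum>c<col_count i. \<Sum>q<N. weight i c * left_col c p * (cnj (right_col c q) * X $$ (q, t)))"
    by (rule sum.swap)
  finally show ?thesis by (simp add: sum_distrib_left)
qed

definition gram_U :: "nat \<Rightarrow> nat \<Rightarrow> complex" where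
  "gram_U c t = (\<Sum>q<N. cnj (right_col c q) * U $$ (q, t))"

text \<open>The matrix \<open>1 - Q\<^sup>*P D/2\<close> of the Woodbury identity.\<close>
definition core :: "nat \<Rightarrow> nat \<Rightarrow> nat \<Rightarrow> complex" where
  "core i c d = (if c = d then 1 else 0) - gram c d * weight i d / 2"

text \<open>A kernel vector \<open>x\<close> yields \<open>v = P D x\<close> with \<open>v = \<Omega> v / 2\<close>, hence \<open>v = 0\<close>; and \<open>x\<close> can be recovered
  from \<open>v\<close> as \<open>Q\<^sup>*v / 2\<close>.\<close>
lemma core_injective: "injective_system (core i) (col_count i)"
proof
  fix x c assume x: "\<And>c. c < col_count i \<Longrightarrow> (\<Sum>d<col_count i. core i c d * x d) = 0" and c: "c < col_count i"
  let ?n = "col_count i"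
  define v where "v p = (\<Sum>d<?n. weight i d * left_col d p * x d)" for p
  have xe: "x c = (\<Sum>q<N. cnj (right_col c q) * v q) / 2" if c: "c < ?n" for c
  proof -
    have "(\<Sum>d<?n. core i c d * x d) = (\<Sum>d<?n. (if c = d then x d else 0) - gram c d * weight i d * x d / 2)"
      by (intro sum.cong refl) (auto simp: core_def left_diff_distrib)
    also have "\<dots> = x c - (\<Sum>d<?n. gram c d * weight i d * x d) / 2"
      using c by (simp add: sum_subtractf sum_divide_distrib)
    also have "(\<Sum>d<?n. gram c d * weight i d * x d) = (\<Sum>q<N. cnj (right_col c q) * v q)"
      unfolding gram_def v_def sum_distrib_left sum_distrib_right
      by (subst sum.swap) (simp add: algebra_simps)
    finally show ?thesis using x[OF c] by simp
  qed
  have "v p = complex_of_real (1/2) * (\<Sum>q<N. Om i $$ (p, q) * v q)" if p: "p < N" for p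
  proof -
    have "v p = (\<Sum>d<?n. weight i d * left_col d p * ((\<Sum>q<N. cnj (right_col d q) * v q) / 2))"
      unfolding v_def[of p] using xe by (intro sum.cong refl) auto
    also have "\<dots> = 1/2 * (\<Sum>d<?n. \<Sum>q<N. weight i d * left_col d p * (cnj (right_col d q) * v q))"
      by (simp add: sum_distrib_left sum_divide_distrib)
    also have "(\<Sum>d<?n. \<Sum>q<N. weight i d * left_col d p * (cnj (right_col d q) * v q)) = (\<Sum>q<N. Om i $$ (p, q) * v q)"
      by (subst sum.swap) (simp add: Om_entry[OF p] sum_distrib_right mult.assoc)
    finally show ?thesis by simp
  qed
  then have "v p = 0" if "p < N" for p by (rule skew_herm_no_real_eigenvector[OF Om_skew _ that])
  then show "x c = 0" using xe[OF c] by simp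
qed

definition core_sol :: "nat \<Rightarrow> nat \<Rightarrow> nat \<Rightarrow> complex" where
  "core_sol i t = conj_solve (core i) (col_count i) (\<lambda>c. gram_U c t)"

lemma Zm_entry:
  assumes "p < N" "t < r"
  shows "Zm i $$ (p, t) = U $$ (p, t) + (\<Sum>c<col_count i. weight i c * left_col c p * gram_U c t) / 2"
proof -
  have "Zm i = U + (1/2) \<cdot>\<^sub>m (Om i * U)"
    unfolding Zm_eq cay_denom_adjoint[OF Om_skew] using Om_carrier[of i] U_carrier
    by (simp add: add_mult_distrib_mat[of _ N N _ _ r] mult_smult_assoc_mat[of _ N N _ r] left_mult_one_mat[of _ N r])
  then show ?thesis using assms Om_carrier[of i] U_carrier
    by (simp add: Om_mult_entry[OF U_carrier] gram_U_def del: index_mult_mat(1))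
qed

lemma cay_denom_mult_entry:
  assumes X: "X \<in> carrier_mat N r" and pt: "p < N" "t < r"
  shows "(cay_denom N (Om i) * X) $$ (p, t) = X $$ (p, t) -
     (\<Sum>c<col_count i. weight i c * left_col c p * (\<Sum>q<N. cnj (right_col c q) * X $$ (q, t))) / 2"
proof -
  have "cay_denom N (Om i) * X = X - (1/2) \<cdot>\<^sub>m (Om i * X)"
    unfolding cay_denom_def using Om_carrier[of i] X
    by (simp add: minus_mult_distrib_mat[of _ N N _ _ r] mult_smult_assoc_mat[of _ N N _ r] left_mult_one_mat[of _ N r])
  then show ?thesis using pt Om_carrier[of i] X
    by (simp add: Om_mult_entry[OF X] del: index_mult_mat(1))
qed

lemma Vm_entry:
  assumes "p < N" "t < r"
  shows "Vm i $$ (p, t) = Gm i $$ (p, t) -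
     (\<Sum>c<col_count i. weight i c * left_col c p * (\<Sum>q<N. cnj (right_col c q) * Gm i $$ (q, t))) / 2"
  unfolding Vm_def by (rule cay_denom_mult_entry[OF Gm_carrier assms])

text \<open>The Woodbury identity in the form \<open>cay \<Omega> U = U + P D y\<close>, where \<open>y\<close> solves the small system with
  right-hand side \<open>Q\<^sup>*U\<close>.\<close>
lemma St_entry:
  assumes pt: "p < N" "t < r"
  shows "St i $$ (p, t) = U $$ (p, t) + (\<Sum>c<col_count i. weight i c * left_col c p * core_sol i t c)"
proof -
  let ?n = "col_count i"
  define X where "X = mat N r (\<lambda>(p, t). U $$ (p, t) + (\<Sum>c<?n. weight i c * left_col c p * core_sol i t c))"
  have Xc: "X \<in> carrier_mat N r" by (simp add: X_def)
  have "X = cay N (Om i) * U"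
  proof (rule cay_mult_unique[OF Om_skew Xc], fold Zm_eq, rule eq_matI)
    fix p t assume "p < dim_row (Zm i)" "t < dim_col (Zm i)"
    then have pt: "p < N" "t < r" using carrier_matD[OF Zm_carrier[of i]] by auto
    have inner: "(\<Sum>q<N. cnj (right_col c q) * X $$ (q, t)) = gram_U c t + (\<Sum>d<?n. gram c d * weight i d * core_sol i t d)" for c
    proof -
      have "(\<Sum>q<N. cnj (right_col c q) * X $$ (q, t)) = (\<Sum>q<N. cnj (right_col c q) * U $$ (q, t) +
          (\<Sum>d<?n. cnj (right_col c q) * left_col d q * weight i d * core_sol i t d))"
        using pt by (intro sum.cong refl) (auto simp: X_def sum_distrib_left algebra_simps)
      also have "\<dots> = gram_U c t + (\<Sum>d<?n. \<Sum>q<N. cnj (right_col c q) * left_col d q * weight i d * core_sol i t d)"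
        unfolding sum.distrib gram_U_def by (subst (2) sum.swap) simp
      finally show ?thesis by (simp add: gram_def sum_distrib_right)
    qed
    have alg: "(\<Sum>c<n. w c * y c) - (\<Sum>c<n. w c * (g c + h c)) / 2 = (\<Sum>c<n. w c * ((y c - h c / 2) - g c / 2))"
      for w y g h :: "nat \<Rightarrow> complex" and n :: nat
      unfolding sum_divide_distrib sum_subtractf[symmetric] by (intro sum.cong refl) (simp add: field_simps)
    have sol: "core_sol i t c - (\<Sum>d<?n. gram c d * weight i d * core_sol i t d) / 2 = gram_U c t" if c: "c < ?n" for c
    proof -
      have "gram_U c t = (\<Sum>d<?n. core i c d * core_sol i t d)"
        unfolding core_sol_def by (rule injective_system.conj_solve[OF core_injective c, symmetric])
      also have "\<dots> = (\<Sum>d<?n. (if c = d then core_sol i t d else 0) - gram c d * weight i d * core_sol i t d / 2)"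
        by (intro sum.cong refl) (auto simp: core_def left_diff_distrib)
      also have "\<dots> = core_sol i t c - (\<Sum>d<?n. gram c d * weight i d * core_sol i t d) / 2"
        using c by (simp add: sum_subtractf sum_divide_distrib)
      finally show ?thesis by simp
    qed
    have "(cay_denom N (Om i) * X) $$ (p, t) = U $$ (p, t) + ((\<Sum>c<?n. weight i c * left_col c p * core_sol i t c) -
       (\<Sum>c<?n. weight i c * left_col c p * (gram_U c t + (\<Sum>d<?n. gram c d * weight i d * core_sol i t d))) / 2)"
      unfolding cay_denom_mult_entry[OF Xc pt] inner using pt by (simp add: X_def)
    also have "(\<Sum>c<?n. weight i c * left_col c p * core_sol i t c) -
       (\<Sum>c<?n. weight i c * left_col c p * (gram_U c t + (\<Sum>d<?n. gram c d * weight i d * core_sol i t d))) / 2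
       = (\<Sum>c<?n. weight i c * left_col c p * ((core_sol i t c - (\<Sum>d<?n. gram c d * weight i d * core_sol i t d) / 2) - gram_U c t / 2))"
      by (rule alg)
    also have "\<dots> = (\<Sum>c<?n. weight i c * left_col c p * (gram_U c t / 2))"
      by (intro sum.cong refl) (simp add: sol)
    also have "\<dots> = (\<Sum>c<?n. weight i c * left_col c p * gram_U c t) / 2"
      by (simp add: sum_divide_distrib)
    also have "U $$ (p, t) + \<dots> = Zm i $$ (p, t)" unfolding Zm_entry[OF pt] ..
    finally show "(cay_denom N (Om i) * X) $$ (p, t) = Zm i $$ (p, t)" .
  qed (use carrier_matD[OF Zm_carrier[of i]] carrier_matD[OF Xc] carrier_matD[OF Om_carrier[of i]] in \<open>auto simp: cay_denom_def\<close>)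
  then have "St i = X" unfolding St_cay by simp
  then show ?thesis using pt by (simp add: X_def)
qed

end

section \<open>Programs for linear solvers\<close>

context straight_line
begin

text \<open>Each direction is stored together with its image and its energy, so every new direction costs
  \<open>O(n\<^sup>2)\<close>. The columns of the right-hand side share the directions.\<close>
lemma derives_conj_solve:
  fixes M b :: "nat \<Rightarrow> nat \<Rightarrow> 'e \<Rightarrow> complex"
  assumes inj: "\<And>e. e \<in> E \<Longrightarrow> injective_system (\<lambda>i j. M i j e) n"
  shows "derives (ents n n M \<union> ents n m b) (13 * n ^ 3 + 9 * m * n ^ 2)
    (ents n m (\<lambda>i t e. conj_solve (\<lambda>i j. M i j e) n (\<lambda>c. b c t e) i))"
proof -
  let ?M = "\<lambda>e i j. M i j e"
  define nrm where "nrm i j e = normal_entry (?M e) n i j" for i j e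
  define dir where "dir k i e = conj_dir (?M e) n k i" for k i e
  define img where "img k i e = conj_image (?M e) n k i" for k i e
  define en where "en k e = conj_energy (?M e) n k" for k e
  define f where "f c t e = (\<Sum>l<n. cnj (M l c e) * b l t e)" for c t e
  define cf where "cf k t e = conj_coeff (?M e) n (\<lambda>c. f c t e) k" for k t e
  define sol where "sol i t e = conj_solve (?M e) n (\<lambda>c. b c t e) i" for i t e
  define K where "K = ents n n M \<union> ents n m b"
  define X where "X k = (dir k ` {..<n} \<union> img k ` {..<n}) \<union> {en k}" for k
  define K1 where "K1 = ents n n nrm"
  have 1: "derives K (n * n * (3 * n)) K1"
    unfolding K1_def
  proof (rule derives_ents)
    fix i j assume ij: "i < n" "j < n"
    have "derives K (n * (0 + 1 + 0 + 1 + 1)) {\<lambda>e. \<Sum>k<n. cnj (M k i e) * M k j e}"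
      using ij by (intro derives_sum derives_mult derives_cnj derives_mem) (auto simp: K_def)
    then show "derives K (3 * n) {nrm i j}"
      unfolding nrm_def[abs_def] normal_entry_def by (rule derives_le) simp
  qed
  have 2: "derives (K \<union> K1) (n * (6 * n * n + 4 * n)) (\<Union>k<n. X k)"
  proof (rule derives_recursion)
    fix k assume k: "k < n"
    let ?K = "K \<union> K1 \<union> (\<Union>j<k. X j)"
    have d: "derives ?K (n * (4 * n + 1)) (dir k ` {..<n})"
    proof -
      have "derives ?K (n * (4 * n + 1)) (\<Union>i<n. {dir k i})"
      proof (rule derives_family)
        fix i assume i: "i < n"
        have "derives ?K (0 + (k * (0 + 1 + 0 + 1 + 0 + 1 + 1)) + 1)
          {\<lambda>e. (if i = k then 1 else 0) - (\<Sum>j<k. cnj (img j k e) / en j e * dir j i e)}"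
        proof (intro derives_diff derives_sum derives_mult derives_divide derives_cnj)
          show "derives ?K 0 {\<lambda>e. if i = k then 1 else 0}" by (simp add: derives_one derives_zero)
          fix j assume j: "j < k"
          show "derives ?K 0 {img j k}" "derives ?K 0 {en j}" "derives ?K 0 {dir j i}"
            using j i k by (auto intro!: derives_mem simp: X_def)
          show "en j e \<noteq> 0" if "e \<in> E" for e
            unfolding en_def by (rule injective_system.conj_energy_nonzero[OF inj[OF that]]) (use j k in simp)
        qed
        then have "derives ?K (0 + (k * (0 + 1 + 0 + 1 + 0 + 1 + 1)) + 1) {dir k i}"
          by (rule derives_cong) (unfold dir_def, subst (2) conj_dir_rec, simp add: img_def en_def)
        then show "derives ?K (4 * n + 1) {dir k i}" by (rule derives_le) (use k in simp)
      qed
      then show ?thesis by (simp add: UNION_singleton_eq_range)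
    qed
    have i: "derives (?K \<union> dir k ` {..<n}) (n * (2 * n)) (img k ` {..<n})"
    proof -
      have "derives (?K \<union> dir k ` {..<n}) (n * (2 * n)) (\<Union>i<n. {img k i})"
      proof (rule derives_family)
        fix i assume i: "i < n"
        have "derives (?K \<union> dir k ` {..<n}) (n * (0 + 0 + 1 + 1)) {\<lambda>e. \<Sum>l<n. nrm i l e * dir k l e}"
          using i by (intro derives_sum derives_mult derives_mem) (auto simp: K1_def)
        then show "derives (?K \<union> dir k ` {..<n}) (2 * n) {img k i}"
          unfolding img_def[abs_def] conj_image_def nrm_def dir_def by (rule derives_le) simp
      qed
      then show ?thesis by (simp add: UNION_singleton_eq_range)
    qed
    have "derives (?K \<union> (dir k ` {..<n} \<union> img k ` {..<n})) (n * (0 + 1 + 0 + 1 + 1)) {\<lambda>e. \<Sum>l<n. cnj (dir k l e) * img k l e}"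
      by (intro derives_sum derives_mult derives_cnj derives_mem) auto
    then have e: "derives (?K \<union> (dir k ` {..<n} \<union> img k ` {..<n})) (3 * n) {en k}"
      unfolding en_def[abs_def] conj_energy_def img_def dir_def by (rule derives_le) simp
    have "derives ?K (n * (4 * n + 1) + n * (2 * n) + 3 * n) (X k)"
      unfolding X_def[of k] by (rule derives_seq[OF derives_seq[OF d i] e])
    then show "derives ?K (6 * n * n + 4 * n) (X k)" by (rule derives_le) (simp add: algebra_simps)
  qed
  define K2 where "K2 = K \<union> (K1 \<union> (\<Union>k<n. X k))"
  have 12: "derives K (n * n * (3 * n) + n * (6 * n * n + 4 * n)) (K1 \<union> (\<Union>k<n. X k))"
    by (rule derives_seq[OF 1 2])
  have 3: "derives K2 (n * m * (3 * n)) (ents n m f)"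
  proof (rule derives_ents)
    fix c t assume "c < n" "t < m"
    then have "derives K2 (n * (0 + 1 + 0 + 1 + 1)) {\<lambda>e. \<Sum>l<n. cnj (M l c e) * b l t e}"
      by (intro derives_sum derives_mult derives_cnj derives_mem) (auto simp: K2_def K_def)
    then show "derives K2 (3 * n) {f c t}" unfolding f_def[abs_def] by (rule derives_le) simp
  qed
  have 4: "derives (K2 \<union> ents n m f) (n * m * (3 * n + 1)) (ents n m cf)"
  proof (rule derives_ents)
    fix k t assume k: "k < n" "t < m"
    have "derives (K2 \<union> ents n m f) (n * (0 + 1 + 0 + 1 + 1) + 0 + 1) {\<lambda>e. (\<Sum>c<n. cnj (dir k c e) * f c t e) / en k e}"
    proof (intro derives_divide derives_sum derives_mult derives_cnj derives_mem)
      show "en k e \<noteq> 0" if "e \<in> E" for e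
        unfolding en_def by (rule injective_system.conj_energy_nonzero[OF inj[OF that] k(1)])
    qed (use k in \<open>auto simp: K2_def X_def\<close>)
    then show "derives (K2 \<union> ents n m f) (3 * n + 1) {cf k t}"
      unfolding cf_def[abs_def] conj_coeff_def en_def dir_def by (rule derives_le) simp
  qed
  have 5: "derives (K2 \<union> (ents n m f \<union> ents n m cf)) (n * m * (2 * n)) (ents n m sol)"
  proof (rule derives_ents)
    fix i t assume i: "i < n" "t < m"
    have "derives (K2 \<union> (ents n m f \<union> ents n m cf)) (n * (0 + 0 + 1 + 1)) {\<lambda>e. \<Sum>k<n. cf k t e * dir k i e}"
      using i by (intro derives_sum derives_mult derives_mem) (auto simp: K2_def X_def)
    then show "derives (K2 \<union> (ents n m f \<union> ents n m cf)) (2 * n) {sol i t}"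
      unfolding sol_def[abs_def] conj_solve_def cf_def f_def[abs_def] dir_def by (rule derives_le) simp
  qed
  have "derives K2 (n * m * (3 * n) + n * m * (3 * n + 1) + n * m * (2 * n)) (ents n m sol)"
    by (rule derives_then[OF derives_seq[OF 3 4] 5])
  then have "derives K (n * n * (3 * n) + n * (6 * n * n + 4 * n) + (n * m * (3 * n) + n * m * (3 * n + 1) + n * m * (2 * n))) (ents n m sol)"
    unfolding K2_def by (rule derives_then[OF 12])
  then have "derives K (13 * n ^ 3 + 9 * m * n ^ 2) (ents n m sol)"
  proof (rule derives_le)
    have "n * n \<le> n ^ 3" by (cases n) (auto simp: power3_eq_cube)
    moreover have "n * m \<le> m * n ^ 2" by (cases n) (auto simp: power2_eq_square)
    moreover have "n * n * (3 * n) + n * (6 * n * n + 4 * n) + (n * m * (3 * n) + n * m * (3 * n + 1) + n * m * (2 * n))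
      = 9 * n ^ 3 + 4 * (n * n) + 8 * (m * n ^ 2) + n * m"
      by (simp add: algebra_simps power2_eq_square power3_eq_cube)
    ultimately show "n * n * (3 * n) + n * (6 * n * n + 4 * n) + (n * m * (3 * n) + n * m * (3 * n + 1) + n * m * (2 * n)) \<le> 13 * n ^ 3 + 9 * m * n ^ 2"
      by linarith
  qed
  then show ?thesis unfolding K_def sol_def[abs_def] .
qed

text \<open>The last component \<open>z\<close> is left open, because it is computed differently on the main diagonal.\<close>
lemma derives_back_subst:
  fixes d w x :: "nat \<Rightarrow> 'e \<Rightarrow> complex" and z :: "'e \<Rightarrow> complex"
  assumes piv: "\<And>e i. e \<in> E \<Longrightarrow> Suc i < L \<Longrightarrow> elim_pivot (\<lambda>i. d i e) (\<lambda>i. w i e) i \<noteq> 0"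
    and K: "\<And>i. i < L \<Longrightarrow> derives K 0 {d i}" "\<And>i. i < L \<Longrightarrow> derives K 0 {w i}" "\<And>i. i < L \<Longrightarrow> derives K 0 {x i}"
    and z: "\<And>K'. 0 < L \<Longrightarrow> derives K' 0 {\<lambda>e. elim_pivot (\<lambda>i. d i e) (\<lambda>i. w i e) (L - 1)} \<Longrightarrow>
       derives K' 0 {\<lambda>e. elim_rhs (\<lambda>i. d i e) (\<lambda>i. w i e) (\<lambda>i. x i e) (L - 1)} \<Longrightarrow> derives K' 1 {z}"
  shows "derives K (10 * L) ((\<lambda>k e. back_subst (\<lambda>i. d i e) (\<lambda>i. w i e) (\<lambda>i. x i e) L (z e) k) ` {..<L})"
proof -
  define P where "P i e = elim_pivot (\<lambda>i. d i e) (\<lambda>i. w i e) i" for i e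
  define R where "R i e = elim_rhs (\<lambda>i. d i e) (\<lambda>i. w i e) (\<lambda>i. x i e) i" for i e
  define B where "B k e = back_subst (\<lambda>i. d i e) (\<lambda>i. w i e) (\<lambda>i. x i e) L (z e) k" for k e
  have K': "derives K' 0 {d i}" "derives K' 0 {w i}" "derives K' 0 {x i}" if "i < L" "K \<subseteq> K'" for i K'
    using K[OF that(1)] that(2) by (auto elim: derives_mono)
  have 1: "derives K (L * 6) (\<Union>i<L. {P i} \<union> {R i})"
  proof (rule derives_recursion)
    fix k assume k: "k < L"
    let ?K = "K \<union> (\<Union>j<k. {P j} \<union> {R j})"
    have "derives ?K 3 {P k} \<and> derives ?K 3 {R k}"
    proof (cases k)
      case 0
      then show ?thesis using K'[of 0 ?K] k
        by (auto simp: P_def[abs_def] R_def[abs_def] intro: derives_le)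
    next
      case (Suc j)
      have mem: "derives ?K 0 {P j}" "derives ?K 0 {R j}" using Suc by (auto intro!: derives_mem)
      have nz: "P j e \<noteq> 0" if "e \<in> E" for e unfolding P_def using piv[OF that, of j] Suc k by simp
      have "derives ?K (0 + (0 + 0 + 1 + 0 + 1) + 1) {\<lambda>e. d (Suc j) e - w j e * w j e / P j e}"
        by (intro derives_diff derives_divide derives_mult mem nz K') (use Suc k in auto)
      moreover have "derives ?K (0 + (0 + 0 + 1 + 0 + 1) + 1) {\<lambda>e. x (Suc j) e + w j e * R j e / P j e}"
        by (intro derives_add derives_divide derives_mult mem nz K') (use Suc k in auto)
      ultimately show ?thesis using Suc by (simp add: P_def[abs_def] R_def[abs_def] numeral_3_eq_3)
    qed
    then have "derives ?K (3 + 3) ({P k} \<union> {R k})" by (intro derives_Un) auto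
    then show "derives ?K 6 ({P k} \<union> {R k})" by simp
  qed
  let ?K1 = "K \<union> (\<Union>i<L. {P i} \<union> {R i})"
  have 2: "derives ?K1 (L * 3) (\<Union>k<L. {B k})"
  proof (rule derives_recursion)
    fix k assume k: "k < L"
    let ?K = "?K1 \<union> (\<Union>j<k. {B j})"
    have PR: "derives ?K 0 {P i}" "derives ?K 0 {R i}" if "i < L" for i
      using that by (auto intro!: derives_mem)
    show "derives ?K 3 {B k}"
    proof (cases k)
      case 0
      have "derives ?K 1 {z}" using z[of ?K] PR[of "L - 1"] k by (simp add: P_def[abs_def] R_def[abs_def])
      then show ?thesis using 0 by (auto simp: B_def[abs_def] intro: derives_le)
    next
      case (Suc j)
      have i: "Suc (L - 2 - j) < L" using k Suc by auto
      have Bj: "derives ?K 0 {B j}" using Suc by (intro derives_mem) auto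
      have "derives ?K (0 + (0 + 0 + 1) + 1 + 0 + 1) {\<lambda>e. (R (L - 2 - j) e + w (L - 2 - j) e * B j e) / P (L - 2 - j) e}"
        using i by (intro derives_divide derives_add derives_mult PR K' Bj) (auto simp: P_def piv)
      then show ?thesis using Suc by (simp add: B_def[abs_def] P_def R_def numeral_3_eq_3)
    qed
  qed
  have "derives K (L * 6 + L * 3) (\<Union>k<L. {B k})" by (rule derives_then[OF 1 2])
  then have "derives K (10 * L) (\<Union>k<L. {B k})" by (rule derives_le) simp
  moreover have "(\<Union>k<L. {B k}) = B ` {..<L}" by auto
  ultimately show ?thesis unfolding B_def[abs_def] by simp
qed

end

section \<open>A program for one step\<close>

type_synonym step_data = "complex mat \<times> complex mat \<times> real \<times> (nat \<Rightarrow> nat \<Rightarrow> real) \<times> (nat \<Rightarrow> real)"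

text \<open>The program may depend on \<open>N\<close>, \<open>r\<close>, \<open>Nh\<close> and \<open>Ns\<close>, but not on these data.\<close>
definition data_env :: "nat \<Rightarrow> step_data \<Rightarrow> step_input \<Rightarrow> complex" where
  "data_env N = (\<lambda>(S, U, dt, a, b). step_env N S a b dt U)"

definition admissible_data :: "nat \<Rightarrow> nat \<Rightarrow> step_data set" where
  "admissible_data N r = {(S, U, dt, a, b). U \<in> stiefel r N \<and>
     (\<exists>s. S = mat_diag r s \<and> (\<forall>i<r. cnj (s i) = - s i))}"

lemma diag_sandwich_entry:
  assumes T: "T = mat_diag r s" and X: "X \<in> carrier_mat N r" and pq: "p < N" "q < N"
  shows "(X * T * mat_adjoint X) $$ (p, q) = (\<Sum>k<r. X $$ (p, k) * T $$ (k, k) * cnj (X $$ (q, k)))"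
  unfolding T mat_diag_mult_right[OF X] using X pq
  by (simp add: scalar_prod_def lessThan_atLeast0 mat_diag_def)

locale step_program =
  fixes N r Nh Ns :: nat
  assumes N2: "2 \<le> N" and r: "1 \<le> r" and Nh: "1 \<le> Nh" "Nh < N" and Ns: "1 \<le> Ns"
begin

sublocale straight_line "data_env N" "admissible_data N r" .

abbreviation "S_of (e :: step_data) \<equiv> fst e"
abbreviation "U_of (e :: step_data) \<equiv> fst (snd e)"
abbreviation "dt_of (e :: step_data) \<equiv> fst (snd (snd e))"
abbreviation "a_of (e :: step_data) \<equiv> (fst (snd (snd (snd e))))(Suc Ns := snd (snd (snd (snd e))))"

definition spec_of :: "step_data \<Rightarrow> nat \<Rightarrow> complex" where
  "spec_of e = (SOME s. S_of e = mat_diag r s \<and> (\<forall>i<r. cnj (s i) = - s i))"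

lemma rkmk: "e \<in> admissible_data N r \<Longrightarrow> rkmk N r (S_of e) (U_of e) (spec_of e)"
proof -
  assume e: "e \<in> admissible_data N r"
  then have "\<exists>s. S_of e = mat_diag r s \<and> (\<forall>i<r. cnj (s i) = - s i)" and U: "U_of e \<in> stiefel r N"
    by (auto simp: admissible_data_def)
  from this(1) have "S_of e = mat_diag r (spec_of e) \<and> (\<forall>i<r. cnj (spec_of e i) = - spec_of e i)"
    unfolding spec_of_def by (rule someI_ex)
  then show ?thesis using N2 U by (intro rkmk.intro) simp_all
qed

subsection \<open>Input data\<close>

text \<open>From here on, the quantities of the previous section become functions of the data, so that programs
  can be said to derive them. The coefficients \<open>b\<close> occupy row \<open>Ns + 1\<close> of the Runge--Kutta table,
  which turns the final update into the value of stage \<open>Ns + 1\<close>.\<close>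
definition Uf where "Uf p t (e :: step_data) = U_of e $$ (p, t)"
definition Sf where "Sf i (e :: step_data) = S_of e $$ (i, i)"
definition weightf where "weightf i c e = rkmk.weight r (a_of e) (dt_of e) i c"
lemma derives_U: "p < N \<Longrightarrow> t < r \<Longrightarrow> derives K 0 {Uf p t}"
  by (rule derives_cong[OF derives_input[of K "In_U p t"]])
    (auto simp: Uf_def data_env_def admissible_data_def stiefel_def)

lemma derives_S: "i < r \<Longrightarrow> derives K 0 {Sf i}"
  by (rule derives_cong[OF derives_input[of K "In_S i"]])
    (auto simp: Sf_def data_env_def admissible_data_def mat_diag_def)

lemma derives_weight: "derives K 1 {weightf i c}"
proof -
  let ?j = "Suc (c div (2 * r))"
  have "derives K (0 + 0 + 1) {\<lambda>e. data_env N e In_dt * data_env N e (if i = Suc Ns then In_b ?j else In_a i ?j)}"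
    by (intro derives_mult derives_input)
  then have "derives K 1 {\<lambda>e. data_env N e In_dt * data_env N e (if i = Suc Ns then In_b ?j else In_a i ?j)}" by simp
  then show ?thesis
  proof (rule derives_cong)
    fix e assume e: "e \<in> admissible_data N r"
    show "data_env N e In_dt * data_env N e (if i = Suc Ns then In_b ?j else In_a i ?j) = weightf i c e"
      unfolding weightf_def rkmk.weight_def[OF rkmk[OF e]] by (auto simp: data_env_def split: prod.split)
  qed
qed

lemma derives_hbar: "derives K 0 {\<lambda>_. complex_of_real (hbar N)}"
  by (rule derives_cong[OF derives_input[of K "In_hbar"]]) (auto simp: data_env_def)

lemma hbar_nonzero: "hbar N \<noteq> 0"
proof -
  have "1 < real N ^ 2" using N2 by (simp add: one_less_power)
  then show ?thesis by (simp add: hbar_def)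
qed

lemma derives_main_diag:
  assumes "a = 0 \<or> b = 0" "i < N - a - b"
  shows "derives K 1 {\<lambda>_. main_diag (N - 1) a b i}"
proof -
  have "derives K (0 + 1) {\<lambda>e. - data_env N e (In_lap (a + b) i i)}"
    by (intro derives_uminus derives_input)
  then have "derives K 1 {\<lambda>e. - data_env N e (In_lap (a + b) i i)}" by simp
  then show ?thesis
  proof (rule derives_cong)
    fix e :: step_data
    have s: "lap_main n p q = lap_main n q p" for n p q by (simp add: lap_main_def)
    have "i + (a + b) < N" using assms by auto
    then have "data_env N e (In_lap (a + b) i i) = - complex_of_real (lap_main (N - 1) i (i + (a + b)))"
      by (simp add: data_env_def lap_diag_entry_main split: prod.split)
    also have "lap_main (N - 1) i (i + (a + b)) = lap_main (N - 1) (a + i) (b + i)"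
      using assms(1) s[of "N - 1" i "a + i"] by (auto simp: add.commute)
    finally show "- data_env N e (In_lap (a + b) i i) = main_diag (N - 1) a b i" by simp
  qed
qed

lemma derives_off_diag:
  assumes "a = 0 \<or> b = 0" "i < N - a - b"
  shows "derives K 0 {\<lambda>_. off_diag (N - 1) a b i}"
proof (cases "Suc i < N - a - b")
  case True
  show ?thesis
  proof (rule derives_cong[OF derives_input[of K "In_lap (a + b) i (i + 1)"]])
    fix e :: step_data
    have s: "lap_off n p q = lap_off n q p" for n p q by (simp add: lap_off_def mult.commute)
    have "i + (a + b) + 1 < N" using True by auto
    then have "data_env N e (In_lap (a + b) i (i + 1)) = complex_of_real (lap_off (N - 1) i (i + (a + b)))"
      by (simp add: data_env_def lap_diag_entry_off[simplified] split: prod.split)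
    also have "lap_off (N - 1) i (i + (a + b)) = lap_off (N - 1) (a + i) (b + i)"
      using assms(1) s[of "N - 1" i "a + i"] by (auto simp: add.commute)
    finally show "data_env N e (In_lap (a + b) i (i + 1)) = off_diag (N - 1) a b i" .
  qed
next
  case False
  then have "a + i = N - 1 \<or> b + i = N - 1" using assms by auto
  then have "off_diag (N - 1) a b i = 0" by (auto simp: lap_off_def)
  then show ?thesis by (simp add: derives_zero)
qed

subsection \<open>The band of the stream matrix\<close>

lemma derives_diag_solution:
  fixes X :: "step_data \<Rightarrow> complex mat"
  assumes ab: "a = 0 \<or> b = 0" "a + b < N"
    and X: "\<And>i. i < N - a - b \<Longrightarrow> derives K 0 {\<lambda>e. X e $$ (a + i, b + i)}"
    and m: "a = b \<Longrightarrow> derives K 0 {\<lambda>e. (\<Sum>k<N. X e $$ (k, k)) / of_nat N}"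
  shows "derives K (12 * N) ((\<lambda>i e. diag_solution N a b (shifted_diag N (X e) a b) i) ` {..<N - a - b})"
proof -
  define L where "L = N - a - b"
  define d where "d i e = main_diag (N - 1) a b i" for i and e :: step_data
  define w where "w i e = off_diag (N - 1) a b i" for i and e :: step_data
  define x where "x i e = shifted_diag N (X e) a b i" for i e
  define z where "z e = (if a = b then 0 else elim_rhs (\<lambda>i. d i e) (\<lambda>i. w i e) (\<lambda>i. x i e) (L - 1) / elim_pivot (\<lambda>i. d i e) (\<lambda>i. w i e) (L - 1))" for e
  have piv: "elim_pivot (\<lambda>i. d i e) (\<lambda>i. w i e) i \<noteq> 0" if "i < L" "Suc i < L \<or> a \<noteq> b" for i e
    unfolding d_def w_def by (rule lap_pivot_nonzero) (use ab that in \<open>auto simp: L_def\<close>)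
  have 1: "derives K (L * 1) (\<Union>i<L. {d i})"
    by (rule derives_family) (use ab derives_main_diag in \<open>auto simp: d_def[abs_def] L_def\<close>)
  have 2: "derives K (L * 1) (\<Union>i<L. {x i})"
  proof (rule derives_family)
    fix i assume i: "i < L"
    have "derives K (0 + 0 + 1) {\<lambda>e. (if a = b then (\<Sum>k<N. X e $$ (k, k)) / of_nat N else 0) - X e $$ (a + i, b + i)}"
    proof (intro derives_diff X)
      show "derives K 0 {\<lambda>e. if a = b then (\<Sum>k<N. X e $$ (k, k)) / of_nat N else 0}"
        using m derives_zero by (cases "a = b") auto
    qed (use i in \<open>simp add: L_def\<close>)
    then show "derives K 1 {x i}" by (simp add: x_def[abs_def] shifted_diag_def)
  qed
  let ?K = "K \<union> ((\<Union>i<L. {d i}) \<union> (\<Union>i<L. {x i}))"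
  have 3: "derives ?K (10 * L) ((\<lambda>k e. back_subst (\<lambda>i. d i e) (\<lambda>i. w i e) (\<lambda>i. x i e) L (z e) k) ` {..<L})"
  proof (rule derives_back_subst)
    show "derives ?K 0 {w i}" if "i < L" for i
      using derives_off_diag[OF ab(1)] that by (simp add: w_def[abs_def] L_def)
    fix K' assume L0: "0 < L" and P: "derives K' 0 {\<lambda>e. elim_pivot (\<lambda>i. d i e) (\<lambda>i. w i e) (L - 1)}"
      and R: "derives K' 0 {\<lambda>e. elim_rhs (\<lambda>i. d i e) (\<lambda>i. w i e) (\<lambda>i. x i e) (L - 1)}"
    show "derives K' 1 {z}"
    proof (cases "a = b")
      case True
      then show ?thesis by (auto simp: z_def[abs_def] intro: derives_le[OF derives_zero])
    next
      case False
      have "derives K' (0 + 0 + 1) {\<lambda>e. elim_rhs (\<lambda>i. d i e) (\<lambda>i. w i e) (\<lambda>i. x i e) (L - 1) / elim_pivot (\<lambda>i. d i e) (\<lambda>i. w i e) (L - 1)}"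
        by (intro derives_divide P R piv) (use L0 False in auto)
      then show ?thesis using False by (simp add: z_def[abs_def])
    qed
  qed (auto intro!: derives_mem simp: piv)
  have "derives K (L * 1 + L * 1 + 10 * L) ((\<lambda>k e. back_subst (\<lambda>i. d i e) (\<lambda>i. w i e) (\<lambda>i. x i e) L (z e) k) ` {..<L})"
    by (rule derives_then[OF derives_Un[OF 1 2] 3])
  then show ?thesis
  proof (rule derives_mono)
    show "(\<lambda>i e. diag_solution N a b (shifted_diag N (X e) a b) i) ` {..<N - a - b}
      \<subseteq> (\<lambda>k e. back_subst (\<lambda>i. d i e) (\<lambda>i. w i e) (\<lambda>i. x i e) L (z e) k) ` {..<L}"
    proof (rule image_subsetI)
      fix i assume i: "i \<in> {..<N - a - b}"
      have "(\<lambda>e. diag_solution N a b (shifted_diag N (X e) a b) i) = (\<lambda>e. back_subst (\<lambda>i. d i e) (\<lambda>i. w i e) (\<lambda>i. x i e) L (z e) (L - 1 - i))"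
        unfolding diag_solution_def Let_def z_def d_def w_def x_def L_def ..
      then show "(\<lambda>e. diag_solution N a b (shifted_diag N (X e) a b) i) \<in> (\<lambda>k e. back_subst (\<lambda>i. d i e) (\<lambda>i. w i e) (\<lambda>i. x i e) L (z e) k) ` {..<L}"
        using i by (auto simp: L_def)
    qed
  qed (auto simp: L_def)
qed

definition band :: "(nat \<Rightarrow> nat \<Rightarrow> step_data \<Rightarrow> complex) \<Rightarrow> (step_data \<Rightarrow> complex) set" where
  "band f = {f p q | p q. p < N \<and> q < N \<and> \<bar>int q - int p\<bar> \<le> int Nh}"

lemma band_mem: "p < N \<Longrightarrow> q < N \<Longrightarrow> \<bar>int q - int p\<bar> \<le> int Nh \<Longrightarrow> f p q \<in> band f"
  unfolding band_def by blast

lemma derives_band_poisson: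
  fixes X :: "step_data \<Rightarrow> complex mat"
  shows "derives (band (\<lambda>p q e. X e $$ (p, q))) (60 * N * Nh) (band (\<lambda>p q e. band_poisson N Nh (X e) $$ (p, q)))"
proof -
  define K where "K = band (\<lambda>p q e. X e $$ (p, q))"
  define sol where "sol a b i e = diag_solution N a b (shifted_diag N (X e) a b) i" for a b i e
  define m1 where "m1 e = (\<Sum>k<N. X e $$ (k, k)) / of_nat N" for e
  define m2 where "m2 e = (\<Sum>k<N. sol 0 0 k e) / of_nat N" for e
  have Xb: "derives (K \<union> K') 0 {\<lambda>e. X e $$ (p, q)}" if "p < N" "q < N" "\<bar>int q - int p\<bar> \<le> int Nh" for p q K'
    using band_mem[OF that, of "\<lambda>p q e. X e $$ (p, q)"] by (intro derives_mem) (simp add: K_def)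
  have N0: "(of_nat N :: complex) \<noteq> 0" using N2 by simp
  have 1: "derives K (2 * N) {m1}"
  proof -
    have "derives K (N * (0 + 1) + 0 + 1) {\<lambda>e. (\<Sum>k<N. X e $$ (k, k)) / of_nat N}"
      by (intro derives_divide derives_sum derives_of_nat N0) (use Xb[of _ _ "{}"] in auto)
    then show ?thesis unfolding m1_def[abs_def] by (rule derives_le) (use N2 in simp)
  qed
  define blk where "blk k = sol k 0 ` {..<N - k} \<union> sol 0 k ` {..<N - k}" for k
  have 2: "derives (K \<union> {m1}) (Suc Nh * (24 * N)) (\<Union>k<Suc Nh. blk k)"
  proof (rule derives_family)
    fix k assume k: "k < Suc Nh"
    then have kN: "k < N" using Nh by simp
    have "derives (K \<union> {m1}) (12 * N + 12 * N) (blk k)"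
      unfolding blk_def
    proof (rule derives_Un)
      have "derives (K \<union> {m1}) (12 * N) ((\<lambda>i e. diag_solution N k 0 (shifted_diag N (X e) k 0) i) ` {..<N - k - 0})"
      proof (rule derives_diag_solution)
        show "derives (K \<union> {m1}) 0 {\<lambda>e. X e $$ (k + i, 0 + i)}" if "i < N - k - 0" for i
          by (rule Xb) (use that k kN in auto)
        show "derives (K \<union> {m1}) 0 {\<lambda>e. (\<Sum>k<N. X e $$ (k, k)) / of_nat N}"
          by (rule derives_mem) (simp add: m1_def[abs_def])
      qed (use kN in auto)
      then show "derives (K \<union> {m1}) (12 * N) (sol k 0 ` {..<N - k})" by (simp add: sol_def[abs_def])
      have "derives (K \<union> {m1}) (12 * N) ((\<lambda>i e. diag_solution N 0 k (shifted_diag N (X e) 0 k) i) ` {..<N - 0 - k})"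
      proof (rule derives_diag_solution)
        show "derives (K \<union> {m1}) 0 {\<lambda>e. X e $$ (0 + i, k + i)}" if "i < N - 0 - k" for i
          by (rule Xb) (use that k kN in auto)
        show "derives (K \<union> {m1}) 0 {\<lambda>e. (\<Sum>k<N. X e $$ (k, k)) / of_nat N}"
          by (rule derives_mem) (simp add: m1_def[abs_def])
      qed (use kN in auto)
      then show "derives (K \<union> {m1}) (12 * N) (sol 0 k ` {..<N - k})" by (simp add: sol_def[abs_def])
    qed
    then show "derives (K \<union> {m1}) (24 * N) (blk k)" by (rule derives_le) simp
  qed
  let ?K2 = "K \<union> ({m1} \<union> (\<Union>k<Suc Nh. blk k))"
  have sol: "derives (?K2 \<union> K') 0 {sol a b i}" if "a = 0 \<or> b = 0" "a + b \<le> Nh" "i < N - (a + b)" for a b i K'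
  proof (rule derives_mem)
    have "sol a b i \<in> blk (a + b)" using that by (auto simp: blk_def)
    moreover have "a + b < Suc Nh" using that by simp
    ultimately show "sol a b i \<in> ?K2 \<union> K'" by blast
  qed
  have 3: "derives ?K2 (2 * N) {m2}"
  proof -
    have "derives ?K2 (N * (0 + 1) + 0 + 1) {\<lambda>e. (\<Sum>k<N. sol 0 0 k e) / of_nat N}"
      by (intro derives_divide derives_sum derives_of_nat N0) (use sol[of 0 0 _ "{}"] in auto)
    then show ?thesis unfolding m2_def[abs_def] by (rule derives_le) (use N2 in simp)
  qed
  have 4: "derives (?K2 \<union> {m2}) (N * 1) (\<Union>k<N. {\<lambda>e. sol 0 0 k e - m2 e})"
  proof (rule derives_family)
    fix k assume k: "k < N"
    have "derives (?K2 \<union> {m2}) (0 + 0 + 1) {\<lambda>e. sol 0 0 k e - m2 e}"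
      by (intro derives_diff sol) (use k in \<open>auto intro!: derives_mem\<close>)
    then show "derives (?K2 \<union> {m2}) 1 {\<lambda>e. sol 0 0 k e - m2 e}" by simp
  qed
  have all: "derives K (2 * N + Suc Nh * (24 * N) + (2 * N + N * 1)) (({m1} \<union> (\<Union>k<Suc Nh. blk k)) \<union> ({m2} \<union> (\<Union>k<N. {\<lambda>e. sol 0 0 k e - m2 e})))"
    by (rule derives_seq[OF derives_seq[OF 1 2] derives_seq[OF 3 4]])
  have "derives K (60 * N * Nh) (({m1} \<union> (\<Union>k<Suc Nh. blk k)) \<union> ({m2} \<union> (\<Union>k<N. {\<lambda>e. sol 0 0 k e - m2 e})))"
  proof (rule derives_le[OF all])
    have "N \<le> N * Nh" using Nh by simp
    moreover have "2 * N + Suc Nh * (24 * N) + (2 * N + N * 1) = 24 * (N * Nh) + 29 * N" by (simp add: algebra_simps)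
    ultimately show "2 * N + Suc Nh * (24 * N) + (2 * N + N * 1) \<le> 60 * N * Nh" by linarith
  qed
  then show ?thesis unfolding K_def[symmetric]
  proof (rule derives_mono)
    show "band (\<lambda>p q e. band_poisson N Nh (X e) $$ (p, q)) \<subseteq>
      ({m1} \<union> (\<Union>k<Suc Nh. blk k)) \<union> ({m2} \<union> (\<Union>k<N. {\<lambda>e. sol 0 0 k e - m2 e}))"
    proof
      fix f assume "f \<in> band (\<lambda>p q e. band_poisson N Nh (X e) $$ (p, q))"
      then obtain p q where f: "f = (\<lambda>e. band_poisson N Nh (X e) $$ (p, q))"
        and pq: "p < N" "q < N" "\<bar>int q - int p\<bar> \<le> int Nh" unfolding band_def by blast
      have fe: "f = (\<lambda>e. sol (p - q) (q - p) (min p q) e - (if p = q then m2 e else 0))"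
        unfolding f using pq by (auto simp: band_poisson_def sol_def m2_def)
      show "f \<in> ({m1} \<union> (\<Union>k<Suc Nh. blk k)) \<union> ({m2} \<union> (\<Union>k<N. {\<lambda>e. sol 0 0 k e - m2 e}))"
      proof (cases "p = q")
        case True
        then show ?thesis using pq fe by auto
      next
        case False
        define k where "k = (p - q) + (q - p)"
        have "f = sol (p - q) (q - p) (min p q)" using False by (simp add: fe)
        moreover have "sol (p - q) (q - p) (min p q) \<in> blk k"
        proof (cases "p \<le> q")
          case True
          then show ?thesis using pq by (auto simp: blk_def k_def)
        next
          case False
          then show ?thesis using pq by (auto simp: blk_def k_def)
        qed
        moreover have "k < Suc Nh" using pq by (auto simp: k_def)
        ultimately show ?thesis by blast
      qed
    qed
  qed auto
qed


subsection \<open>The vector field\<close>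

definition stf where "stf i p t e = rkmk.St N Nh (S_of e) (U_of e) (a_of e) (dt_of e) i $$ (p, t)"
definition Ff where "Ff i p t e = rkmk.Fm N Nh (S_of e) (U_of e) (a_of e) (dt_of e) i $$ (p, t)"
definition Gf where "Gf i p t e = rkmk.Gm N Nh (S_of e) (U_of e) (a_of e) (dt_of e) i $$ (p, t)"
definition Vf where "Vf i p t e = rkmk.Vm N Nh (S_of e) (U_of e) (a_of e) (dt_of e) i $$ (p, t)"
definition Zf where "Zf i p t e = rkmk.Zm N Nh (S_of e) (U_of e) (a_of e) (dt_of e) i $$ (p, t)"
definition leftf where "leftf c p e = rkmk.left_col N r Nh (S_of e) (U_of e) (a_of e) (dt_of e) c p"
definition rightf where "rightf c p e = rkmk.right_col N r Nh (S_of e) (U_of e) (a_of e) (dt_of e) c p"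
definition gramf where "gramf c d e = rkmk.gram N r Nh (S_of e) (U_of e) (a_of e) (dt_of e) c d"
definition gramUf where "gramUf c t e = rkmk.gram_U N r Nh (S_of e) (U_of e) (a_of e) (dt_of e) c t"
definition coref where "coref i c d e = rkmk.core N r Nh (S_of e) (U_of e) (a_of e) (dt_of e) i c d"
definition solf where "solf i c t e = rkmk.core_sol N r Nh (S_of e) (U_of e) (a_of e) (dt_of e) i t c"

definition num_cols :: "nat \<Rightarrow> nat" where "num_cols i = (i - 1) * (2 * r)"

lemma num_cols_eq: "rkmk.col_count r i = num_cols i" if "e \<in> admissible_data N r"
  unfolding rkmk.col_count_def[OF rkmk[OF that]] num_cols_def ..

lemma stage_carrier:
  assumes "e \<in> admissible_data N r"
  shows "rkmk.St N Nh (S_of e) (U_of e) (a_of e) (dt_of e) i \<in> carrier_mat N r"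
    "rkmk.Fm N Nh (S_of e) (U_of e) (a_of e) (dt_of e) i \<in> carrier_mat N r"
  using rkmk.St_carrier[OF rkmk[OF assms]] rkmk.F_hat_facts(1)[OF rkmk[OF assms]]
  by (auto simp: rkmk.Fm_def[OF rkmk[OF assms]])

lemma derives_Ff: "derives (ents N r (stf i)) (90 * (N * Nh * r)) (ents N r (Ff i))"
proof -
  define dens where "dens e = rkmk.St N Nh (S_of e) (U_of e) (a_of e) (dt_of e) i * S_of e *
     mat_adjoint (rkmk.St N Nh (S_of e) (U_of e) (a_of e) (dt_of e) i)" for e
  define Pf where "Pf p q e = band_poisson N Nh (dens e) $$ (p, q)" for p q e
  let ?K = "ents N r (stf i)"
  \<comment> \<open>The band meets row \<open>p\<close> in the columns \<open>p + k - Nh\<close> with \<open>k < w\<close>, as far as these exist.\<close>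
  define w where "w = 2 * Nh + 1"
  have w: "w \<le> 3 * Nh" using Nh by (simp add: w_def)
  define inside where "inside p k \<longleftrightarrow> Nh \<le> p + k \<and> p + k - Nh < N" for p k
  have dens_entry: "dens e $$ (p, q) = (\<Sum>k<r. stf i p k e * Sf k e * cnj (stf i q k e))"
    if e: "e \<in> admissible_data N r" and pq: "p < N" "q < N" for e p q
  proof -
    let ?X = "rkmk.St N Nh (S_of e) (U_of e) (a_of e) (dt_of e) i"
    have X: "?X \<in> carrier_mat N r" by (rule stage_carrier[OF e])
    obtain s where s: "S_of e = mat_diag r s" using rkmk.S[OF rkmk[OF e]] by blast
    show ?thesis unfolding dens_def stf_def Sf_def by (rule diag_sandwich_entry[OF s X pq])
  qed
  have 1: "derives ?K (N * w * (4 * r)) (band (\<lambda>p q e. dens e $$ (p, q)))"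
  proof -
    define g where "g p k = (if inside p k then (\<lambda>e. dens e $$ (p, p + k - Nh)) else (\<lambda>_. 0))" for p k
    have "derives ?K (N * w * (4 * r)) (ents N w g)"
    proof (rule derives_ents)
      fix p k assume pk: "p < N" "k < w"
      show "derives ?K (4 * r) {g p k}"
      proof (cases "inside p k")
        case True
        let ?q = "p + k - Nh"
        have q: "?q < N" using True by (simp add: inside_def)
        have "derives ?K (r * (0 + 0 + 1 + (0 + 1) + 1 + 1)) {\<lambda>e. \<Sum>k<r. stf i p k e * Sf k e * cnj (stf i ?q k e)}"
          by (intro derives_sum derives_mult derives_cnj derives_S derives_mem) (use pk q in auto)
        then have "derives ?K (4 * r) {\<lambda>e. \<Sum>k<r. stf i p k e * Sf k e * cnj (stf i ?q k e)}"
          by (rule derives_le) simp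
        then show ?thesis by (rule derives_cong) (use True pk q in \<open>simp add: g_def dens_entry\<close>)
      next
        case False
        then show ?thesis by (auto simp: g_def intro: derives_le[OF derives_zero])
      qed
    qed
    then show ?thesis
    proof (rule derives_mono)
      show "band (\<lambda>p q e. dens e $$ (p, q)) \<subseteq> ents N w g"
      proof
        fix f assume "f \<in> band (\<lambda>p q e. dens e $$ (p, q))"
        then obtain p q where f: "f = (\<lambda>e. dens e $$ (p, q))" and pq: "p < N" "q < N" "\<bar>int q - int p\<bar> \<le> int Nh"
          unfolding band_def by blast
        have "f = g p (q + Nh - p)" "q + Nh - p < w" using pq by (auto simp: f g_def inside_def w_def)
        then show "f \<in> ents N w g" using pq by simp
      qed
    qed auto
  qed
  have 2: "derives (?K \<union> band (\<lambda>p q e. dens e $$ (p, q))) (60 * N * Nh) (band Pf)"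
    unfolding Pf_def[abs_def] by (rule derives_mono[OF derives_band_poisson]) auto
  let ?K2 = "?K \<union> (band (\<lambda>p q e. dens e $$ (p, q)) \<union> band Pf)"
  have F_entry: "Ff i p t e = (- (1 / complex_of_real (hbar N))) * (\<Sum>k<w. if inside p k then Pf p (p + k - Nh) e * stf i (p + k - Nh) t e else 0)"
    if e: "e \<in> admissible_data N r" and pt: "p < N" "t < r" for e p t
  proof -
    let ?X = "rkmk.St N Nh (S_of e) (U_of e) (a_of e) (dt_of e) i"
    have X: "?X \<in> carrier_mat N r" by (rule stage_carrier[OF e])
    have dc: "dens e \<in> carrier_mat N N" unfolding dens_def
      using rkmk.density_skew[OF rkmk[OF e] X] by (rule skew_hermD(1))
    have P: "P_hat N Nh (dens e) = band_poisson N Nh (dens e)" by (rule P_hat_eq[OF _ dc]) (use N2 in simp)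
    have bp: "band_poisson N Nh (dens e) \<in> carrier_mat N N" by (simp add: band_poisson_def)
    have "Ff i p t e = complex_of_real (- inverse (hbar N)) * (\<Sum>q<N. Pf p q e * ?X $$ (q, t))"
      unfolding Ff_def rkmk.Fm_def[OF rkmk[OF e]] F_hat_def dens_def[symmetric] P Pf_def
      using pt X bp by (simp add: scalar_prod_def lessThan_atLeast0)
    also have "(\<Sum>q<N. Pf p q e * ?X $$ (q, t)) = (\<Sum>q\<in>{q. q < N \<and> \<bar>int q - int p\<bar> \<le> int Nh}. Pf p q e * stf i q t e)"
      unfolding stf_def by (rule sum.mono_neutral_cong_right) (use pt in \<open>auto simp: Pf_def band_poisson_def\<close>)
    also have "\<dots> = (\<Sum>k\<in>{k. k < w \<and> inside p k}. Pf p (p + k - Nh) e * stf i (p + k - Nh) t e)"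
      by (rule sum.reindex_bij_witness[of _ "\<lambda>k. p + k - Nh" "\<lambda>q. q + Nh - p"])
        (auto simp: inside_def w_def)
    also have "\<dots> = (\<Sum>k<w. if inside p k then Pf p (p + k - Nh) e * stf i (p + k - Nh) t e else 0)"
      by (rule sum.mono_neutral_cong_left) auto
    finally show ?thesis by (simp add: inverse_eq_divide)
  qed
  have 3: "derives ?K2 (N * r * (2 * w + 3)) (ents N r (Ff i))"
  proof (rule derives_ents)
    fix p t assume pt: "p < N" "t < r"
    have tm: "derives ?K2 1 {\<lambda>e. if inside p k then Pf p (p + k - Nh) e * stf i (p + k - Nh) t e else 0}"
      if k: "k < w" for k
    proof (cases "inside p k")
      case True
      let ?q = "p + k - Nh"
      have q: "?q < N" "\<bar>int ?q - int p\<bar> \<le> int Nh" using True k by (auto simp: inside_def w_def)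
      have "derives ?K2 (0 + 0 + 1) {\<lambda>e. Pf p ?q e * stf i ?q t e}"
        by (intro derives_mult derives_mem) (use pt q band_mem[of p ?q Pf] in auto)
      then show ?thesis using True by simp
    qed (auto intro: derives_le[OF derives_zero])
    have "derives ?K2 (0 + 0 + 1 + 1 + w * (1 + 1) + 1) {\<lambda>e. (- (1 / complex_of_real (hbar N))) *
        (\<Sum>k<w. if inside p k then Pf p (p + k - Nh) e * stf i (p + k - Nh) t e else 0)}"
      by (intro derives_mult derives_uminus derives_divide derives_one derives_hbar derives_sum tm)
        (auto simp: hbar_nonzero)
    then have "derives ?K2 (2 * w + 3) {\<lambda>e. (- (1 / complex_of_real (hbar N))) *
        (\<Sum>k<w. if inside p k then Pf p (p + k - Nh) e * stf i (p + k - Nh) t e else 0)}"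
      by (rule derives_le) simp
    then show "derives ?K2 (2 * w + 3) {Ff i p t}"
      by (rule derives_cong) (simp only: F_entry[OF _ pt])
  qed
  have "derives ?K (N * w * (4 * r) + 60 * N * Nh + N * r * (2 * w + 3)) (ents N r (Ff i))"
    by (rule derives_then[OF derives_seq[OF 1 2] 3])
  then show ?thesis
  proof (rule derives_le)
    have "N * r * w \<le> N * r * (3 * Nh)" by (intro mult_le_mono2 w)
    moreover have "N * Nh * 1 \<le> N * Nh * r" "N * r * 1 \<le> N * r * Nh" using r Nh by (intro mult_le_mono2; simp)+
    moreover have "N * r * (3 * Nh) = 3 * (N * Nh * r)" "N * r * Nh = N * Nh * r" by simp_all
    moreover have "N * w * (4 * r) + 60 * N * Nh + N * r * (2 * w + 3) = 6 * (N * r * w) + 60 * (N * Nh * 1) + 3 * (N * r * 1)"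
      by (simp add: algebra_simps)
    ultimately show "N * w * (4 * r) + 60 * N * Nh + N * r * (2 * w + 3) \<le> 90 * (N * Nh * r)"
      by linarith
  qed
qed

lemma derives_Gf: "derives (ents N r (stf i) \<union> ents N r (Ff i)) (7 * (N * r * r)) (ents N r (Gf i))"
proof -
  let ?K = "ents N r (stf i) \<union> ents N r (Ff i)"
  define H where "H k t e = (\<Sum>q<N. cnj (stf i q k e) * Ff i q t e)" for k t e
  have 1: "derives ?K (r * r * (N * 3)) (ents r r H)"
  proof (rule derives_ents)
    fix k t assume "k < r" "t < r"
    then have "derives ?K (N * (0 + 1 + 0 + 1 + 1)) {\<lambda>e. \<Sum>q<N. cnj (stf i q k e) * Ff i q t e}"
      by (intro derives_sum derives_mult derives_cnj derives_mem) auto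
    then show "derives ?K (N * 3) {H k t}" unfolding H_def[abs_def] by (rule derives_le) simp
  qed
  have 2: "derives (?K \<union> ents r r H) (N * r * (r * 2 + 2)) (ents N r (Gf i))"
  proof (rule derives_ents)
    fix p t assume pt: "p < N" "t < r"
    have "derives (?K \<union> ents r r H) (0 + (r * (0 + 0 + 1 + 1) + 0 + 1) + 1)
       {\<lambda>e. Ff i p t e - (\<Sum>k<r. stf i p k e * H k t e) / 2}"
      by (intro derives_diff derives_divide derives_sum derives_mult derives_numeral derives_mem) (use pt in auto)
    then have "derives (?K \<union> ents r r H) (r * 2 + 2) {\<lambda>e. Ff i p t e - (\<Sum>k<r. stf i p k e * H k t e) / 2}"
      by (rule derives_le) simp
    then show "derives (?K \<union> ents r r H) (r * 2 + 2) {Gf i p t}"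
    proof (rule derives_cong)
      fix e assume e: "e \<in> admissible_data N r"
      note X = stage_carrier[OF e, of i]
      show "Ff i p t e - (\<Sum>k<r. stf i p k e * H k t e) / 2 = Gf i p t e"
        unfolding Gf_def rkmk.Gm_def[OF rkmk[OF e]] horizontal_def H_def Ff_def stf_def
        using X pt by (simp add: scalar_prod_def lessThan_atLeast0)
    qed
  qed
  have "derives ?K (r * r * (N * 3) + N * r * (r * 2 + 2)) (ents N r (Gf i))"
    by (rule derives_then[OF 1 2])
  then show ?thesis
  proof (rule derives_le)
    have "N * r \<le> N * r * r" using r by simp
    moreover have "r * r * (N * 3) + N * r * (r * 2 + 2) = 5 * (N * r * r) + 2 * (N * r)" by (simp add: algebra_simps)
    ultimately show "r * r * (N * 3) + N * r * (r * 2 + 2) \<le> 7 * (N * r * r)" by linarith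
  qed
qed


subsection \<open>Cost of one stage\<close>

text \<open>What the program keeps between two stages: the factors of \<open>\<Omega>\<close>, their Gram matrix, and \<open>Q\<^sup>*U\<close>.\<close>
definition factors :: "nat \<Rightarrow> (step_data \<Rightarrow> complex) set" where
  "factors i = ents (num_cols i) N leftf \<union> ents (num_cols i) N rightf \<union> ents (num_cols i) (num_cols i) gramf \<union> ents (num_cols i) r gramUf"

lemma derives_ents_cong:
  assumes "derives K c (ents p q x)" "\<And>e i j. e \<in> admissible_data N r \<Longrightarrow> x i j e = y i j e"
  shows "derives K c (ents p q y)"
proof (rule derives_cong_set[OF assms(1)])
  fix g assume "g \<in> ents p q y"
  then obtain i j where "g = y i j" "i < p" "j < q" by (auto simp: ents_def)
  then show "\<exists>f\<in>ents p q x. \<forall>e\<in>admissible_data N r. f e = g e"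
    using assms(2) by (intro bexI[of _ "x i j"]) auto
qed

lemma derives_stf:
  "derives (factors i) (22 * (num_cols i) ^ 3 + 4 * (num_cols i) ^ 2 + 9 * (r * (num_cols i) ^ 2) + N * r * (4 * num_cols i + 1)) (ents N r (stf i))"
proof -
  let ?n = "num_cols i" and ?K = "factors i"
  have 1: "derives ?K (?n * ?n * 4) (ents ?n ?n (coref i))"
  proof (rule derives_ents)
    fix c d assume cd: "c < ?n" "d < ?n"
    have "derives ?K (0 + (0 + 1 + 1 + 0 + 1) + 1) {\<lambda>e. (if c = d then 1 else 0) - gramf c d e * weightf i d e / 2}"
      by (intro derives_diff derives_divide derives_mult derives_numeral derives_weight)
        (use cd in \<open>auto simp: factors_def derives_one derives_zero intro!: derives_mem\<close>)
    then have "derives ?K 4 {\<lambda>e. (if c = d then 1 else 0) - gramf c d e * weightf i d e / 2}"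
      by (rule derives_le) simp
    then show "derives ?K 4 {coref i c d}"
      by (rule derives_cong) (simp add: coref_def gramf_def weightf_def rkmk.core_def[OF rkmk])
  qed
  have 2: "derives (?K \<union> ents ?n ?n (coref i)) (13 * ?n ^ 3 + 9 * r * ?n ^ 2) (ents ?n r (solf i))"
  proof -
    have "derives (ents ?n ?n (coref i) \<union> ents ?n r gramUf) (13 * ?n ^ 3 + 9 * r * ?n ^ 2)
       (ents ?n r (\<lambda>c t e. conj_solve (\<lambda>k j. coref i k j e) ?n (\<lambda>c. gramUf c t e) c))"
    proof (rule derives_conj_solve)
      fix e assume e: "e \<in> admissible_data N r"
      show "injective_system (\<lambda>k j. coref i k j e) ?n"
        using rkmk.core_injective[OF rkmk[OF e]] unfolding coref_def num_cols_eq[OF e] .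
    qed
    then have *: "derives (?K \<union> ents ?n ?n (coref i)) (13 * ?n ^ 3 + 9 * r * ?n ^ 2)
       (ents ?n r (\<lambda>c t e. conj_solve (\<lambda>k j. coref i k j e) ?n (\<lambda>c. gramUf c t e) c))"
      by (rule derives_mono) (auto simp: factors_def)
    have eq: "conj_solve (\<lambda>k j. coref i k j e) ?n (\<lambda>c. gramUf c t e) c = solf i c t e"
      if e: "e \<in> admissible_data N r" for e c t
      unfolding solf_def rkmk.core_sol_def[OF rkmk[OF e]] num_cols_eq[OF e] coref_def gramUf_def ..
    show ?thesis by (rule derives_ents_cong[OF * eq])
  qed
  let ?K2 = "?K \<union> (ents ?n ?n (coref i) \<union> ents ?n r (solf i))"
  have 3: "derives ?K2 (N * r * (4 * ?n + 1)) (ents N r (stf i))"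
  proof (rule derives_ents)
    fix p t assume pt: "p < N" "t < r"
    have "derives ?K2 (0 + ?n * (1 + 0 + 1 + 0 + 1 + 1) + 1)
       {\<lambda>e. Uf p t e + (\<Sum>c<?n. weightf i c e * leftf c p e * solf i c t e)}"
      by (intro derives_add derives_sum derives_mult derives_weight derives_U derives_mem)
        (use pt in \<open>auto simp: factors_def\<close>)
    then have "derives ?K2 (4 * ?n + 1) {\<lambda>e. Uf p t e + (\<Sum>c<?n. weightf i c e * leftf c p e * solf i c t e)}"
      by (rule derives_le) simp
    then show "derives ?K2 (4 * ?n + 1) {stf i p t}"
    proof (rule derives_cong)
      fix e assume e: "e \<in> admissible_data N r"
      show "Uf p t e + (\<Sum>c<?n. weightf i c e * leftf c p e * solf i c t e) = stf i p t e"
        unfolding stf_def rkmk.St_entry[OF rkmk[OF e] pt] num_cols_eq[OF e]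
        by (simp add: Uf_def weightf_def leftf_def solf_def)
    qed
  qed
  have "derives ?K (?n * ?n * 4 + (13 * ?n ^ 3 + 9 * r * ?n ^ 2) + N * r * (4 * ?n + 1)) (ents N r (stf i))"
    by (rule derives_then[OF derives_seq[OF 1 2] 3])
  then show ?thesis by (rule derives_le) (simp add: power2_eq_square)
qed

lemma derives_Zf: "derives (factors i) (N * r * (4 * num_cols i + 2)) (ents N r (Zf i))"
proof (rule derives_ents)
  let ?n = "num_cols i"
  fix p t assume pt: "p < N" "t < r"
  have "derives (factors i) (0 + (?n * (1 + 0 + 1 + 0 + 1 + 1) + 0 + 1) + 1)
     {\<lambda>e. Uf p t e + (\<Sum>c<?n. weightf i c e * leftf c p e * gramUf c t e) / 2}"
    by (intro derives_add derives_divide derives_sum derives_mult derives_weight derives_U derives_numeral derives_mem)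
      (use pt in \<open>auto simp: factors_def\<close>)
  then have "derives (factors i) (4 * ?n + 2) {\<lambda>e. Uf p t e + (\<Sum>c<?n. weightf i c e * leftf c p e * gramUf c t e) / 2}"
    by (rule derives_le) simp
  then show "derives (factors i) (4 * ?n + 2) {Zf i p t}"
  proof (rule derives_cong)
    fix e assume e: "e \<in> admissible_data N r"
    show "Uf p t e + (\<Sum>c<?n. weightf i c e * leftf c p e * gramUf c t e) / 2 = Zf i p t e"
      unfolding Zf_def rkmk.Zm_entry[OF rkmk[OF e] pt] num_cols_eq[OF e]
      by (simp add: Uf_def weightf_def leftf_def gramUf_def)
  qed
qed

lemma derives_Vf: "derives (factors i \<union> ents N r (Gf i)) (N * r * (7 * num_cols i + 2)) (ents N r (Vf i))"
proof -
  let ?n = "num_cols i" and ?K = "factors i \<union> ents N r (Gf i)"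
  define y where "y c t e = (\<Sum>q<N. cnj (rightf c q e) * Gf i q t e)" for c t e
  have 1: "derives ?K (?n * r * (N * 3)) (ents ?n r y)"
  proof (rule derives_ents)
    fix c t assume "c < ?n" "t < r"
    then have "derives ?K (N * (0 + 1 + 0 + 1 + 1)) {\<lambda>e. \<Sum>q<N. cnj (rightf c q e) * Gf i q t e}"
      by (intro derives_sum derives_mult derives_cnj derives_mem) (auto simp: factors_def)
    then show "derives ?K (N * 3) {y c t}" unfolding y_def[abs_def] by (rule derives_le) simp
  qed
  have 2: "derives (?K \<union> ents ?n r y) (N * r * (4 * ?n + 2)) (ents N r (Vf i))"
  proof (rule derives_ents)
    fix p t assume pt: "p < N" "t < r"
    have "derives (?K \<union> ents ?n r y) (0 + (?n * (1 + 0 + 1 + 0 + 1 + 1) + 0 + 1) + 1)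
       {\<lambda>e. Gf i p t e - (\<Sum>c<?n. weightf i c e * leftf c p e * y c t e) / 2}"
      by (intro derives_diff derives_divide derives_sum derives_mult derives_weight derives_numeral derives_mem)
        (use pt in \<open>auto simp: factors_def\<close>)
    then have "derives (?K \<union> ents ?n r y) (4 * ?n + 2) {\<lambda>e. Gf i p t e - (\<Sum>c<?n. weightf i c e * leftf c p e * y c t e) / 2}"
      by (rule derives_le) simp
    then show "derives (?K \<union> ents ?n r y) (4 * ?n + 2) {Vf i p t}"
    proof (rule derives_cong)
      fix e assume e: "e \<in> admissible_data N r"
      show "Gf i p t e - (\<Sum>c<?n. weightf i c e * leftf c p e * y c t e) / 2 = Vf i p t e"
        unfolding Vf_def rkmk.Vm_entry[OF rkmk[OF e] pt] num_cols_eq[OF e]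
        by (simp add: Gf_def weightf_def leftf_def rightf_def y_def)
    qed
  qed
  have "derives ?K (?n * r * (N * 3) + N * r * (4 * ?n + 2)) (ents N r (Vf i))"
    by (rule derives_then[OF 1 2])
  then show ?thesis by (rule derives_le) (simp add: algebra_simps)
qed

text \<open>Only the inner products that involve a new column are computed. Recomputing the whole Gram matrix
  would cost a further factor of \<open>Ns\<close>.\<close>
lemma derives_next_factors:
  assumes i: "1 \<le> i"
  defines "n' \<equiv> num_cols (Suc i)"
  shows "derives (factors i \<union> ents N r (Vf i) \<union> ents N r (Zf i)) (n' * N + 15 * (N * r * n')) (factors (Suc i))"
proof -
  let ?K = "factors i \<union> ents N r (Vf i) \<union> ents N r (Zf i)"
  define n where "n = num_cols i"
  have n': "n' = n + 2 * r" using i by (cases i) (auto simp: n'_def n_def num_cols_def)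
  have dm: "(n + t) div (2 * r) = i - 1" "(n + t) mod (2 * r) = t" if "t < 2 * r" for t
    using that unfolding n_def num_cols_def by auto
  have si: "Suc (i - 1) = i" using i by simp
  have new: "c < n \<or> (\<exists>t<2 * r. c = n + t)" if "c < n'" for c
    using that unfolding n' by (metis add_diff_inverse_nat nat_add_left_cancel_less)
  have left_new: "leftf (n + t) p e = (if t < r then Vf i p t e else Zf i p (t - r) e)"
    if "e \<in> admissible_data N r" "t < 2 * r" for t p e
    unfolding leftf_def rkmk.left_col_def[OF rkmk[OF that(1)]] dm[OF that(2)] si Let_def Vf_def Zf_def ..
  have right_new: "rightf (n + t) p e = (if t < r then Zf i p t e else - Vf i p (t - r) e)"
    if "e \<in> admissible_data N r" "t < 2 * r" for t p e
    unfolding rightf_def rkmk.right_col_def[OF rkmk[OF that(1)]] dm[OF that(2)] si Let_def Vf_def Zf_def ..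
  have L: "derives ?K 0 {leftf c p}" if "c < n'" "p < N" for c p
    using new[OF that(1)]
  proof
    assume "c < n"
    then show ?thesis using that by (intro derives_mem) (auto simp: factors_def n_def)
  next
    assume "\<exists>t<2 * r. c = n + t"
    then obtain t where t: "t < 2 * r" "c = n + t" by blast
    have "derives ?K 0 {if t < r then Vf i p t else Zf i p (t - r)}"
      using that t by (intro derives_mem) auto
    then show ?thesis by (rule derives_cong) (use t left_new in auto)
  qed
  have R: "derives ?K 1 {rightf c p}" if "c < n'" "p < N" for c p
    using new[OF that(1)]
  proof
    assume "c < n"
    then show ?thesis using that by (intro derives_le[OF derives_mem]) (auto simp: factors_def n_def)
  next
    assume "\<exists>t<2 * r. c = n + t"
    then obtain t where t: "t < 2 * r" "c = n + t" by blast
    show ?thesis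
    proof (cases "t < r")
      case True
      have "derives ?K 1 {Zf i p t}" using that True by (intro derives_le[OF derives_mem]) auto
      then show ?thesis by (rule derives_cong) (use t True right_new in auto)
    next
      case False
      have "derives ?K (0 + 1) {\<lambda>e. - Vf i p (t - r) e}"
        using that t False by (intro derives_uminus derives_mem) auto
      then have "derives ?K 1 {\<lambda>e. - Vf i p (t - r) e}" by simp
      then show ?thesis by (rule derives_cong) (use t False right_new in auto)
    qed
  qed
  have 1: "derives ?K (n' * N * 0 + n' * N * 1) (ents n' N leftf \<union> ents n' N rightf)"
    by (intro derives_Un derives_ents L R)
  let ?K1 = "?K \<union> (ents n' N leftf \<union> ents n' N rightf)"
  have gram: "derives ?K1 (3 * N) {gramf c d}" if "c < n'" "d < n'" for c d
  proof -
    have "derives ?K1 (N * (0 + 1 + 0 + 1 + 1)) {\<lambda>e. \<Sum>p<N. cnj (rightf c p e) * leftf d p e}"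
      using that by (intro derives_sum derives_mult derives_cnj derives_mem) auto
    then have "derives ?K1 (3 * N) {\<lambda>e. \<Sum>p<N. cnj (rightf c p e) * leftf d p e}" by (rule derives_le) simp
    then show ?thesis
      by (rule derives_cong) (simp add: gramf_def rkmk.gram_def[OF rkmk] rightf_def leftf_def)
  qed
  have gramU: "derives ?K1 (3 * N) {gramUf c t}" if "c < n'" "t < r" for c t
  proof -
    have "derives ?K1 (N * (0 + 1 + 0 + 1 + 1)) {\<lambda>e. \<Sum>p<N. cnj (rightf c p e) * Uf p t e}"
      using that by (intro derives_sum derives_mult derives_cnj derives_U derives_mem) auto
    then have "derives ?K1 (3 * N) {\<lambda>e. \<Sum>p<N. cnj (rightf c p e) * Uf p t e}" by (rule derives_le) simp
    then show ?thesis
      by (rule derives_cong) (simp add: gramUf_def rkmk.gram_U_def[OF rkmk] rightf_def Uf_def)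
  qed
  let ?G1 = "ents (2 * r) n' (\<lambda>t d. gramf (n + t) d)" and ?G2 = "ents n' (2 * r) (\<lambda>c t. gramf c (n + t))"
  have 2: "derives ?K1 (2 * r * n' * (3 * N) + n' * (2 * r) * (3 * N) + n' * r * (3 * N)) (?G1 \<union> ?G2 \<union> ents n' r gramUf)"
    by (intro derives_Un derives_ents gram gramU) (auto simp: n')
  have "derives ?K (n' * N * 0 + n' * N * 1 + (2 * r * n' * (3 * N) + n' * (2 * r) * (3 * N) + n' * r * (3 * N)))
    (?K \<union> (ents n' N leftf \<union> ents n' N rightf \<union> (?G1 \<union> ?G2 \<union> ents n' r gramUf)))"
    using derives_Un[OF derives_subset[of ?K ?K 0] derives_seq[OF 1 2]] by simp
  then show ?thesis
  proof (rule derives_mono)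
    have "gramf c d \<in> factors i \<union> ?G1 \<union> ?G2" if cd: "c < n'" "d < n'" for c d
    proof (cases "c < n \<and> d < n")
      case True then show ?thesis by (auto simp: factors_def n_def)
    next
      case False
      then consider t where "t < 2 * r" "c = n + t" | t where "t < 2 * r" "d = n + t" using new cd by blast
      then show ?thesis
      proof cases
        case 1
        then have "gramf c d \<in> ?G1" using ents_mem[of t "2 * r" d n' "\<lambda>t d. gramf (n + t) d"] cd by simp
        then show ?thesis by blast
      next
        case 2
        then have "gramf c d \<in> ?G2" using ents_mem[of c n' t "2 * r" "\<lambda>c t. gramf c (n + t)"] cd by simp
        then show ?thesis by blast
      qed
    qed
    then have "ents n' n' gramf \<subseteq> factors i \<union> ?G1 \<union> ?G2" unfolding ents_def[of n' n'] by blast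
    then show "factors (Suc i) \<subseteq> ?K \<union> (ents n' N leftf \<union> ents n' N rightf \<union> (?G1 \<union> ?G2 \<union> ents n' r gramUf))"
      unfolding factors_def[of "Suc i"] n'_def[symmetric] by blast
  qed (auto simp: algebra_simps)
qed

subsection \<open>Cost of the whole step\<close>

text \<open>An upper bound for every stage, with at most \<open>2 r Ns\<close> columns in the factors.\<close>
definition stage_cost :: nat where
  "stage_cost = 280 * (r ^ 3 * Ns ^ 3) + 86 * (N * r ^ 2 * Ns) + 90 * (N * Nh * r)"

lemma cost_bounds:
  assumes "n \<le> 2 * r * Ns"
  shows "n ^ 3 \<le> 8 * (r ^ 3 * Ns ^ 3)" "n ^ 2 \<le> 8 * (r ^ 3 * Ns ^ 3)" "r * n ^ 2 \<le> 8 * (r ^ 3 * Ns ^ 3)"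
    "N * r * n \<le> 2 * (N * r ^ 2 * Ns)" "n * N \<le> 2 * (N * r ^ 2 * Ns)"
    "N * r \<le> 2 * (N * r ^ 2 * Ns)" "N * r * r \<le> 2 * (N * r ^ 2 * Ns)"
proof -
  let ?B = "2 * r * Ns"
  have B3: "?B ^ 3 = 8 * (r ^ 3 * Ns ^ 3)" by (simp add: power_mult_distrib)
  have NB: "N * r * ?B = 2 * (N * r ^ 2 * Ns)" by (simp add: power2_eq_square)
  have 1: "1 \<le> ?B" "r \<le> ?B" "1 \<le> r" using r Ns by auto
  have "n ^ 3 \<le> ?B ^ 3" by (rule power_mono) (use assms in auto)
  then show "n ^ 3 \<le> 8 * (r ^ 3 * Ns ^ 3)" unfolding B3 .
  have n2: "n ^ 2 \<le> ?B ^ 2" by (rule power_mono) (use assms in auto)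
  have "1 * n ^ 2 \<le> ?B * ?B ^ 2" "r * n ^ 2 \<le> ?B * ?B ^ 2" using n2 1 by (intro mult_le_mono; simp)+
  moreover have "?B * ?B ^ 2 = ?B ^ 3" by (simp add: power3_eq_cube power2_eq_square)
  ultimately show "n ^ 2 \<le> 8 * (r ^ 3 * Ns ^ 3)" "r * n ^ 2 \<le> 8 * (r ^ 3 * Ns ^ 3)" unfolding B3 by simp_all
  have "N * r * n \<le> N * r * ?B" "N * 1 * n \<le> N * r * ?B" "N * r * 1 \<le> N * r * ?B" "N * r * r \<le> N * r * ?B"
    using assms 1 by (intro mult_le_mono; simp)+
  then show "N * r * n \<le> 2 * (N * r ^ 2 * Ns)" "n * N \<le> 2 * (N * r ^ 2 * Ns)"
    "N * r \<le> 2 * (N * r ^ 2 * Ns)" "N * r * r \<le> 2 * (N * r ^ 2 * Ns)"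
    unfolding NB by (simp_all add: mult.commute)
qed

lemma num_cols_le: "i \<le> Suc Ns \<Longrightarrow> num_cols i \<le> 2 * r * Ns"
  unfolding num_cols_def by (cases i) (auto simp: mult.commute)

lemma derives_stage_value:
  assumes "i \<le> Suc Ns"
  shows "derives (factors i) (280 * (r ^ 3 * Ns ^ 3) + 10 * (N * r ^ 2 * Ns)) (ents N r (stf i))"
proof (rule derives_le[OF derives_stf])
  note b = cost_bounds[OF num_cols_le[OF assms]]
  have "N * r * (4 * num_cols i + 1) = 4 * (N * r * num_cols i) + N * r" by (simp add: algebra_simps)
  then show "22 * num_cols i ^ 3 + 4 * (num_cols i)\<^sup>2 + 9 * (r * (num_cols i)\<^sup>2) + N * r * (4 * num_cols i + 1)
    \<le> 280 * (r ^ 3 * Ns ^ 3) + 10 * (N * r ^ 2 * Ns)"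
    using b by linarith
qed

lemma derives_stage:
  assumes i: "1 \<le> i" "i \<le> Ns"
  shows "derives (factors i) stage_cost (factors (Suc i))"
proof -
  let ?K = "factors i" and ?S = "ents N r (stf i)" and ?F = "ents N r (Ff i)" and ?G = "ents N r (Gf i)"
    and ?Z = "ents N r (Zf i)" and ?V = "ents N r (Vf i)"
  let ?n = "num_cols i" and ?n' = "num_cols (Suc i)"
  have 1: "derives ?K (280 * (r ^ 3 * Ns ^ 3) + 10 * (N * r ^ 2 * Ns)) ?S"
    using i by (intro derives_stage_value) simp
  have 2: "derives (?K \<union> ?S) (90 * (N * Nh * r)) ?F" by (rule derives_mono[OF derives_Ff]) auto
  have 3: "derives (?K \<union> (?S \<union> ?F)) (7 * (N * r * r)) ?G" by (rule derives_mono[OF derives_Gf]) auto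
  have 4: "derives (?K \<union> (?S \<union> ?F \<union> ?G)) (N * r * (7 * ?n + 2)) ?V" by (rule derives_mono[OF derives_Vf]) auto
  have 5: "derives (?K \<union> (?S \<union> ?F \<union> ?G \<union> ?V)) (N * r * (4 * ?n + 2)) ?Z" by (rule derives_mono[OF derives_Zf]) auto
  have 6: "derives (?K \<union> (?S \<union> ?F \<union> ?G \<union> ?V \<union> ?Z)) (?n' * N + 15 * (N * r * ?n')) (factors (Suc i))"
    by (rule derives_mono[OF derives_next_factors[OF i(1)]]) auto
  note all = derives_then[OF derives_seq[OF derives_seq[OF derives_seq[OF derives_seq[OF 1 2] 3] 4] 5] 6]
  show ?thesis
  proof (rule derives_le[OF all])
    have b: "num_cols i \<le> 2 * r * Ns" "num_cols (Suc i) \<le> 2 * r * Ns" using i by (auto intro!: num_cols_le)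
    have e: "N * r * (7 * ?n + 2) = 7 * (N * r * ?n) + 2 * (N * r)" "N * r * (4 * ?n + 2) = 4 * (N * r * ?n) + 2 * (N * r)"
      by (simp_all add: algebra_simps)
    show "280 * (r ^ 3 * Ns ^ 3) + 10 * (N * r\<^sup>2 * Ns) + 90 * (N * Nh * r) + 7 * (N * r * r) +
      N * r * (7 * ?n + 2) + N * r * (4 * ?n + 2) + (?n' * N + 15 * (N * r * ?n')) \<le> stage_cost"
      unfolding e stage_cost_def using cost_bounds(4,6,7)[OF b(1)] cost_bounds(4,5)[OF b(2)] by linarith
  qed
qed

lemma derives_all_factors: "derives {} (Ns * stage_cost) (factors (Suc Ns))"
proof -
  have "derives {} (Ns * stage_cost) (\<Union>k<Ns. factors (Suc (Suc k)))"
  proof (rule derives_recursion)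
    fix k assume k: "k < Ns"
    have "factors (Suc k) \<subseteq> {} \<union> (\<Union>j<k. factors (Suc (Suc j)))"
    proof (cases k)
      case 0
      then show ?thesis by (simp add: factors_def num_cols_def ents_def)
    qed auto
    then show "derives ({} \<union> (\<Union>j<k. factors (Suc (Suc j)))) stage_cost (factors (Suc (Suc k)))"
      using k by (intro derives_mono[OF derives_stage[of "Suc k"]]) auto
  qed
  moreover have "factors (Suc Ns) \<subseteq> (\<Union>k<Ns. factors (Suc (Suc k)))"
    using Ns by (intro UN_upper[of "Ns - 1", THEN subset_trans[rotated]]) auto
  ultimately show ?thesis by (auto intro: derives_mono)
qed

text \<open>There are \<open>Ns + 1 \<le> 2 Ns\<close> stages, of which the last is the final update.\<close>
lemma derives_step:
  "derives {} (560 * (r ^ 3 * Ns ^ 4) + 172 * (N * r ^ 2 * Ns ^ 2) + 180 * (N * Nh * r * Ns)) (ents N r (stf (Suc Ns)))"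
proof -
  have "derives ({} \<union> factors (Suc Ns)) stage_cost (ents N r (stf (Suc Ns)))"
    by (rule derives_mono[OF derives_stage_value[of "Suc Ns"]]) (auto simp: stage_cost_def)
  then have "derives {} (Ns * stage_cost + stage_cost) (ents N r (stf (Suc Ns)))"
    by (rule derives_then[OF derives_all_factors])
  then show ?thesis
  proof (rule derives_le)
    have "stage_cost \<le> Ns * stage_cost" using Ns by simp
    moreover have "2 * (Ns * stage_cost) = 560 * (r ^ 3 * Ns ^ 4) + 172 * (N * r ^ 2 * Ns ^ 2) + 180 * (N * Nh * r * Ns)"
      by (simp add: stage_cost_def algebra_simps power4_eq_xxxx power3_eq_cube power2_eq_square)
    ultimately show "Ns * stage_cost + stage_cost \<le> 560 * (r ^ 3 * Ns ^ 4) + 172 * (N * r ^ 2 * Ns ^ 2) + 180 * (N * Nh * r * Ns)"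
      by linarith
  qed
qed

lemma program_exists:
  "\<exists>prog out. length prog \<le> 560 * (r ^ 3 * Ns ^ 4) + 172 * (N * r ^ 2 * Ns ^ 2) + 180 * (N * Nh * r * Ns) \<and>
     (\<forall>e\<in>admissible_data N r. computes_matrix (data_env N e) prog out
       (rkmk.St N Nh (S_of e) (U_of e) (a_of e) (dt_of e) (Suc Ns)))"
proof -
  obtain prog where len: "length prog \<le> 560 * (r ^ 3 * Ns ^ 4) + 172 * (N * r ^ 2 * Ns ^ 2) + 180 * (N * Nh * r * Ns)"
    and run: "runs prog" and ex: "\<forall>f\<in>ents N r (stf (Suc Ns)). \<exists>x. holds prog x f"
    by (rule program_of_derives[OF derives_step])
  define out where "out i j = (SOME x. holds prog x (stf (Suc Ns) i j))" for i j
  have out: "holds prog (out i j) (stf (Suc Ns) i j)" if "i < N" "j < r" for i j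
    unfolding out_def by (rule someI_ex) (use ex that in auto)
  have "computes_matrix (data_env N e) prog out (rkmk.St N Nh (S_of e) (U_of e) (a_of e) (dt_of e) (Suc Ns))"
    if e: "e \<in> admissible_data N r" for e
  proof -
    let ?Y = "rkmk.St N Nh (S_of e) (U_of e) (a_of e) (dt_of e) (Suc Ns)"
    obtain rs where rs: "run_program (data_env N e) prog [] = Some rs" using run e by (auto simp: runs_def)
    have "operand_value (data_env N e) rs (out i j) = Some (?Y $$ (i, j))" if "i < N" "j < r" for i j
      using out[OF that] e rs by (auto simp: holds_def stf_def)
    then show ?thesis using rs carrier_matD[OF stage_carrier(1)[OF e, of "Suc Ns"]] by (auto simp: computes_matrix_def)
  qed
  with len show ?thesis by blast
qed

end

lemma rkmk_Omega_coeff_cong: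
  assumes "\<And>k. k \<le> i \<Longrightarrow> a k = a' k"
  shows "rkmk_Omega N \<Psi> L a dt U i = rkmk_Omega N \<Psi> L a' dt U i"
  using assms
proof (induction i rule: less_induct)
  case (less i)
  have "rkmk_Omega N \<Psi> L a dt U j = rkmk_Omega N \<Psi> L a' dt U j" if "j < i" for j
    using less.IH[OF that] less.prems that by simp
  then show ?case using less.prems[of i]
    by (subst (1 2) rkmk_Omega.simps) (auto simp: mat_lincomb_def intro!: arg_cong2[where f = "(\<cdot>\<^sub>m)"] eq_matI sum.cong)
qed

text \<open>The final update is one more stage whose coefficients are the weights \<open>b\<close>.\<close>
lemma rkmk_step_eq_stage:
  assumes "1 \<le> Ns"
  shows "rkmk_step N \<Psi> L Ns a b dt U = rkmk_stage N \<Psi> L (a(Suc Ns := b)) dt U (Suc Ns)"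
proof -
  let ?a = "a(Suc Ns := b)"
  have Om: "rkmk_Omega N \<Psi> L ?a dt U j = rkmk_Omega N \<Psi> L a dt U j" if "j \<le> Ns" for j
    by (rule rkmk_Omega_coeff_cong) (use that in auto)
  have "rkmk_Omega N \<Psi> L ?a dt U (Suc Ns) = complex_of_real dt \<cdot>\<^sub>m mat_lincomb N {1..Ns} b
    (\<lambda>i. inv_right_triv_tangent N \<Psi> (rkmk_Omega N \<Psi> L a dt U i) (L (rkmk_stage N \<Psi> L a dt U i)))"
    using assms Om by (subst rkmk_Omega.simps)
      (auto simp: mat_lincomb_def rkmk_stage_def atLeastLessThanSuc_atLeastAtMost intro!: arg_cong2[where f = "(\<cdot>\<^sub>m)"] eq_matI sum.cong)
  then show ?thesis using assms by (simp add: rkmk_step_def rkmk_stage_def)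
qed

text \<open>Subtracting the imaginary part of the eigenvalue leaves a skew-Hermitian matrix with a real
  eigenvalue, which must be zero.\<close>
lemma skew_herm_eigenvalue_imaginary:
  assumes W: "W \<in> skew_herm N" and k: "eigenvalue W k"
  shows "cnj k = - k"
proof -
  have Wc: "W \<in> carrier_mat N N" by (rule skew_hermD(1)[OF W])
  obtain v where v: "v \<in> carrier_vec N" "v \<noteq> 0\<^sub>v N" "W *\<^sub>v v = k \<cdot>\<^sub>v v"
    using k Wc by (auto simp: eigenvalue_def eigenvector_def)
  have Wv: "(\<Sum>j<N. W $$ (i, j) * v $ j) = k * v $ i" if "i < N" for i
  proof -
    have "(W *\<^sub>v v) $ i = (\<Sum>j<N. W $$ (i, j) * v $ j)"
      using that Wc v(1) by (simp add: scalar_prod_def lessThan_atLeast0)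
    then show ?thesis using v that by simp
  qed
  show ?thesis
  proof (rule ccontr)
    assume "cnj k \<noteq> - k"
    then have k0: "Re k \<noteq> 0" by (auto simp: complex_eq_iff)
    define W' where "W' = mat N N (\<lambda>(i, j). W $$ (i, j) - (if i = j then \<i> * of_real (Im k) else 0))"
    have W': "W' \<in> skew_herm N"
      by (rule skew_hermI) (auto simp: W'_def skew_herm_entry[OF W] intro!: eq_matI)
    have "v $ i = complex_of_real (1 / Re k) * (\<Sum>j<N. W' $$ (i, j) * v $ j)" if i: "i < N" for i
    proof -
      have "(\<Sum>j<N. W' $$ (i, j) * v $ j) = (\<Sum>j<N. W $$ (i, j) * v $ j - (if i = j then \<i> * of_real (Im k) * v $ j else 0))"
        using i by (intro sum.cong) (auto simp: W'_def left_diff_distrib)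
      also have "\<dots> = (k - \<i> * of_real (Im k)) * v $ i"
        using i by (simp add: sum_subtractf Wv left_diff_distrib)
      also have "k - \<i> * of_real (Im k) = of_real (Re k)" by (simp add: complex_eq_iff)
      finally show ?thesis using k0 by simp
    qed
    then have "v $ i = 0" if "i < N" for i by (rule skew_herm_no_real_eigenvector[OF W' _ that])
    then have "v = 0\<^sub>v N" using v(1) by (intro eq_vecI) auto
    then show False using v(2) by simp
  qed
qed

lemma dominant_eigenvalue_matrix_skew:
  assumes W: "W \<in> su_alg N" and S: "dominant_eigenvalue_matrix r W S"
  shows "\<exists>s. S = mat_diag r s \<and> (\<forall>i<r. cnj (s i) = - s i)"
proof -
  have Ws: "W \<in> skew_herm N" and Wc: "W \<in> carrier_mat N N" using W by (auto simp: su_alg_def skew_herm_def)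
  obtain es where es: "char_poly W = (\<Prod>e\<leftarrow>es. [:- e, 1:])" "r \<le> length es" "S = mat_diag r (\<lambda>i. es ! i)"
    using S by (auto simp: dominant_eigenvalue_matrix_def)
  have "cnj (es ! i) = - (es ! i)" if "i < r" for i
  proof (rule skew_herm_eigenvalue_imaginary[OF Ws])
    have "poly (char_poly W) (es ! i) = 0"
      unfolding es(1) poly_prod_list using that es(2) by (auto simp: prod_list_zero_iff intro!: image_eqI[of _ _ "es ! i"])
    then show "eigenvalue W (es ! i)" by (simp add: eigenvalue_root_char_poly[OF Wc])
  qed
  then show ?thesis using es(3) by blast
qed

theorem proposition5p3:
  shows "\<exists>C1 C2 C3 :: real. 0 \<le> C1 \<and> 0 \<le> C2 \<and> 0 \<le> C3 \<and>
    (\<forall>N r Nh Ns :: nat. 2 \<le> N \<and> 1 \<le> r \<and> r \<le> N \<and> 0 < Nh \<and> Nh \<le> N - 1 \<and> 1 \<le> Ns \<longrightarrow>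
      (\<exists>(prog :: step_input instr list) (out :: nat \<Rightarrow> nat \<Rightarrow> step_input operand).
         real (length prog) \<le>
             C1 * (real N * real r ^ 2 * real Ns ^ 2)
           + C2 * (real r ^ 3 * real Ns ^ 4)
           + C3 * (real N * real Nh * real r * real Ns) \<and>
         (\<forall>(W0 :: complex mat) (S0 :: complex mat) (U :: complex mat)
            (dt :: real) (a :: nat \<Rightarrow> nat \<Rightarrow> real) (b :: nat \<Rightarrow> real).
            W0 \<in> su_alg N \<and> dominant_eigenvalue_matrix r W0 S0 \<and> U \<in> stiefel r N \<and>
            0 < dt \<and> explicit_rk Ns a \<longrightarrow>
              computes_matrix (step_env N S0 a b dt U) prog out
                (rkmk_step N (cay N) (L_hat N Nh S0) Ns a b dt U))))"
proof (rule exI[of _ 172], rule exI[of _ 560], rule exI[of _ 180], intro conjI allI impI)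
  fix N r Nh Ns :: nat
  assume A: "2 \<le> N \<and> 1 \<le> r \<and> r \<le> N \<and> 0 < Nh \<and> Nh \<le> N - 1 \<and> 1 \<le> Ns"
  interpret step_program N r Nh Ns using A by unfold_locales auto
  obtain prog and out :: "nat \<Rightarrow> nat \<Rightarrow> step_input operand" where
    len: "length prog \<le> 560 * (r ^ 3 * Ns ^ 4) + 172 * (N * r ^ 2 * Ns ^ 2) + 180 * (N * Nh * r * Ns)"
    and prog: "\<And>e. e \<in> admissible_data N r \<Longrightarrow> computes_matrix (data_env N e) prog out
       (rkmk.St N Nh (S_of e) (U_of e) (a_of e) (dt_of e) (Suc Ns))"
    using program_exists by blast
  have "real (length prog) \<le> real (560 * (r ^ 3 * Ns ^ 4) + 172 * (N * r ^ 2 * Ns ^ 2) + 180 * (N * Nh * r * Ns))"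
    using len by (rule of_nat_mono)
  then have bound: "real (length prog) \<le> 172 * (real N * real r ^ 2 * real Ns ^ 2)
     + 560 * (real r ^ 3 * real Ns ^ 4) + 180 * (real N * real Nh * real r * real Ns)" by simp
  have comp: "computes_matrix (step_env N S0 a b dt U) prog out (rkmk_step N (cay N) (L_hat N Nh S0) Ns a b dt U)"
    if H: "W0 \<in> su_alg N" "dominant_eigenvalue_matrix r W0 S0" "U \<in> stiefel r N"
    for W0 S0 U :: "complex mat" and dt :: real and a :: "nat \<Rightarrow> nat \<Rightarrow> real" and b :: "nat \<Rightarrow> real"
  proof -
    let ?e = "(S0, U, dt, a, b)"
    have e: "?e \<in> admissible_data N r"
      using dominant_eigenvalue_matrix_skew[OF H(1,2)] H(3) by (simp add: admissible_data_def)
    have "rkmk.St N Nh S0 U (a(Suc Ns := b)) dt (Suc Ns) = rkmk_step N (cay N) (L_hat N Nh S0) Ns a b dt U"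
      using rkmk.St_def[OF rkmk[OF e], of Nh "a(Suc Ns := b)" dt "Suc Ns"] A by (simp add: rkmk_step_eq_stage)
    then show ?thesis using prog[OF e] by (simp add: data_env_def)
  qed
  show "\<exists>(prog :: step_input instr list) (out :: nat \<Rightarrow> nat \<Rightarrow> step_input operand).
         real (length prog) \<le>
             172 * (real N * real r ^ 2 * real Ns ^ 2)
           + 560 * (real r ^ 3 * real Ns ^ 4)
           + 180 * (real N * real Nh * real r * real Ns) \<and>
         (\<forall>(W0 :: complex mat) (S0 :: complex mat) (U :: complex mat)
            (dt :: real) (a :: nat \<Rightarrow> nat \<Rightarrow> real) (b :: nat \<Rightarrow> real).
            W0 \<in> su_alg N \<and> dominant_eigenvalue_matrix r W0 S0 \<and> U \<in> stiefel r N \<and>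
            0 < dt \<and> explicit_rk Ns a \<longrightarrow>
              computes_matrix (step_env N S0 a b dt U) prog out
                (rkmk_step N (cay N) (L_hat N Nh S0) Ns a b dt U))"
    by (intro exI[of _ prog] exI[of _ out] conjI allI impI bound) (elim conjE, rule comp)
qed simp_all

end
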